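(* Let $\pi:M\to N$ be a smooth fibre bundle, let $F_1$ be a Finsler function on $M$ with energy $E_1=\frac12F_1^2$, and let $h:\pi^*TN\to TM$ be the homogeneous nonlinear splitting induced by $F_1$. Assume that the canonical spray $S_1$ of $F_1$ is tangent to the horizontal submanifold $\mathrm{Im}\,h$ (equivalently, $Y^{\mathrm C}(E_1)\circ h=0$ for every $\pi$-vertical vector field $Y$ on $M$). Then the function $$F_2:=F_1\circ h$$ on $\pi^*TN$ determines a function on $TN$. Moreover, it is a Finsler function on $N$ with the property that $\pi$ is a Finsler submersion between the Finsler manifolds $(M,F_1)$ and $(N,F_2)$.
   Context: $\tau:TM\to M$, $\bar\tau:TN\to N$ are the tangent bundles; a ring $\mathring T$ denotes the tangent bundle with the zero section removed. $\pi^*TN=\{(m,v_n)\in M\times TN:\pi(m)=\bar\tau(v_n)\}$. That a function $f$ on $\pi^*TN$ determines a function on $TN$ means that $f(m,v_n)$ depends only on $v_n$. A Finsler function $F:TM\to\mathbb{R}$ is a non-negative continuous function, positively homogeneous of degree 1 on fibres, smooth on $\mathring TM$, and strongly convex: with $E=\frac12F^2$ and natural coordinates $(q^a,u^a)$ on $TM$, the matrix $\left(\frac{\partial^2E}{\partial u^a\partial u^b}\right)$ is positive definite at every point of $\mathring TM$. Its restriction to each $T_mM$ is a Minkowski norm $F_m$. For a vector field $X=X^a\,\partial/\partial q^a$ on $M$: vertical lift $X^{\mathrm V}=X^a\,\partial/\partial u^a$, complete lift $X^{\mathrm C}=X^a\,\partial/\partial q^a+u^b\frac{\partial X^a}{\partial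 q^b}\,\partial/\partial u^a$. A spray is a second-order vector field $S=u^a\,\partial/\partial q^a+f^a\,\partial/\partial u^a$ on $\mathring TM$ with $[\Delta,S]=S$, $\Delta=u^a\,\partial/\partial u^a$. The canonical spray of $F$ is the unique spray $S$ with $S(X^{\mathrm V}(E))-X^{\mathrm C}(E)=0$ for all vector fields $X$ on $M$. A vector field $Y$ on $M$ is $\pi$-vertical if $T\pi\circ Y=0$. The nonlinear splitting induced by a Finsler function $F$ on $M$ is the map $h:\pi^*TN\to TM$ (smooth on $\pi^*\mathring TN$) with $h(m,v_n)\in T_mM$, $T\pi(h(m,v_n))=v_n$, and $Y^{\mathrm V}(E)\circ h=0$ for all $\pi$-vertical $Y$; in bundle-adapted coordinates $(x^i,y^\alpha)$ with fibre coordinates $(v^i,w^\alpha)$, $h(x,y,v)=(x,y,v,h^\alpha(x,y,v))$, where $w^\alpha=h^\alpha(x,y,v)$ solves $\frac{\partial E}{\partial w^\alpha}=0$; $h(m,0)=0$. It satisfies $h(m,\lambda v_n)=\lambda h(m,v_n)$ for $\lambda>0$. Its image $\mathrm{Im}\,h$ is the horizontal (sub)manifold; tangency and the condition $Y^{\mathrm C}(E_1)\circ h=0$ are considered at vectors $h(m,v_n)$ with $v_n\neq0$. A surjective linear map $\mu:V_1\to V_2$ between Minkowski normed spaces $(V_1,\Phi_1)$, $(V_2,\Phi_2)$ is a submersion if $\mu(\{\Phi_1\le1\})=\{\Phi_2\le1\}$. A surjective map $\pi:(M,F_1)\to(N,F_2)$ between Finsler manifolds is a Finsler submersion if for each $m\in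 M$ the tangent map $T_m\pi:T_mM\to T_{\pi(m)}N$ is a submersion between the Minkowski spaces $(T_mM,(F_1)_m)$ and $(T_{\pi(m)}N,(F_2)_{\pi(m)})$.
   Formalization: The typical fibre of the bundle is assumed connected; without this the claim fails, e.g. for N=R and M two copies of R with F_1=|u| on one and 2|u| on the other, where tangency is automatic but F_1∘h depends on m. *)

theory Defs
  imports "HOL-Analysis.Analysis"
begin

section \<open>Smooth functions between finite-dimensional normed spaces\<close>

text \<open>Intended for open \<open>S\<close> and finite-dimensional domain.\<close>

primrec Ck_on :: "nat \<Rightarrow> 'a::real_normed_vector set \<Rightarrow> ('a \<Rightarrow> 'b::real_normed_vector) \<Rightarrow> bool" where
  "Ck_on 0 S f \<longleftrightarrow> continuous_on S f"
| "Ck_on (Suc k) S f \<longleftrightarrow>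
     (\<forall>x\<in>S. f differentiable (at x)) \<and> (\<forall>v. Ck_on k S (\<lambda>x. frechet_derivative f (at x) v))"

definition smooth_on :: "'a::real_normed_vector set \<Rightarrow> ('a \<Rightarrow> 'b::real_normed_vector) \<Rightarrow> bool" where
  "smooth_on S f \<longleftrightarrow> (\<forall>k. Ck_on k S f)"


section \<open>Smooth manifolds\<close>

text \<open>
  A chart is a pair \<open>(U, \<phi>)\<close>; the values of \<open>\<phi>\<close> outside \<open>U\<close> are irrelevant.  A manifold is given by
  an atlas (not assumed maximal), which determines both the set of points and the topology.
\<close>

type_synonym ('m, 'a) chart = "'m set \<times> ('m \<Rightarrow> 'a)"

abbreviation chart_inv :: "('m, 'a) chart \<Rightarrow> 'a \<Rightarrow> 'm" where
  "chart_inv c \<equiv> inv_into (fst c) (snd c)"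

definition points :: "('m, 'a) chart set \<Rightarrow> 'm set" where
  "points A = (\<Union>c\<in>A. fst c)"

definition smooth_atlas :: "('m, 'a::real_normed_vector) chart set \<Rightarrow> bool" where
  "smooth_atlas A \<longleftrightarrow>
     (\<forall>c\<in>A. inj_on (snd c) (fst c) \<and> open (snd c ` fst c)) \<and>
     (\<forall>c\<in>A. \<forall>d\<in>A. open (snd c ` (fst c \<inter> fst d)) \<and>
        smooth_on (snd c ` (fst c \<inter> fst d)) (snd d \<circ> chart_inv c))"

text \<open>The unique topology for which the charts are homeomorphisms between open sets.\<close>

definition mtopology :: "('m, 'a::real_normed_vector) chart set \<Rightarrow> 'm topology" where
  "mtopology A = topology (\<lambda>W. W \<subseteq> points A \<and> (\<forall>c\<in>A. open (snd c ` (W \<inter> fst c))))"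

text \<open>
  The model space is only required to be a finite-dimensional normed space, so that a
  zero-dimensional manifold is allowed as the typical fibre of a bundle.
\<close>

definition smooth_manifold :: "('m, 'a::real_normed_vector) chart set \<Rightarrow> bool" where
  "smooth_manifold A \<longleftrightarrow>
     (\<exists>B::'a set. finite B \<and> span B = UNIV) \<and>
     smooth_atlas A \<and> Hausdorff_space (mtopology A) \<and> second_countable (mtopology A)"

text \<open>\<open>f\<close> is smooth on the open subset \<open>S\<close> of \<open>A\<close>, with values in \<open>B\<close>.\<close>

definition smooth_map_on ::
  "('m, 'a::real_normed_vector) chart set \<Rightarrow> 'm set \<Rightarrow> ('n, 'b::real_normed_vector) chart set
     \<Rightarrow> ('m \<Rightarrow> 'n) \<Rightarrow> bool" where
  "smooth_map_on A S B f \<longleftrightarrow>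
     openin (mtopology A) S \<and>
     continuous_map (subtopology (mtopology A) S) (mtopology B) f \<and>
     (\<forall>c\<in>A. \<forall>d\<in>B. smooth_on (snd c ` (fst c \<inter> S \<inter> f -` fst d)) (snd d \<circ> f \<circ> chart_inv c))"

definition diffeo_on ::
  "('m, 'a::real_normed_vector) chart set \<Rightarrow> 'm set \<Rightarrow> ('n, 'b::real_normed_vector) chart set
     \<Rightarrow> 'n set \<Rightarrow> ('m \<Rightarrow> 'n) \<Rightarrow> bool" where
  "diffeo_on A S B T f \<longleftrightarrow>
     bij_betw f S T \<and> smooth_map_on A S B f \<and> smooth_map_on B T A (inv_into S f)"

definition vs_atlas :: "('a, 'a::real_normed_vector) chart set" where
  "vs_atlas = {(UNIV, id)}"

definition prod_atlas ::
  "('m, 'a) chart set \<Rightarrow> ('n, 'b) chart set \<Rightarrow> ('m \<times> 'n, 'a \<times> 'b) chart set" where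
  "prod_atlas A B = {(fst c \<times> fst d, map_prod (snd c) (snd d)) | c d. c \<in> A \<and> d \<in> B}"


section \<open>Smooth fibre bundles\<close>

definition smooth_fibre_bundle ::
  "('m, 'a::real_normed_vector) chart set \<Rightarrow> ('n, 'b::real_normed_vector) chart set
     \<Rightarrow> ('f, 'k::real_normed_vector) chart set \<Rightarrow> ('m \<Rightarrow> 'n) \<Rightarrow> bool" where
  "smooth_fibre_bundle AM AN AF \<pi> \<longleftrightarrow>
     smooth_manifold AM \<and> smooth_manifold AN \<and> smooth_manifold AF \<and>
     smooth_map_on AM (points AM) AN \<pi> \<and> \<pi> ` points AM = points AN \<and>
     (\<forall>n\<in>points AN. \<exists>U \<Phi>. openin (mtopology AN) U \<and> n \<in> U \<and>
        diffeo_on AM (points AM \<inter> \<pi> -` U) (prod_atlas AN AF) (U \<times> points AF) \<Phi> \<and>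
        (\<forall>m \<in> points AM \<inter> \<pi> -` U. fst (\<Phi> m) = \<pi> m))"


section \<open>Tangent vectors\<close>

text \<open>
  A tangent vector at \<open>p\<close> is \<open>p\<close> together with the family of its components in all charts around
  \<open>p\<close>, related by the Jacobians of the transition maps; the components at all other indices are
  set to zero, so that equality of tangent vectors is equality of pairs.
\<close>

type_synonym ('m, 'a) tangent = "'m \<times> (('m, 'a) chart \<Rightarrow> 'a)"

definition tangent_space ::
  "('m, 'a::real_normed_vector) chart set \<Rightarrow> 'm \<Rightarrow> ('m, 'a) tangent set" where
  "tangent_space A p = {(p, \<xi>) | \<xi>.
     (\<forall>c\<in>A. \<forall>d\<in>A. p \<in> fst c \<and> p \<in> fst d \<longrightarrow>
        \<xi> d = frechet_derivative (snd d \<circ> chart_inv c) (at (snd c p)) (\<xi> c)) \<and>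
     (\<forall>c. \<not> (c \<in> A \<and> p \<in> fst c) \<longrightarrow> \<xi> c = 0)}"

definition tadd :: "('m, 'a::real_normed_vector) tangent \<Rightarrow> ('m, 'a) tangent \<Rightarrow> ('m, 'a) tangent" where
  "tadd v w = (fst v, \<lambda>c. snd v c + snd w c)"

definition tscale :: "real \<Rightarrow> ('m, 'a::real_normed_vector) tangent \<Rightarrow> ('m, 'a) tangent" where
  "tscale r v = (fst v, \<lambda>c. r *\<^sub>R snd v c)"

definition tzero :: "'m \<Rightarrow> ('m, 'a::real_normed_vector) tangent" where
  "tzero p = (p, \<lambda>c. 0)"

definition TM :: "('m, 'a::real_normed_vector) chart set \<Rightarrow> ('m, 'a) tangent set" where
  "TM A = (\<Union>p\<in>points A. tangent_space A p)"

definition slit_TM :: "('m, 'a::real_normed_vector) chart set \<Rightarrow> ('m, 'a) tangent set" where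
  "slit_TM A = {v \<in> TM A. v \<noteq> tzero (fst v)}"

text \<open>The natural chart \<open>(q, u)\<close> of the tangent bundle.\<close>

definition tchart ::
  "('m, 'a::real_normed_vector) chart set \<Rightarrow> ('m, 'a) chart \<Rightarrow> (('m, 'a) tangent, 'a \<times> 'a) chart" where
  "tchart A c = ({v \<in> TM A. fst v \<in> fst c}, \<lambda>v. (snd c (fst v), snd v c))"

definition tatlas ::
  "('m, 'a::real_normed_vector) chart set \<Rightarrow> (('m, 'a) tangent, 'a \<times> 'a) chart set" where
  "tatlas A = tchart A ` A"

definition chart_at :: "('m, 'a) chart set \<Rightarrow> 'm \<Rightarrow> ('m, 'a) chart" where
  "chart_at A p = (SOME c. c \<in> A \<and> p \<in> fst c)"

text \<open>The tangent vector at \<open>p\<close> with components \<open>w\<close> in the chart \<open>c\<close>.\<close>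

definition tangent_of ::
  "('m, 'a::real_normed_vector) chart set \<Rightarrow> ('m, 'a) chart \<Rightarrow> 'm \<Rightarrow> 'a \<Rightarrow> ('m, 'a) tangent" where
  "tangent_of A c p w = (p, \<lambda>d. if d \<in> A \<and> p \<in> fst d
      then frechet_derivative (snd d \<circ> chart_inv c) (at (snd c p)) w else 0)"

text \<open>
  The notions below are given by their usual coordinate formulas in the arbitrarily chosen chart
  \<open>chart_at A p\<close>; for smooth arguments they do not depend on this choice.
\<close>

definition tangent_map ::
  "('m, 'a::real_normed_vector) chart set \<Rightarrow> ('n, 'b::real_normed_vector) chart set
     \<Rightarrow> ('m \<Rightarrow> 'n) \<Rightarrow> ('m, 'a) tangent \<Rightarrow> ('n, 'b) tangent" where
  "tangent_map A B f v =
     (let p = fst v; c = chart_at A p; d = chart_at B (f p) in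
        tangent_of B d (f p)
          (frechet_derivative (snd d \<circ> f \<circ> chart_inv c) (at (snd c p)) (snd v c)))"

text \<open>The derivative \<open>v(g)\<close> of the function \<open>g\<close> along the tangent vector \<open>v\<close>.\<close>

definition tderiv ::
  "('m, 'a::real_normed_vector) chart set \<Rightarrow> ('m, 'a) tangent \<Rightarrow> ('m \<Rightarrow> real) \<Rightarrow> real" where
  "tderiv A v g =
     (let c = chart_at A (fst v) in
        frechet_derivative (g \<circ> chart_inv c) (at (snd c (fst v))) (snd v c))"


section \<open>Vector fields and their lifts\<close>

definition vector_field_on ::
  "('m, 'a::real_normed_vector) chart set \<Rightarrow> 'm set \<Rightarrow> ('m \<Rightarrow> ('m, 'a) tangent) \<Rightarrow> bool" where
  "vector_field_on A S X \<longleftrightarrow>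
     (\<forall>p\<in>S. X p \<in> tangent_space A p) \<and> smooth_map_on A S (tatlas A) X"

abbreviation vector_field ::
  "('m, 'a::real_normed_vector) chart set \<Rightarrow> ('m \<Rightarrow> ('m, 'a) tangent) \<Rightarrow> bool" where
  "vector_field A X \<equiv> vector_field_on A (points A) X"

definition components :: "('m, 'a) chart \<Rightarrow> ('m \<Rightarrow> ('m, 'a) tangent) \<Rightarrow> 'a \<Rightarrow> 'a" where
  "components c X q = snd (X (chart_inv c q)) c"

definition lie_bracket ::
  "('m, 'a::real_normed_vector) chart set \<Rightarrow> ('m \<Rightarrow> ('m, 'a) tangent) \<Rightarrow> ('m \<Rightarrow> ('m, 'a) tangent)
     \<Rightarrow> 'm \<Rightarrow> ('m, 'a) tangent" where
  "lie_bracket A X Y p =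
     (let c = chart_at A p; q = snd c p in
        tangent_of A c p
          (frechet_derivative (components c Y) (at q) (components c X q) -
           frechet_derivative (components c X) (at q) (components c Y q)))"

definition vertical_lift ::
  "('m, 'a::real_normed_vector) chart set \<Rightarrow> ('m \<Rightarrow> ('m, 'a) tangent)
     \<Rightarrow> ('m, 'a) tangent \<Rightarrow> (('m, 'a) tangent, 'a \<times> 'a) tangent" where
  "vertical_lift A X v =
     (let c = chart_at A (fst v) in
        tangent_of (tatlas A) (tchart A c) v (0, components c X (snd c (fst v))))"

definition complete_lift ::
  "('m, 'a::real_normed_vector) chart set \<Rightarrow> ('m \<Rightarrow> ('m, 'a) tangent)
     \<Rightarrow> ('m, 'a) tangent \<Rightarrow> (('m, 'a) tangent, 'a \<times> 'a) tangent" where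
  "complete_lift A X v =
     (let c = chart_at A (fst v); q = snd c (fst v); u = snd v c in
        tangent_of (tatlas A) (tchart A c) v
          (components c X q, frechet_derivative (components c X) (at q) u))"

definition liouville ::
  "('m, 'a::real_normed_vector) chart set
     \<Rightarrow> ('m, 'a) tangent \<Rightarrow> (('m, 'a) tangent, 'a \<times> 'a) tangent" where
  "liouville A v =
     (let c = chart_at A (fst v) in tangent_of (tatlas A) (tchart A c) v (0, snd v c))"

definition proj_vertical ::
  "('m, 'a::real_normed_vector) chart set \<Rightarrow> ('n, 'b::real_normed_vector) chart set
     \<Rightarrow> ('m \<Rightarrow> 'n) \<Rightarrow> ('m \<Rightarrow> ('m, 'a) tangent) \<Rightarrow> bool" where
  "proj_vertical A B \<pi> Y \<longleftrightarrow> (\<forall>m\<in>points A. tangent_map A B \<pi> (Y m) = tzero (\<pi> m))"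


section \<open>Finsler functions and sprays\<close>

definition energy :: "(('m, 'a) tangent \<Rightarrow> real) \<Rightarrow> ('m, 'a) tangent \<Rightarrow> real" where
  "energy F v = (F v)\<^sup>2 / 2"

text \<open>
  The matrix of second partial derivatives of \<open>G(q, u)\<close> with respect to \<open>u\<close>, indexed by the
  standard basis.
\<close>

definition fibre_hessian ::
  "('a \<times> 'a::euclidean_space \<Rightarrow> real) \<Rightarrow> 'a \<times> 'a \<Rightarrow> 'a \<Rightarrow> 'a \<Rightarrow> real" where
  "fibre_hessian G z a b =
     frechet_derivative (\<lambda>y. frechet_derivative G (at y) (0, b)) (at z) (0, a)"

definition positive_definite :: "('a::euclidean_space \<Rightarrow> 'a \<Rightarrow> real) \<Rightarrow> bool" where
  "positive_definite H \<longleftrightarrow>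
     (\<forall>w. w \<noteq> 0 \<longrightarrow> (\<Sum>a\<in>Basis. \<Sum>b\<in>Basis. H a b * (w \<bullet> a) * (w \<bullet> b)) > 0)"

definition finsler_function ::
  "('m, 'a::euclidean_space) chart set \<Rightarrow> (('m, 'a) tangent \<Rightarrow> real) \<Rightarrow> bool" where
  "finsler_function A F \<longleftrightarrow>
     (\<forall>v\<in>TM A. F v \<ge> 0) \<and>
     continuous_map (mtopology (tatlas A)) euclideanreal F \<and>
     (\<forall>v\<in>TM A. \<forall>r>0. F (tscale r v) = r * F v) \<and>
     smooth_map_on (tatlas A) (slit_TM A) vs_atlas F \<and>
     (\<forall>c\<in>A. \<forall>v\<in>slit_TM A. fst v \<in> fst c \<longrightarrow>
        positive_definite
          (fibre_hessian (energy F \<circ> chart_inv (tchart A c)) (snd (tchart A c) v)))"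

definition spray ::
  "('m, 'a::real_normed_vector) chart set
     \<Rightarrow> (('m, 'a) tangent \<Rightarrow> (('m, 'a) tangent, 'a \<times> 'a) tangent) \<Rightarrow> bool" where
  "spray A S \<longleftrightarrow>
     vector_field_on (tatlas A) (slit_TM A) S \<and>
     (\<forall>v\<in>slit_TM A. \<forall>c\<in>A. fst v \<in> fst c \<longrightarrow> fst (snd (S v) (tchart A c)) = snd v c) \<and>
     (\<forall>v\<in>slit_TM A. lie_bracket (tatlas A) (liouville A) S v = S v)"

definition canonical_spray ::
  "('m, 'a::euclidean_space) chart set \<Rightarrow> (('m, 'a) tangent \<Rightarrow> real)
     \<Rightarrow> (('m, 'a) tangent \<Rightarrow> (('m, 'a) tangent, 'a \<times> 'a) tangent) \<Rightarrow> bool" where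
  "canonical_spray A F S \<longleftrightarrow>
     spray A S \<and>
     (\<forall>X. vector_field A X \<longrightarrow> (\<forall>v\<in>slit_TM A.
        tderiv (tatlas A) (S v) (\<lambda>w. tderiv (tatlas A) (vertical_lift A X w) (energy F))
        - tderiv (tatlas A) (complete_lift A X v) (energy F) = 0))"


section \<open>Nonlinear splittings\<close>

definition pullback ::
  "('m, 'a::real_normed_vector) chart set \<Rightarrow> ('n, 'b::real_normed_vector) chart set
     \<Rightarrow> ('m \<Rightarrow> 'n) \<Rightarrow> ('m \<times> ('n, 'b) tangent) set" where
  "pullback AM AN \<pi> = {(m, v). m \<in> points AM \<and> v \<in> TM AN \<and> \<pi> m = fst v}"

definition slit_pullback ::
  "('m, 'a::real_normed_vector) chart set \<Rightarrow> ('n, 'b::real_normed_vector) chart set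
     \<Rightarrow> ('m \<Rightarrow> 'n) \<Rightarrow> ('m \<times> ('n, 'b) tangent) set" where
  "slit_pullback AM AN \<pi> = {(m, v). m \<in> points AM \<and> v \<in> slit_TM AN \<and> \<pi> m = fst v}"

definition pullback_atlas ::
  "('m, 'a::real_normed_vector) chart set \<Rightarrow> ('n, 'b::real_normed_vector) chart set
     \<Rightarrow> ('m \<Rightarrow> 'n) \<Rightarrow> ('m \<times> ('n, 'b) tangent, 'a \<times> 'b) chart set" where
  "pullback_atlas AM AN \<pi> =
     {({(m, v) \<in> pullback AM AN \<pi>. m \<in> fst c \<and> fst v \<in> fst d}, \<lambda>(m, v). (snd c m, snd v d))
       | c d. c \<in> AM \<and> d \<in> AN}"

text \<open>
  The condition involving vertical lifts is imposed only at nonzero vectors, the energy not being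
  smooth along the zero section; there \<open>h\<close> is prescribed by the last clause.
\<close>

definition induced_splitting ::
  "('m, 'a::euclidean_space) chart set \<Rightarrow> ('n, 'b::euclidean_space) chart set \<Rightarrow> ('m \<Rightarrow> 'n)
     \<Rightarrow> (('m, 'a) tangent \<Rightarrow> real) \<Rightarrow> ('m \<times> ('n, 'b) tangent \<Rightarrow> ('m, 'a) tangent) \<Rightarrow> bool" where
  "induced_splitting AM AN \<pi> F h \<longleftrightarrow>
     (\<forall>(m, v) \<in> pullback AM AN \<pi>. h (m, v) \<in> tangent_space AM m \<and> tangent_map AM AN \<pi> (h (m, v)) = v) \<and>
     smooth_map_on (pullback_atlas AM AN \<pi>) (slit_pullback AM AN \<pi>) (tatlas AM) h \<and>
     (\<forall>Y. vector_field AM Y \<and> proj_vertical AM AN \<pi> Y \<longrightarrow>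
        (\<forall>x \<in> slit_pullback AM AN \<pi>.
           tderiv (tatlas AM) (vertical_lift AM Y (h x)) (energy F) = 0)) \<and>
     (\<forall>m\<in>points AM. h (m, tzero (\<pi> m)) = tzero m)"

text \<open>
  \<open>w\<close> is the velocity at time \<open>0\<close> of a smooth curve lying in \<open>P\<close>; for an embedded submanifold \<open>P\<close>
  this describes the tangent vectors to \<open>P\<close>.
\<close>

definition tangent_to ::
  "('m, 'a::real_normed_vector) chart set \<Rightarrow> 'm set \<Rightarrow> ('m, 'a) tangent \<Rightarrow> bool" where
  "tangent_to A P w \<longleftrightarrow>
     (\<exists>\<gamma> \<epsilon>. \<epsilon> > 0 \<and> smooth_map_on (vs_atlas :: (real, real) chart set) {-\<epsilon><..<\<epsilon>} A \<gamma> \<and>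
        \<gamma> ` {-\<epsilon><..<\<epsilon>} \<subseteq> P \<and>
        tangent_map vs_atlas A \<gamma> (tangent_of vs_atlas (UNIV, id) 0 1) = w)"

definition spray_tangent_to_image ::
  "('m, 'a::euclidean_space) chart set \<Rightarrow> ('n, 'b::euclidean_space) chart set \<Rightarrow> ('m \<Rightarrow> 'n)
     \<Rightarrow> ('m \<times> ('n, 'b) tangent \<Rightarrow> ('m, 'a) tangent)
     \<Rightarrow> (('m, 'a) tangent \<Rightarrow> (('m, 'a) tangent, 'a \<times> 'a) tangent) \<Rightarrow> bool" where
  "spray_tangent_to_image AM AN \<pi> h S \<longleftrightarrow>
     (\<forall>x \<in> slit_pullback AM AN \<pi>. tangent_to (tatlas AM) (h ` pullback AM AN \<pi>) (S (h x)))"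


section \<open>Submersions\<close>

definition minkowski_submersion ::
  "('m, 'a::real_normed_vector) tangent set \<Rightarrow> (('m, 'a) tangent \<Rightarrow> real)
     \<Rightarrow> ('n, 'b::real_normed_vector) tangent set \<Rightarrow> (('n, 'b) tangent \<Rightarrow> real)
     \<Rightarrow> (('m, 'a) tangent \<Rightarrow> ('n, 'b) tangent) \<Rightarrow> bool" where
  "minkowski_submersion V\<^sub>1 \<Phi>\<^sub>1 V\<^sub>2 \<Phi>\<^sub>2 \<mu> \<longleftrightarrow>
     (\<forall>v\<in>V\<^sub>1. \<forall>w\<in>V\<^sub>1. \<mu> (tadd v w) = tadd (\<mu> v) (\<mu> w)) \<and>
     (\<forall>v\<in>V\<^sub>1. \<forall>r. \<mu> (tscale r v) = tscale r (\<mu> v)) \<and>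
     \<mu> ` V\<^sub>1 = V\<^sub>2 \<and>
     \<mu> ` {v \<in> V\<^sub>1. \<Phi>\<^sub>1 v \<le> 1} = {w \<in> V\<^sub>2. \<Phi>\<^sub>2 w \<le> 1}"

definition finsler_submersion ::
  "('m, 'a::euclidean_space) chart set \<Rightarrow> (('m, 'a) tangent \<Rightarrow> real)
     \<Rightarrow> ('n, 'b::euclidean_space) chart set \<Rightarrow> (('n, 'b) tangent \<Rightarrow> real) \<Rightarrow> ('m \<Rightarrow> 'n) \<Rightarrow> bool" where
  "finsler_submersion AM F\<^sub>1 AN F\<^sub>2 \<pi> \<longleftrightarrow>
     \<pi> ` points AM = points AN \<and>
     (\<forall>m\<in>points AM. minkowski_submersion
        (tangent_space AM m) F\<^sub>1 (tangent_space AN (\<pi> m)) F\<^sub>2 (tangent_map AM AN \<pi>))"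

end

theory Submission
  imports Defs
begin

text \<open>
  Vertical vectors extend to global vertical vector fields \<open>Y\<close> by means of a local trivialisation and
  a bump function, so all conditions become pointwise conditions in charts.  The equations
  \<open>Y\<^sup>V(E) = 0\<close> cut out \<open>Im h\<close>, and \<open>S(Y\<^sup>V(E)) = Y\<^sup>C(E)\<close>; hence tangency of \<open>S\<close> forces
  \<open>Y\<^sup>C(E) = 0\<close> along \<open>Im h\<close>.  Conversely the curve in \<open>Im h\<close> with the same projection to first order as
  \<open>S\<close> differs from it by a vertical vector that lies in the kernel of the fibre Hessian of \<open>E\<close>.

  Along a fibre of \<open>\<pi>\<close> the derivative of \<open>E \<circ> h\<close> in the direction \<open>Y\<close> equals \<open>Y\<^sup>C(E) \<circ> h\<close>, because the
  two differ by a vertical vector, which \<open>dE\<close> annihilates at \<open>h\<close>; so \<open>E \<circ> h\<close> is constant on the connected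
  fibres.  By convexity \<open>h(m, v)\<close> minimises the norm over the vectors at \<open>m\<close> that project to \<open>v\<close>, which gives
  the submersion property, homogeneity, and continuity at the zero section, and the fibre Hessian
  of the pushed-down energy is the restriction of that of \<open>E\<close> to the image of the fibre derivative of \<open>h\<close>.
\<close>

section \<open>Calculus of smooth functions\<close>

text \<open>Why the comparison vectors are vertical: differentiating \<open>T\<pi> (h) = v\<close>
  along \<open>Y\<close>, and \<open>T\<pi> (Y) = 0\<close> along \<open>h\<close>, produces the
  same second derivative of the projection in two orders. Symmetry cancels it, and the difference of
  the remaining terms lies in the kernel of the derivative of \<pi>. The energy is not assumed
  smooth on the zero section. Over a nonzero v every competitor in the minimisation projects to v
  and so cannot vanish; over v = 0 the values of h and F1 are known outright. The smoothness
  predicate records derivatives in fixed directions only, so the chain rule expands a moving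
  direction in a finite basis. The fibre model is merely a normed space, which admits
  zero-dimensional fibres; smooth maps into or out of it are therefore composed only with linear or
  affine maps. Connectedness of the typical fibre enters at one place: where a vanishing vertical
  derivative becomes constancy.\<close>

lemma frechet_derivative_cong_open:
  assumes "open S" "x \<in> S" "\<And>y. y \<in> S \<Longrightarrow> f y = g y"
  shows "frechet_derivative f (at x) = frechet_derivative g (at x)"
proof -
  \<comment> \<open>\<open>frechet_derivative\<close> is a choice among all derivatives, so equality
    of the sets of candidates already gives equality of the chosen values, differentiable or
    not.\<close>
  have "(f has_derivative D) (at x) \<longleftrightarrow> (g has_derivative D) (at x)" for D
    using assms has_derivative_transform_within_open[of f D x UNIV S g]
      has_derivative_transform_within_open[of g D x UNIV S f] by auto
  then show ?thesis
    unfolding frechet_derivative_def by simp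
qed

lemma has_frechet_derivative:
  "f differentiable (at x) \<Longrightarrow> (f has_derivative frechet_derivative f (at x)) (at x)"
  by (simp add: frechet_derivative_works)

lemma frechet_derivative_eqI:
  "(f has_derivative D) (at x) \<Longrightarrow> frechet_derivative f (at x) = D"
  by (metis frechet_derivative_at)

lemma has_derivative_cong_open:
  assumes "(f has_derivative D) (at x)" "open S" "x \<in> S" "\<And>y. y \<in> S \<Longrightarrow> f y = g y"
  shows "(g has_derivative D) (at x)"
  using assms has_derivative_transform_within_open[of f D x UNIV S g] by auto

lemma differentiable_cong_open:
  assumes "f differentiable (at x)" "open S" "x \<in> S" "\<And>y. y \<in> S \<Longrightarrow> f y = g y"
  shows "g differentiable (at x)"
  using assms has_derivative_cong_open unfolding differentiable_def by metis

lemma Ck_on_cong: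
  assumes "open S" "\<And>x. x \<in> S \<Longrightarrow> f x = g x" "Ck_on k S f"
  shows "Ck_on k S g"
  using assms(2,3)
proof (induction k arbitrary: f g)
  case 0
  then show ?case using continuous_on_cong[of S S f g] by (metis Ck_on.simps(1))
next
  case (Suc k)
  have "frechet_derivative f (at x) v = frechet_derivative g (at x) v" if "x \<in> S" for x v
    using frechet_derivative_cong_open[OF assms(1) that] Suc.prems(1) by metis
  then have "Ck_on k S (\<lambda>x. frechet_derivative g (at x) v)" for v
    using Suc.IH[of "\<lambda>x. frechet_derivative f (at x) v"] Suc.prems(2) by auto
  then show ?case
    using differentiable_cong_open[OF _ assms(1)] Suc.prems by (metis Ck_on.simps(2))
qed

lemma Ck_on_subset: "Ck_on k S f \<Longrightarrow> T \<subseteq> S \<Longrightarrow> Ck_on k T f"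
proof (induction k arbitrary: f)
  case 0
  then show ?case using continuous_on_subset by auto
qed auto

lemma Ck_on_SucD: "Ck_on (Suc k) S f \<Longrightarrow> Ck_on k S f"
proof (induction k arbitrary: f)
  case 0
  then show ?case
    by (auto intro!: differentiable_imp_continuous_on simp: differentiable_on_def differentiable_at_withinI)
next
  case (Suc k)
  then show ?case by (metis Ck_on.simps(2))
qed

lemma Ck_on_local:
  assumes "\<And>x. x \<in> S \<Longrightarrow> \<exists>V. open V \<and> x \<in> V \<and> Ck_on k V f"
  shows "Ck_on k S f"
  using assms
proof (induction k arbitrary: f)
  case 0
  have "isCont f x" if x: "x \<in> S" for x
    using 0[OF x] by (auto simp: continuous_on_eq_continuous_at)
  then show ?case by (simp add: continuous_at_imp_continuous_on)
next
  case (Suc k)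
  show ?case
    unfolding Ck_on.simps
  proof (intro conjI ballI allI)
    show "f differentiable (at x)" if "x \<in> S" for x
      using Suc.prems[OF that] by auto
    show "Ck_on k S (\<lambda>x. frechet_derivative f (at x) v)" for v
      using Suc.IH Suc.prems by (metis Ck_on.simps(2))
  qed
qed

text \<open>\<open>Ck_on\<close> is phrased with the chosen \<open>frechet_derivative\<close>;
  through this rule the inductions below work with a derivative computed by hand.\<close>

lemma Ck_on_SucI:
  assumes S: "open S"
    and D: "\<And>x. x \<in> S \<Longrightarrow> (f has_derivative D x) (at x)"
    and "\<And>v. Ck_on k S (\<lambda>x. D x v)"
  shows "Ck_on (Suc k) S f"
proof -
  have "frechet_derivative f (at x) v = D x v" if "x \<in> S" for x v
    using frechet_derivative_eqI[OF D[OF that]] by simp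
  then have "Ck_on k S (\<lambda>x. frechet_derivative f (at x) v)" for v
    using Ck_on_cong[OF S _ assms(3)[of v]] by auto
  then show ?thesis
    using D by (auto simp: differentiable_def)
qed

lemma Ck_on_SucD_deriv:
  assumes "Ck_on (Suc k) S f" "x \<in> S"
  shows "(f has_derivative frechet_derivative f (at x)) (at x)"
  using assms by (auto intro!: has_frechet_derivative)

lemma Ck_on_const: "Ck_on k S (\<lambda>x. c)"
  by (induction k arbitrary: c) (auto simp: frechet_derivative_const)

lemma Ck_on_linear_comp:
  assumes L: "bounded_linear L" and S: "open S"
  shows "Ck_on k S f \<Longrightarrow> Ck_on k S (\<lambda>x. L (f x))"
proof (induction k arbitrary: f)
  case 0
  then show ?case
    by (simp add: bounded_linear.continuous_on[OF L])
next
  case (Suc k)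
  show ?case
  proof (rule Ck_on_SucI[OF S])
    show "((\<lambda>x. L (f x)) has_derivative (\<lambda>v. L (frechet_derivative f (at x) v))) (at x)" if "x \<in> S" for x
      by (rule bounded_linear.has_derivative[OF L Ck_on_SucD_deriv[OF Suc.prems that]])
    show "Ck_on k S (\<lambda>x. L (frechet_derivative f (at x) v))" for v
      using Suc by auto
  qed
qed

text \<open>Valid over every normed space, unlike \<open>Ck_on_compose\<close>: the inner derivative
  is constant, so the fixed direction \<open>v\<close> goes to the fixed direction
  \<open>L v\<close> and no basis has to be expanded.\<close>

lemma Ck_on_affine_precomp:
  assumes L: "bounded_linear L" and S: "open S" and ST: "\<And>x. x \<in> S \<Longrightarrow> L x + c \<in> T"
  shows "Ck_on k T f \<Longrightarrow> Ck_on k S (\<lambda>x. f (L x + c))"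
proof (induction k arbitrary: f)
  case 0
  have "continuous_on S (\<lambda>x. L x + c)"
    by (intro continuous_intros linear_continuous_on L)
  then show ?case
    using 0 ST by (auto intro: continuous_on_compose2)
next
  case (Suc k)
  have D: "((\<lambda>x. L x + c) has_derivative L) (at x)" for x
    by (auto intro!: derivative_eq_intros bounded_linear_imp_has_derivative L)
  show ?case
  proof (rule Ck_on_SucI[OF S])
    show "((\<lambda>x. f (L x + c)) has_derivative (\<lambda>v. frechet_derivative f (at (L x + c)) (L v))) (at x)"
      if "x \<in> S" for x
      using has_derivative_compose[OF D Ck_on_SucD_deriv[OF Suc.prems ST[OF that]]] .
    show "Ck_on k S (\<lambda>x. frechet_derivative f (at (L x + c)) (L v))" for v
      using Suc.IH[of "\<lambda>y. frechet_derivative f (at y) (L v)"] Suc.prems by auto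
  qed
qed

lemma Ck_on_add:
  assumes S: "open S"
  shows "Ck_on k S f \<Longrightarrow> Ck_on k S g \<Longrightarrow> Ck_on k S (\<lambda>x. f x + g x)"
proof (induction k arbitrary: f g)
  case 0
  then show ?case by (simp add: continuous_on_add)
next
  case (Suc k)
  show ?case
  proof (rule Ck_on_SucI[OF S])
    show "((\<lambda>x. f x + g x) has_derivative
        (\<lambda>v. frechet_derivative f (at x) v + frechet_derivative g (at x) v)) (at x)" if "x \<in> S" for x
      by (intro has_derivative_add Ck_on_SucD_deriv[OF Suc.prems(1) that] Ck_on_SucD_deriv[OF Suc.prems(2) that])
  qed (use Suc in auto)
qed

lemma Ck_on_bilinear:
  assumes B: "bounded_bilinear B" and S: "open S"
  shows "Ck_on k S f \<Longrightarrow> Ck_on k S g \<Longrightarrow> Ck_on k S (\<lambda>x. B (f x) (g x))"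
proof (induction k arbitrary: f g)
  case 0
  then show ?case by (simp add: bounded_bilinear.continuous_on[OF B])
next
  case (Suc k)
  show ?case
  proof (rule Ck_on_SucI[OF S])
    show "((\<lambda>x. B (f x) (g x)) has_derivative
        (\<lambda>v. B (f x) (frechet_derivative g (at x) v) + B (frechet_derivative f (at x) v) (g x))) (at x)"
      if "x \<in> S" for x
      by (intro bounded_bilinear.FDERIV[OF B] Ck_on_SucD_deriv[OF Suc.prems(1) that] Ck_on_SucD_deriv[OF Suc.prems(2) that])
    show "Ck_on k S (\<lambda>x. B (f x) (frechet_derivative g (at x) v) + B (frechet_derivative f (at x) v) (g x))" for v
      using Suc.prems Ck_on_SucD[OF Suc.prems(1)] Ck_on_SucD[OF Suc.prems(2)]
      by (intro Ck_on_add S Suc.IH) auto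
  qed
qed

lemma Ck_on_sum:
  assumes S: "open S" and "finite I" "\<And>i. i \<in> I \<Longrightarrow> Ck_on k S (f i)"
  shows "Ck_on k S (\<lambda>x. \<Sum>i\<in>I. f i x)"
  using assms(2,3)
  by (induction I rule: finite_induct) (simp_all add: Ck_on_const Ck_on_add[OF S])

lemma Ck_on_Pair:
  assumes S: "open S"
  shows "Ck_on k S f \<Longrightarrow> Ck_on k S g \<Longrightarrow> Ck_on k S (\<lambda>x. (f x, g x))"
proof (induction k arbitrary: f g)
  case 0
  then show ?case by (simp add: continuous_on_Pair)
next
  case (Suc k)
  show ?case
  proof (rule Ck_on_SucI[OF S])
    show "((\<lambda>x. (f x, g x)) has_derivative
        (\<lambda>v. (frechet_derivative f (at x) v, frechet_derivative g (at x) v))) (at x)" if "x \<in> S" for x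
      by (intro has_derivative_Pair Ck_on_SucD_deriv[OF Suc.prems(1) that] Ck_on_SucD_deriv[OF Suc.prems(2) that])
  qed (use Suc in auto)
qed

lemma linear_sum_Basis:
  fixes L :: "'a::euclidean_space \<Rightarrow> 'b::real_vector"
  assumes "linear L"
  shows "L x = (\<Sum>i\<in>Basis. (x \<bullet> i) *\<^sub>R L i)"
proof -
  have "L x = L (\<Sum>i\<in>Basis. (x \<bullet> i) *\<^sub>R i)"
    by (simp add: euclidean_representation)
  also have "\<dots> = (\<Sum>i\<in>Basis. (x \<bullet> i) *\<^sub>R L i)"
    by (simp add: linear_sum[OF assms] linear_scale[OF assms])
  finally show ?thesis .
qed

text \<open>In the chain rule the inner derivative is a direction that moves with the point, whereas
  \<open>Ck_on\<close> controls fixed directions only. Expanding it in a basis of the intermediate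
  space leaves finitely many products of a scalar function and a derivative in a basis
  direction.\<close>

lemma Ck_on_compose:
  fixes g :: "'a::real_normed_vector \<Rightarrow> 'b::euclidean_space" and f :: "'b \<Rightarrow> 'c::real_normed_vector"
  assumes S: "open S" and gT: "\<And>x. x \<in> S \<Longrightarrow> g x \<in> T"
  shows "Ck_on k T f \<Longrightarrow> Ck_on k S g \<Longrightarrow> Ck_on k S (\<lambda>x. f (g x))"
proof (induction k arbitrary: f)
  case 0
  then have "continuous_on S (\<lambda>x. f (g x))"
    using continuous_on_compose2[of T f S g] gT by auto
  then show ?case by simp
next
  case (Suc k)
  have *: "frechet_derivative f (at (g x)) (frechet_derivative g (at x) v) =
      (\<Sum>i\<in>Basis. (frechet_derivative g (at x) v \<bullet> i) *\<^sub>R frechet_derivative f (at (g x)) i)"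
    if "x \<in> S" for x v
  proof (rule linear_sum_Basis[of "frechet_derivative f (at (g x))"])
    show "linear (frechet_derivative f (at (g x)))"
      using Suc.prems gT[OF that] by (auto intro: linear_frechet_derivative)
  qed
  show ?case
  proof (rule Ck_on_SucI[OF S])
    show "((\<lambda>x. f (g x)) has_derivative (\<lambda>v. \<Sum>i\<in>Basis. (frechet_derivative g (at x) v \<bullet> i) *\<^sub>R
        frechet_derivative f (at (g x)) i)) (at x)" if "x \<in> S" for x
      using has_derivative_compose[OF Ck_on_SucD_deriv[OF Suc.prems(2) that]
          Ck_on_SucD_deriv[OF Suc.prems(1) gT[OF that]]]
      by (simp only: *[OF that])
    show "Ck_on k S (\<lambda>x. \<Sum>i\<in>Basis. (frechet_derivative g (at x) v \<bullet> i) *\<^sub>R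
        frechet_derivative f (at (g x)) i)" for v
    proof (rule Ck_on_sum[OF S finite_Basis], rule Ck_on_bilinear[OF bounded_bilinear_scaleR S])
      fix i :: 'b
      show "Ck_on k S (\<lambda>x. frechet_derivative g (at x) v \<bullet> i)"
        using Suc.prems by (intro Ck_on_linear_comp[OF bounded_linear_inner_left S]) auto
      show "Ck_on k S (\<lambda>x. frechet_derivative f (at (g x)) i)"
        using Suc.IH[of "\<lambda>y. frechet_derivative f (at y) i"] Suc.prems(1) Ck_on_SucD[OF Suc.prems(2)]
        by auto
    qed
  qed
qed

section \<open>Closure properties of smooth functions\<close>

lemma smooth_on_cong:
  "smooth_on S f \<Longrightarrow> open S \<Longrightarrow> (\<And>x. x \<in> S \<Longrightarrow> f x = g x) \<Longrightarrow> smooth_on S g"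
  unfolding smooth_on_def using Ck_on_cong by blast

lemma smooth_on_subset: "smooth_on S f \<Longrightarrow> T \<subseteq> S \<Longrightarrow> smooth_on T f"
  unfolding smooth_on_def using Ck_on_subset by blast

lemma smooth_on_local:
  "(\<And>x. x \<in> S \<Longrightarrow> \<exists>V. open V \<and> x \<in> V \<and> smooth_on V f) \<Longrightarrow> smooth_on S f"
  unfolding smooth_on_def by (intro allI Ck_on_local) blast

lemma smooth_on_const [intro]: "smooth_on S (\<lambda>x. c)"
  unfolding smooth_on_def by (simp add: Ck_on_const)

lemma smooth_on_linear_comp:
  "bounded_linear L \<Longrightarrow> open S \<Longrightarrow> smooth_on S f \<Longrightarrow> smooth_on S (\<lambda>x. L (f x))"
  unfolding smooth_on_def using Ck_on_linear_comp by blast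

lemma smooth_on_affine_precomp:
  assumes "smooth_on T f" "bounded_linear L" "open S" "\<And>x. x \<in> S \<Longrightarrow> L x + c \<in> T"
  shows "smooth_on S (\<lambda>x. f (L x + c))"
  using assms unfolding smooth_on_def by (blast intro: Ck_on_affine_precomp)

lemma smooth_on_id: "open S \<Longrightarrow> smooth_on S (\<lambda>x. x)"
  unfolding smooth_on_def
proof
  fix k assume S: "open S"
  show "Ck_on k S (\<lambda>x. x)"
  proof (cases k)
    case (Suc k')
    show ?thesis
      unfolding Suc by (rule Ck_on_SucI[OF S has_derivative_ident]) (rule Ck_on_const)
  qed auto
qed

lemma smooth_on_linear: "bounded_linear L \<Longrightarrow> open S \<Longrightarrow> smooth_on S L"
  using smooth_on_linear_comp[OF _ _ smooth_on_id] by blast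

lemma smooth_on_add:
  "open S \<Longrightarrow> smooth_on S f \<Longrightarrow> smooth_on S g \<Longrightarrow> smooth_on S (\<lambda>x. f x + g x)"
  unfolding smooth_on_def using Ck_on_add by blast

lemma smooth_on_scaleR:
  "open S \<Longrightarrow> smooth_on S f \<Longrightarrow> smooth_on S g \<Longrightarrow> smooth_on S (\<lambda>x. f x *\<^sub>R g x)"
  unfolding smooth_on_def using Ck_on_bilinear[OF bounded_bilinear_scaleR] by blast

lemma smooth_on_mult:
  fixes f g :: "_ \<Rightarrow> real"
  shows "open S \<Longrightarrow> smooth_on S f \<Longrightarrow> smooth_on S g \<Longrightarrow> smooth_on S (\<lambda>x. f x * g x)"
  using smooth_on_scaleR[of S f g] by simp

lemma smooth_on_sum:
  "open S \<Longrightarrow> finite I \<Longrightarrow> (\<And>i. i \<in> I \<Longrightarrow> smooth_on S (f i)) \<Longrightarrow> smooth_on S (\<lambda>x. \<Sum>i\<in>I. f i x)"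
  unfolding smooth_on_def using Ck_on_sum[of S I] by blast

lemma smooth_on_Pair:
  "open S \<Longrightarrow> smooth_on S f \<Longrightarrow> smooth_on S g \<Longrightarrow> smooth_on S (\<lambda>x. (f x, g x))"
  unfolding smooth_on_def using Ck_on_Pair by blast

lemma smooth_on_compose:
  fixes g :: "'a::real_normed_vector \<Rightarrow> 'b::euclidean_space"
  assumes "smooth_on T f" "open S" "smooth_on S g" "\<And>x. x \<in> S \<Longrightarrow> g x \<in> T"
  shows "smooth_on S (\<lambda>x. f (g x))"
  using assms unfolding smooth_on_def by (blast intro: Ck_on_compose)

lemma smooth_on_differentiable: "smooth_on S f \<Longrightarrow> x \<in> S \<Longrightarrow> f differentiable (at x)"
  unfolding smooth_on_def using Ck_on.simps(2) by blast

lemma smooth_on_has_derivative: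
  "smooth_on S f \<Longrightarrow> x \<in> S \<Longrightarrow> (f has_derivative frechet_derivative f (at x)) (at x)"
  by (simp add: has_frechet_derivative smooth_on_differentiable)

lemma smooth_on_linear_deriv:
  "smooth_on S f \<Longrightarrow> x \<in> S \<Longrightarrow> linear (frechet_derivative f (at x))"
  by (simp add: linear_frechet_derivative smooth_on_differentiable)

lemma smooth_on_continuous_on: "smooth_on S f \<Longrightarrow> continuous_on S f"
  unfolding smooth_on_def using Ck_on.simps(1) by blast

lemma smooth_on_deriv: "smooth_on S f \<Longrightarrow> smooth_on S (\<lambda>x. frechet_derivative f (at x) v)"
  unfolding smooth_on_def using Ck_on.simps(2) by blast

lemma smooth_on_deriv_compose:
  fixes a b :: "'a::real_normed_vector \<Rightarrow> 'b::euclidean_space"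
  assumes f: "smooth_on T f" and S: "open S" and a: "smooth_on S a" and b: "smooth_on S b"
    and aT: "\<And>x. x \<in> S \<Longrightarrow> a x \<in> T"
  shows "smooth_on S (\<lambda>x. frechet_derivative f (at (a x)) (b x))"
proof -
  have "smooth_on S (\<lambda>x. \<Sum>i\<in>Basis. (b x \<bullet> i) *\<^sub>R frechet_derivative f (at (a x)) i)"
  proof (rule smooth_on_sum[OF S finite_Basis], rule smooth_on_scaleR[OF S])
    show "smooth_on S (\<lambda>x. b x \<bullet> i)" for i
      by (rule smooth_on_linear_comp[OF bounded_linear_inner_left S b])
    show "smooth_on S (\<lambda>x. frechet_derivative f (at (a x)) i)" for i
      by (rule smooth_on_compose[OF smooth_on_deriv[OF f, of i] S a aT])
  qed
  then show ?thesis
    by (rule smooth_on_cong[OF _ S]) (rule linear_sum_Basis[OF smooth_on_linear_deriv[OF f aT], symmetric])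
qed

text \<open>Product rule for a derivative whose base point and direction both move. After expansion
  of the direction in a basis, each summand is a scalar times a derivative in a fixed direction.
  Every later differentiation of a projection equation or of a vertical lift goes through this
  rule.\<close>

lemma has_derivative_deriv_compose:
  fixes a b :: "'c::real_normed_vector \<Rightarrow> 'b::euclidean_space"
  assumes f: "smooth_on T f" and T: "open T" and aT: "a t \<in> T"
    and a: "(a has_derivative a') (at t)" and b: "(b has_derivative b') (at t)"
  shows "((\<lambda>s. frechet_derivative f (at (a s)) (b s)) has_derivative
    (\<lambda>s. frechet_derivative (\<lambda>y. frechet_derivative f (at y) (b t)) (at (a t)) (a' s)
       + frechet_derivative f (at (a t)) (b' s))) (at t)"
proof -
  let ?D = "\<lambda>y v. frechet_derivative f (at y) v"
  have lin: "linear (?D y)" if "y \<in> T" for y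
    using smooth_on_linear_deriv[OF f that] .
  have Di: "((\<lambda>s. ?D (a s) i) has_derivative (\<lambda>s. frechet_derivative (\<lambda>y. ?D y i) (at (a t)) (a' s))) (at t)" for i
    using has_derivative_compose[OF a smooth_on_has_derivative[OF smooth_on_deriv[OF f] aT]] .
  have *: "((\<lambda>s. \<Sum>i\<in>Basis. (b s \<bullet> i) *\<^sub>R ?D (a s) i) has_derivative
     (\<lambda>s. \<Sum>i\<in>Basis. (b t \<bullet> i) *\<^sub>R frechet_derivative (\<lambda>y. ?D y i) (at (a t)) (a' s)
        + (b' s \<bullet> i) *\<^sub>R ?D (a t) i)) (at t)"
  proof (rule has_derivative_sum)
    show "((\<lambda>s. (b s \<bullet> i) *\<^sub>R ?D (a s) i) has_derivative
     (\<lambda>s. (b t \<bullet> i) *\<^sub>R frechet_derivative (\<lambda>y. ?D y i) (at (a t)) (a' s)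
        + (b' s \<bullet> i) *\<^sub>R ?D (a t) i)) (at t)" for i
      by (rule has_derivative_scaleR[OF has_derivative_inner_left[OF b] Di])
  qed
  \<comment> \<open>Regroups the second-order terms: their coefficients are frozen at
    \<open>t\<close>, so the sum is the derivative of the single function that evaluates
    \<open>f\<close> in the direction \<open>b t\<close>.\<close>
  have e1: "frechet_derivative (\<lambda>y. ?D y (b t)) (at (a t)) v =
     (\<Sum>i\<in>Basis. (b t \<bullet> i) *\<^sub>R frechet_derivative (\<lambda>y. ?D y i) (at (a t)) v)" for v
  proof -
    have "((\<lambda>y. \<Sum>i\<in>Basis. (b t \<bullet> i) *\<^sub>R ?D y i) has_derivative
       (\<lambda>v. \<Sum>i\<in>Basis. (b t \<bullet> i) *\<^sub>R frechet_derivative (\<lambda>y. ?D y i) (at (a t)) v)) (at (a t))"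
      by (rule has_derivative_sum, rule has_derivative_scaleR_right,
          rule smooth_on_has_derivative[OF smooth_on_deriv[OF f] aT])
    then have "((\<lambda>y. ?D y (b t)) has_derivative
       (\<lambda>v. \<Sum>i\<in>Basis. (b t \<bullet> i) *\<^sub>R frechet_derivative (\<lambda>y. ?D y i) (at (a t)) v)) (at (a t))"
      by (rule has_derivative_cong_open[OF _ T aT]) (rule linear_sum_Basis[OF lin, symmetric])
    then show ?thesis by (simp add: frechet_derivative_eqI)
  qed
  have "\<forall>\<^sub>F s in at t. a s \<in> T"
    using has_derivative_continuous[OF a] T aT
    by (auto simp: isCont_def dest: topological_tendstoD)
  then have "\<forall>\<^sub>F s in at t. (\<Sum>i\<in>Basis. (b s \<bullet> i) *\<^sub>R ?D (a s) i) = ?D (a s) (b s)"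
    by (rule eventually_mono) (rule linear_sum_Basis[OF lin, symmetric])
  then have "((\<lambda>s. ?D (a s) (b s)) has_derivative
     (\<lambda>s. \<Sum>i\<in>Basis. (b t \<bullet> i) *\<^sub>R frechet_derivative (\<lambda>y. ?D y i) (at (a t)) (a' s)
        + (b' s \<bullet> i) *\<^sub>R ?D (a t) i)) (at t)"
    by (rule has_derivative_transform_eventually[OF *])
       (auto intro: linear_sum_Basis[OF lin[OF aT], symmetric])
  then show ?thesis
    by (simp add: e1 sum.distrib linear_sum_Basis[OF lin[OF aT], symmetric])
qed

section \<open>Symmetry of second derivatives\<close>

text \<open>The mean value theorem is applied along \<open>v\<close> to the difference of two
  parallel edges, then along \<open>w\<close> to the derivative in the direction \<open>v\<close>.
  The right-hand side depends on the order of the directions; the second difference on the left does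
  not.\<close>

lemma second_difference_mvt:
  fixes f :: "'a::euclidean_space \<Rightarrow> real"
  assumes f: "smooth_on S f" and S: "open S" and s: "s > 0"
    and box: "\<And>a b. 0 \<le> a \<Longrightarrow> a \<le> s \<Longrightarrow> 0 \<le> b \<Longrightarrow> b \<le> s \<Longrightarrow> x + a *\<^sub>R v + b *\<^sub>R w \<in> S"
  shows "\<exists>a b. 0 \<le> a \<and> a \<le> s \<and> 0 \<le> b \<and> b \<le> s \<and>
     f (x + s *\<^sub>R v + s *\<^sub>R w) - f (x + s *\<^sub>R w) - f (x + s *\<^sub>R v) + f x =
     s\<^sup>2 * frechet_derivative (\<lambda>y. frechet_derivative f (at y) v) (at (x + a *\<^sub>R v + b *\<^sub>R w)) w"
proof -
  let ?D = "\<lambda>y v. frechet_derivative f (at y) v"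
  have line: "((\<lambda>r. g (p + r *\<^sub>R u)) has_real_derivative frechet_derivative g (at (p + r *\<^sub>R u)) u) (at r)"
    if "smooth_on S g" "p + r *\<^sub>R u \<in> S" for g :: "'a \<Rightarrow> real" and p u r
  proof -
    have "((\<lambda>r. p + r *\<^sub>R u) has_derivative (\<lambda>h. h *\<^sub>R u)) (at r)"
      by (auto intro!: derivative_eq_intros)
    from has_derivative_compose[OF this smooth_on_has_derivative[OF that]]
    show ?thesis
      unfolding has_field_derivative_def
      by (rule has_derivative_eq_rhs) (auto simp: linear_scale[OF smooth_on_linear_deriv[OF that]])
  qed
  have d1: "((\<lambda>r. f ((x + s *\<^sub>R w) + r *\<^sub>R v) - f (x + r *\<^sub>R v)) has_real_derivative
      ?D ((x + s *\<^sub>R w) + r *\<^sub>R v) v - ?D (x + r *\<^sub>R v) v) (at r)" if "0 \<le> r" "r \<le> s" for r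
    using box[of r s] box[of r 0] that s
    by (intro DERIV_diff line f) (auto simp: algebra_simps)
  obtain a where a: "0 < a" "a < s" and ea:
    "(f ((x + s *\<^sub>R w) + s *\<^sub>R v) - f (x + s *\<^sub>R v)) - (f ((x + s *\<^sub>R w) + 0 *\<^sub>R v) - f (x + 0 *\<^sub>R v))
      = (s - 0) * (?D ((x + s *\<^sub>R w) + a *\<^sub>R v) v - ?D (x + a *\<^sub>R v) v)"
    using MVT2[OF s d1] by blast
  have d2: "((\<lambda>r. ?D ((x + a *\<^sub>R v) + r *\<^sub>R w) v) has_real_derivative
      frechet_derivative (\<lambda>y. ?D y v) (at ((x + a *\<^sub>R v) + r *\<^sub>R w)) w) (at r)" if "0 \<le> r" "r \<le> s" for r
    using box[of a r] a that by (intro line smooth_on_deriv f) auto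
  obtain b where b: "0 < b" "b < s" and eb:
    "?D ((x + a *\<^sub>R v) + s *\<^sub>R w) v - ?D ((x + a *\<^sub>R v) + 0 *\<^sub>R w) v
      = (s - 0) * frechet_derivative (\<lambda>y. ?D y v) (at ((x + a *\<^sub>R v) + b *\<^sub>R w)) w"
    using MVT2[OF s d2] by blast
  have "f (x + s *\<^sub>R v + s *\<^sub>R w) - f (x + s *\<^sub>R w) - f (x + s *\<^sub>R v) + f x =
     s * (?D ((x + a *\<^sub>R v) + s *\<^sub>R w) v - ?D (x + a *\<^sub>R v) v)"
    using ea by (simp add: algebra_simps)
  also have "\<dots> = s\<^sup>2 * frechet_derivative (\<lambda>y. ?D y v) (at (x + a *\<^sub>R v + b *\<^sub>R w)) w"
    using eb by (simp add: power2_eq_square)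
  finally show ?thesis
    using a b by (intro exI[of _ a] exI[of _ b]) auto
qed

lemma symmetric_second_derivative_real:
  fixes f :: "'a::euclidean_space \<Rightarrow> real"
  assumes f: "smooth_on S f" and S: "open S" and x: "x \<in> S"
  shows "frechet_derivative (\<lambda>y. frechet_derivative f (at y) v) (at x) w =
         frechet_derivative (\<lambda>y. frechet_derivative f (at y) w) (at x) v"
proof -
  let ?A = "\<lambda>v w y. frechet_derivative (\<lambda>y. frechet_derivative f (at y) v) (at y) w"
  have cont: "isCont (?A v w) x" for v w
    using smooth_on_continuous_on[OF smooth_on_deriv[OF smooth_on_deriv[OF f]]] S x
    by (auto simp: continuous_on_eq_continuous_at)
  have "\<bar>?A v w x - ?A w v x\<bar> \<le> 2 * e" if e: "e > 0" for e
  proof -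
    obtain d1 where d1: "d1 > 0" "\<And>y. dist y x < d1 \<Longrightarrow> dist (?A v w y) (?A v w x) < e"
      using cont[of v w] e unfolding continuous_at_eps_delta by blast
    obtain d2 where d2: "d2 > 0" "\<And>y. dist y x < d2 \<Longrightarrow> dist (?A w v y) (?A w v x) < e"
      using cont[of w v] e unfolding continuous_at_eps_delta by blast
    obtain d3 where d3: "d3 > 0" "ball x d3 \<subseteq> S"
      using S x open_contains_ball by blast
    \<comment> \<open>Within distance \<open>d\<close> both mixed derivatives vary by less than
      \<open>e\<close> and the points stay in \<open>S\<close>. The parallelogram with sides
      \<open>s v\<close> and \<open>s w\<close> stays within \<open>s K = d / 2\<close> of
      \<open>x\<close>; the summand 1 keeps \<open>K\<close> positive when both directions
      vanish.\<close>
    define d where "d = min d1 (min d2 d3)"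
    define K where "K = norm v + norm w + 1"
    define s where "s = d / (2 * K)"
    have pos: "d > 0" "K > 0"
      using d1 d2 d3 unfolding d_def K_def by (auto intro: add_nonneg_pos)
    then have s: "s > 0" unfolding s_def by simp
    have small: "dist (x + a *\<^sub>R v + b *\<^sub>R w) x < d" if "0 \<le> a" "a \<le> s" "0 \<le> b" "b \<le> s" for a b
    proof -
      have "dist (x + a *\<^sub>R v + b *\<^sub>R w) x = norm (a *\<^sub>R v + b *\<^sub>R w)"
        by (simp add: dist_norm algebra_simps)
      also have "\<dots> \<le> a * norm v + b * norm w"
        using norm_triangle_ineq[of "a *\<^sub>R v" "b *\<^sub>R w"] that by simp
      also have "\<dots> \<le> s * norm v + s * norm w"
        using that by (intro add_mono mult_right_mono) auto
      also have "\<dots> \<le> s * K"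
        using s by (simp add: K_def algebra_simps)
      also have "\<dots> = d / 2" unfolding s_def using pos by simp
      finally show ?thesis using pos by simp
    qed
    have inS: "x + a *\<^sub>R v + b *\<^sub>R w \<in> S" if "0 \<le> a" "a \<le> s" "0 \<le> b" "b \<le> s" for a b
      using small[OF that] d3 unfolding d_def by (auto simp: dist_commute)
    then have inS': "x + a *\<^sub>R w + b *\<^sub>R v \<in> S" if "0 \<le> a" "a \<le> s" "0 \<le> b" "b \<le> s" for a b
      using inS[of b a] that by (simp add: algebra_simps)
    obtain a b where ab: "0 \<le> a" "a \<le> s" "0 \<le> b" "b \<le> s"
      and 1: "f (x + s *\<^sub>R v + s *\<^sub>R w) - f (x + s *\<^sub>R w) - f (x + s *\<^sub>R v) + f x =
        s\<^sup>2 * ?A v w (x + a *\<^sub>R v + b *\<^sub>R w)"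
      using second_difference_mvt[OF f S s inS] by blast
    obtain a' b' where ab': "0 \<le> a'" "a' \<le> s" "0 \<le> b'" "b' \<le> s"
      and 2: "f (x + s *\<^sub>R w + s *\<^sub>R v) - f (x + s *\<^sub>R v) - f (x + s *\<^sub>R w) + f x =
        s\<^sup>2 * ?A w v (x + a' *\<^sub>R w + b' *\<^sub>R v)"
      using second_difference_mvt[OF f S s inS'] by blast
    have c: "x + a' *\<^sub>R w + b' *\<^sub>R v = x + b' *\<^sub>R v + a' *\<^sub>R w" "x + s *\<^sub>R w + s *\<^sub>R v = x + s *\<^sub>R v + s *\<^sub>R w"
      by (simp_all add: algebra_simps)
    have "s\<^sup>2 * ?A v w (x + a *\<^sub>R v + b *\<^sub>R w) = s\<^sup>2 * ?A w v (x + b' *\<^sub>R v + a' *\<^sub>R w)"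
      using 1 2 unfolding c by linarith
    then have "?A v w (x + a *\<^sub>R v + b *\<^sub>R w) = ?A w v (x + b' *\<^sub>R v + a' *\<^sub>R w)"
      using s by simp
    moreover have "dist (?A v w (x + a *\<^sub>R v + b *\<^sub>R w)) (?A v w x) < e"
      using small[OF ab] d1(2) unfolding d_def by simp
    moreover have "dist (?A w v (x + b' *\<^sub>R v + a' *\<^sub>R w)) (?A w v x) < e"
      using small[OF ab'(3,4,1,2)] d2(2) unfolding d_def by simp
    ultimately show ?thesis
      unfolding dist_real_def by linarith
  qed
  then have "\<bar>?A v w x - ?A w v x\<bar> \<le> e" if "e > 0" for e
    using that by (metis field_sum_of_halves half_gt_zero mult_2)
  then have "\<bar>?A v w x - ?A w v x\<bar> \<le> 0"
    using field_le_epsilon[of "\<bar>?A v w x - ?A w v x\<bar>" 0] by simp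
  then show ?thesis by simp
qed

lemma symmetric_second_derivative:
  fixes f :: "'a::euclidean_space \<Rightarrow> 'b::euclidean_space"
  assumes f: "smooth_on S f" and S: "open S" and x: "x \<in> S"
  shows "frechet_derivative (\<lambda>y. frechet_derivative f (at y) v) (at x) w =
         frechet_derivative (\<lambda>y. frechet_derivative f (at y) w) (at x) v"
proof (rule euclidean_eqI)
  fix i :: 'b
  have fi: "smooth_on S (\<lambda>x. f x \<bullet> i)"
    by (rule smooth_on_linear_comp[OF bounded_linear_inner_left S f])
  have 1: "frechet_derivative (\<lambda>x. f x \<bullet> i) (at y) v = frechet_derivative f (at y) v \<bullet> i" if "y \<in> S" for y v
    using frechet_derivative_eqI[OF has_derivative_inner_left[OF smooth_on_has_derivative[OF f that]]]
    by metis
  have 2: "frechet_derivative (\<lambda>y. frechet_derivative (\<lambda>x. f x \<bullet> i) (at y) v) (at x) w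
      = frechet_derivative (\<lambda>y. frechet_derivative f (at y) v) (at x) w \<bullet> i" for v w
  proof -
    have "frechet_derivative (\<lambda>y. frechet_derivative (\<lambda>x. f x \<bullet> i) (at y) v) (at x)
       = frechet_derivative (\<lambda>y. frechet_derivative f (at y) v \<bullet> i) (at x)"
      by (rule frechet_derivative_cong_open[OF S x 1])
    also have "\<dots> = (\<lambda>w. frechet_derivative (\<lambda>y. frechet_derivative f (at y) v) (at x) w \<bullet> i)"
      by (rule frechet_derivative_eqI, rule has_derivative_inner_left,
          rule smooth_on_has_derivative[OF smooth_on_deriv[OF f] x])
    finally show ?thesis by simp
  qed
  show "frechet_derivative (\<lambda>y. frechet_derivative f (at y) v) (at x) w \<bullet> i =
    frechet_derivative (\<lambda>y. frechet_derivative f (at y) w) (at x) v \<bullet> i"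
    using symmetric_second_derivative_real[OF fi S x] 2 by metis
qed

section \<open>Bump functions\<close>

text \<open>A polynomial in 1/t times the classical flat function exp(-1/t). Carrying the polynomial
  makes the family closed under differentiation: \<open>p\<close> turns into
  \<open>x\<^sup>2 (p - p')\<close>, so one induction proves all members smooth at once.\<close>

definition flat :: "real poly \<Rightarrow> real \<Rightarrow> real" where
  "flat p t = (if t > 0 then poly p (1 / t) * exp (- (1 / t)) else 0)"

lemma tendsto_poly_exp_at_top: "((\<lambda>x. poly p x * exp (- x)) \<longlongrightarrow> 0) (at_top :: real filter)"
proof -
  have "((\<lambda>x. \<Sum>i\<le>degree p. coeff p i * (x ^ i / exp x)) \<longlongrightarrow> (\<Sum>i\<le>degree p. coeff p i * 0)) at_top"
    by (intro tendsto_sum tendsto_mult tendsto_const tendsto_power_div_exp_0)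
  then show ?thesis
    by (simp add: poly_altdef exp_minus field_simps sum_distrib_left sum_distrib_right)
qed

lemma flat_tendsto_0: "(flat p \<longlongrightarrow> 0) (at 0)"
proof -
  have "((\<lambda>t. poly p (inverse t) * exp (- inverse t)) \<longlongrightarrow> 0) (at_right 0)"
    by (rule filterlim_compose[OF tendsto_poly_exp_at_top filterlim_inverse_at_top_right])
  moreover have "\<forall>\<^sub>F t in at_right 0. poly p (inverse t) * exp (- inverse t) = flat p t"
    by (auto simp: eventually_at_filter flat_def divide_inverse)
  ultimately have "(flat p \<longlongrightarrow> 0) (at_right 0)"
    by (rule Lim_transform_eventually)
  moreover have "(flat p \<longlongrightarrow> 0) (at_left 0)"
    by (rule Lim_transform_eventually[OF tendsto_const]) (auto simp: eventually_at_filter flat_def)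
  ultimately show ?thesis
    by (simp add: filterlim_split_at)
qed

lemma flat_deriv: "(flat p has_real_derivative flat ([:0, 0, 1:] * (p - pderiv p)) t) (at t)"
proof (cases t "0 :: real" rule: linorder_cases)
  case greater
  have "((\<lambda>t. poly p (1 / t) * exp (- (1 / t))) has_real_derivative flat ([:0, 0, 1:] * (p - pderiv p)) t) (at t)"
    using greater unfolding flat_def
    by (auto intro!: derivative_eq_intros DERIV_chain'[OF _ poly_DERIV] simp: field_simps power2_eq_square)
  then show ?thesis
    by (rule has_field_derivative_transform_within_open[of _ _ _ "{0<..}"]) (use greater in \<open>auto simp: flat_def\<close>)
next
  case less
  have "((\<lambda>t. 0 :: real) has_real_derivative 0) (at t)" by simp
  then have "(flat p has_real_derivative 0) (at t)"
    by (rule has_field_derivative_transform_within_open[of _ _ _ "{..<0}"]) (use less in \<open>auto simp: flat_def\<close>)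
  then show ?thesis using less by (simp add: flat_def)
next
  \<comment> \<open>The difference quotient at 0 is itself a member of the family, for the
    polynomial x p, so its limit is already known.\<close>
  case equal
  have "\<forall>\<^sub>F h in at 0. flat ([:0, 1:] * p) h = (flat p (0 + h) - flat p 0) / h"
    by (auto simp: eventually_at_filter flat_def)
  then have "((\<lambda>h. (flat p (0 + h) - flat p 0) / h) \<longlongrightarrow> 0) (at 0)"
    by (rule Lim_transform_eventually[OF flat_tendsto_0])
  then show ?thesis
    unfolding equal DERIV_def by (simp add: flat_def)
qed

lemma smooth_on_flat: "smooth_on UNIV (flat p)"
  unfolding smooth_on_def
proof
  show "Ck_on k UNIV (flat p)" for k
  proof (induction k arbitrary: p)
    case 0
    then show ?case
      by (auto intro!: continuous_at_imp_continuous_on DERIV_isCont flat_deriv)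
  next
    case (Suc k)
    let ?p = "[:0, 0, 1:] * (p - pderiv p)"
    show ?case
    proof (rule Ck_on_SucI[OF open_UNIV])
      show "(flat p has_derivative (\<lambda>v. v *\<^sub>R flat ?p x)) (at x)" for x
        using flat_deriv[of p x] unfolding has_field_derivative_def
        by (rule has_derivative_eq_rhs) (simp add: fun_eq_iff)
      show "Ck_on k UNIV (\<lambda>x. v *\<^sub>R flat ?p x)" for v
        by (rule Ck_on_linear_comp[OF bounded_linear_scaleR_right open_UNIV Suc])
    qed
  qed
qed

lemma smooth_bump:
  fixes q :: "'a::euclidean_space"
  assumes "r > 0"
  obtains \<beta> :: "'a \<Rightarrow> real" where "smooth_on UNIV \<beta>" "\<beta> q = 1" "\<And>x. x \<notin> cball q r \<Longrightarrow> \<beta> x = 0"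
proof
  \<comment> \<open>The argument of the flat function is positive exactly inside the ball of radius
    \<open>r\<close>. At the centre its value is \<open>exp (- 1 / r\<^sup>2)\<close>, which the
    leading constant normalises to 1.\<close>
  define \<beta> where "\<beta> x = exp (1 / r\<^sup>2) * flat 1 (r\<^sup>2 + - 1 * ((x + - q) \<bullet> (x + - q)))" for x :: 'a
  have lin: "smooth_on UNIV (\<lambda>x::'a. x + - q)"
    by (intro smooth_on_add smooth_on_id smooth_on_const open_UNIV)
  have "smooth_on UNIV (\<lambda>x::'a. (x + - q) \<bullet> (x + - q))"
    using lin Ck_on_bilinear[OF bounded_bilinear_inner open_UNIV, of _ "\<lambda>x. x + - q" "\<lambda>x. x + - q"]
    unfolding smooth_on_def by blast
  then have "smooth_on UNIV (\<lambda>x::'a. r\<^sup>2 + - 1 * ((x + - q) \<bullet> (x + - q)))"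
    by (intro smooth_on_add smooth_on_mult smooth_on_const open_UNIV)
  then show "smooth_on UNIV \<beta>"
    unfolding \<beta>_def
    by (intro smooth_on_mult smooth_on_const open_UNIV smooth_on_compose[OF smooth_on_flat]) auto
  show "\<beta> q = 1"
    using assms by (simp add: \<beta>_def flat_def flip: exp_add)
  show "\<beta> x = 0" if "x \<notin> cball q r" for x
  proof -
    have "r < norm (x - q)" using that by (simp add: dist_norm norm_minus_commute)
    then have "r\<^sup>2 < (norm (x - q))\<^sup>2" using assms by (intro power_strict_mono) auto
    then show ?thesis by (simp add: \<beta>_def flat_def power2_norm_eq_inner)
  qed
qed

section \<open>The topology of an atlas\<close>

text \<open>The topological half of \<open>smooth_atlas\<close>. It determines the open sets, and it
  is the half that is established for product atlases.\<close>

definition chart_atlas :: "('m, 'a::real_normed_vector) chart set \<Rightarrow> bool" where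
  "chart_atlas A \<longleftrightarrow> (\<forall>c\<in>A. inj_on (snd c) (fst c) \<and> (\<forall>d\<in>A. open (snd c ` (fst c \<inter> fst d))))"

lemma smooth_atlas_imp_chart_atlas: "smooth_atlas A \<Longrightarrow> chart_atlas A"
  unfolding smooth_atlas_def chart_atlas_def by blast

lemma chart_inv_chart [simp]: "inj_on (snd c) (fst c) \<Longrightarrow> p \<in> fst c \<Longrightarrow> chart_inv c (snd c p) = p"
  by (rule inv_into_f_f)

lemma chart_chart_inv: "y \<in> snd c ` fst c \<Longrightarrow> snd c (chart_inv c y) = y"
  by (rule f_inv_into_f)

lemma chart_inv_in: "y \<in> snd c ` fst c \<Longrightarrow> chart_inv c y \<in> fst c"
  by (rule inv_into_into)

text \<open>\<open>topology\<close> can be inverted only on predicates that satisfy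
  \<open>istopology\<close>. Injectivity of the charts enters in the intersection clause, where
  images have to commute with intersections.\<close>

lemma openin_mtopology:
  assumes A: "chart_atlas A"
  shows "openin (mtopology A) W \<longleftrightarrow> W \<subseteq> points A \<and> (\<forall>c\<in>A. open (snd c ` (W \<inter> fst c)))"
proof -
  have "istopology (\<lambda>W. W \<subseteq> points A \<and> (\<forall>c\<in>A. open (snd c ` (W \<inter> fst c))))"
    unfolding istopology_def
  proof (intro conjI allI impI ballI)
    fix S T c assume *: "S \<subseteq> points A \<and> (\<forall>c\<in>A. open (snd c ` (S \<inter> fst c)))"
      "T \<subseteq> points A \<and> (\<forall>c\<in>A. open (snd c ` (T \<inter> fst c)))" and c: "c \<in> A"
    have "snd c ` ((S \<inter> T) \<inter> fst c) = snd c ` (S \<inter> fst c) \<inter> snd c ` (T \<inter> fst c)"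
      using inj_on_image_Int[of "snd c" "fst c" "S \<inter> fst c" "T \<inter> fst c"] A c
      by (auto simp: chart_atlas_def Int_ac)
    then show "open (snd c ` ((S \<inter> T) \<inter> fst c))"
      using * c by auto
  next
    fix \<K> c assume *: "\<forall>K\<in>\<K>. K \<subseteq> points A \<and> (\<forall>c\<in>A. open (snd c ` (K \<inter> fst c)))" and c: "c \<in> A"
    have "snd c ` (\<Union>\<K> \<inter> fst c) = (\<Union>K\<in>\<K>. snd c ` (K \<inter> fst c))"
      by auto
    then show "open (snd c ` (\<Union>\<K> \<inter> fst c))"
      using * c by auto
  qed auto
  then show ?thesis
    unfolding mtopology_def by (simp add: topology_inverse')
qed

lemma open_chart:
  assumes "chart_atlas A" "c \<in> A" shows "open (snd c ` fst c)"
proof -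
  have "open (snd c ` (fst c \<inter> fst c))" using assms unfolding chart_atlas_def by blast
  then show ?thesis by simp
qed

lemma topspace_mtopology: "chart_atlas A \<Longrightarrow> topspace (mtopology A) = points A"
proof (rule antisym)
  assume A: "chart_atlas A"
  show "topspace (mtopology A) \<subseteq> points A"
    using openin_mtopology[OF A] openin_topspace by blast
  have "open (snd c ` (points A \<inter> fst c))" if "c \<in> A" for c
  proof -
    have "points A \<inter> fst c = fst c" using that by (auto simp: points_def)
    then show ?thesis using open_chart[OF A that] by simp
  qed
  then have "openin (mtopology A) (points A)"
    by (simp add: openin_mtopology[OF A])
  then show "points A \<subseteq> topspace (mtopology A)"
    by (rule openin_subset)
qed

lemma openin_chart: "chart_atlas A \<Longrightarrow> c \<in> A \<Longrightarrow> openin (mtopology A) (fst c)"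
  by (subst openin_mtopology) (auto simp: chart_atlas_def points_def Int_commute)

lemma open_chart_image: "chart_atlas A \<Longrightarrow> c \<in> A \<Longrightarrow> openin (mtopology A) W \<Longrightarrow> open (snd c ` (W \<inter> fst c))"
  by (simp add: openin_mtopology)

lemma chart_atlas_inj: "chart_atlas A \<Longrightarrow> c \<in> A \<Longrightarrow> inj_on (snd c) (fst c)"
  unfolding chart_atlas_def by blast

lemma smooth_map_on_openin_preimage:
  assumes "smooth_map_on A S B f" "openin (mtopology B) W"
  shows "openin (mtopology A) {p \<in> S. f p \<in> W}"
proof -
  have "openin (subtopology (mtopology A) S) {p \<in> topspace (subtopology (mtopology A) S). f p \<in> W}"
    using assms unfolding smooth_map_on_def continuous_map_def by blast
  moreover have "topspace (subtopology (mtopology A) S) = S"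
    using assms openin_subset by (auto simp: smooth_map_on_def)
  ultimately have "openin (subtopology (mtopology A) S) {p \<in> S. f p \<in> W}"
    by (simp only:)
  then show ?thesis
    using assms openin_open_subtopology[of "mtopology A" S] by (simp add: smooth_map_on_def)
qed

lemma smooth_map_on_openD:
  assumes "smooth_map_on A S B f" "chart_atlas A" "chart_atlas B" "c \<in> A" "d \<in> B"
  shows "open (snd c ` (fst c \<inter> S \<inter> f -` fst d))"
proof -
  have "fst c \<inter> S \<inter> f -` fst d = {p \<in> S. f p \<in> fst d} \<inter> fst c" by auto
  then show ?thesis
    using open_chart_image[OF assms(2,4) smooth_map_on_openin_preimage[OF assms(1) openin_chart[OF assms(3,5)]]]
    by simp
qed

lemma smooth_map_onD:
  "smooth_map_on A S B f \<Longrightarrow> c \<in> A \<Longrightarrow> d \<in> B \<Longrightarrow>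
    smooth_on (snd c ` (fst c \<inter> S \<inter> f -` fst d)) (snd d \<circ> f \<circ> chart_inv c)"
  unfolding smooth_map_on_def by blast

section \<open>Transition maps\<close>

lemma tangent_space_iff:
  "v \<in> tangent_space A p \<longleftrightarrow> fst v = p \<and>
     (\<forall>c\<in>A. \<forall>d\<in>A. p \<in> fst c \<and> p \<in> fst d \<longrightarrow>
        snd v d = frechet_derivative (snd d \<circ> chart_inv c) (at (snd c p)) (snd v c)) \<and>
     (\<forall>c. \<not> (c \<in> A \<and> p \<in> fst c) \<longrightarrow> snd v c = 0)"
proof (cases v)
  case (Pair q \<xi>)
  show ?thesis unfolding Pair tangent_space_def fst_conv snd_conv by blast
qed

lemma tangent_space_fst: "v \<in> tangent_space A p \<Longrightarrow> fst v = p"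
  unfolding tangent_space_iff by blast

lemma tangent_space_change:
  assumes "v \<in> tangent_space A p" "c \<in> A" "p \<in> fst c" "d \<in> A" "p \<in> fst d"
  shows "snd v d = frechet_derivative (snd d \<circ> chart_inv c) (at (snd c p)) (snd v c)"
  using assms unfolding tangent_space_iff by blast

context
  fixes A :: "('m, 'a::real_normed_vector) chart set"
  assumes A: "smooth_atlas A"
begin

lemma transition_smooth:
  "c \<in> A \<Longrightarrow> d \<in> A \<Longrightarrow> smooth_on (snd c ` (fst c \<inter> fst d)) (snd d \<circ> chart_inv c)"
  using A unfolding smooth_atlas_def by blast

lemma transition_open: "c \<in> A \<Longrightarrow> d \<in> A \<Longrightarrow> open (snd c ` (fst c \<inter> fst d))"
  using A unfolding smooth_atlas_def by blast

lemma atlas_inj: "c \<in> A \<Longrightarrow> inj_on (snd c) (fst c)"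
  using A unfolding smooth_atlas_def by blast

text \<open>Seen in another chart \<open>d\<close>, the set is the preimage of an open set under the
  transition map, hence open there as well.\<close>

lemma openin_chart_subset:
  assumes c: "c \<in> A" and T: "T \<subseteq> fst c" "open (snd c ` T)"
  shows "openin (mtopology A) T"
  unfolding openin_mtopology[OF smooth_atlas_imp_chart_atlas[OF A]]
proof (intro conjI ballI)
  show "T \<subseteq> points A" using c T by (auto simp: points_def)
  fix d assume d: "d \<in> A"
  have "snd d ` (T \<inter> fst d) = snd d ` (fst d \<inter> fst c) \<inter> (snd c \<circ> chart_inv d) -` (snd c ` T)"
  proof (intro set_eqI iffI)
    fix y assume "y \<in> snd d ` (T \<inter> fst d)"
    then show "y \<in> snd d ` (fst d \<inter> fst c) \<inter> (snd c \<circ> chart_inv d) -` (snd c ` T)"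
      using T atlas_inj[OF d] by auto
  next
    fix y assume y: "y \<in> snd d ` (fst d \<inter> fst c) \<inter> (snd c \<circ> chart_inv d) -` (snd c ` T)"
    then obtain p where p: "p \<in> fst d" "p \<in> fst c" "y = snd d p" by auto
    then have "snd c p \<in> snd c ` T" using y atlas_inj[OF d] by auto
    then have "p \<in> T" using p T atlas_inj[OF c] by (auto dest: inj_onD)
    then show "y \<in> snd d ` (T \<inter> fst d)" using p by auto
  qed
  then show "open (snd d ` (T \<inter> fst d))"
    using continuous_open_preimage[OF smooth_on_continuous_on[OF transition_smooth[OF d c]] transition_open[OF d c] T(2)]
    by simp
qed

lemma chart_change:
  fixes f :: "'m \<Rightarrow> 'x::real_normed_vector"
  assumes c: "c \<in> A" "p \<in> fst c" and d: "d \<in> A" "p \<in> fst d"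
    and f: "(f \<circ> chart_inv d) differentiable (at (snd d p))"
  shows "((f \<circ> chart_inv c) has_derivative
     (\<lambda>w. frechet_derivative (f \<circ> chart_inv d) (at (snd d p))
        (frechet_derivative (snd d \<circ> chart_inv c) (at (snd c p)) w))) (at (snd c p))"
proof -
  let ?U = "snd c ` (fst c \<inter> fst d)"
  have p: "snd c p \<in> ?U" using c d by auto
  have "((f \<circ> chart_inv d) has_derivative frechet_derivative (f \<circ> chart_inv d) (at (snd d p)))
      (at ((snd d \<circ> chart_inv c) (snd c p)))"
    using has_frechet_derivative[OF f] c atlas_inj by simp
  from has_derivative_compose[OF smooth_on_has_derivative[OF transition_smooth[OF c(1) d(1)] p] this]
  show ?thesis
    by (rule has_derivative_cong_open[OF _ transition_open[OF c(1) d(1)] p])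
      (use c d atlas_inj in auto)
qed

lemma transition_linear:
  assumes "c \<in> A" "p \<in> fst c" "d \<in> A" "p \<in> fst d"
  shows "linear (frechet_derivative (snd d \<circ> chart_inv c) (at (snd c p)))"
  using assms by (intro smooth_on_linear_deriv[OF transition_smooth]) auto

lemma transition_cocycle:
  assumes c: "c \<in> A" "p \<in> fst c" and d: "d \<in> A" "p \<in> fst d" and e: "e \<in> A" "p \<in> fst e"
  shows "frechet_derivative (snd e \<circ> chart_inv c) (at (snd c p)) w =
     frechet_derivative (snd e \<circ> chart_inv d) (at (snd d p))
        (frechet_derivative (snd d \<circ> chart_inv c) (at (snd c p)) w)"
proof -
  have "(snd e \<circ> chart_inv d) differentiable (at (snd d p))"
    using d e by (intro smooth_on_differentiable[OF transition_smooth]) auto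
  from frechet_derivative_eqI[OF chart_change[OF c d this]] show ?thesis by simp
qed

lemma transition_refl:
  assumes c: "c \<in> A" "p \<in> fst c"
  shows "frechet_derivative (snd c \<circ> chart_inv c) (at (snd c p)) w = w"
proof -
  have "((snd c \<circ> chart_inv c) has_derivative (\<lambda>w. w)) (at (snd c p))"
    by (rule has_derivative_cong_open[OF has_derivative_ident transition_open[OF c(1) c(1)]])
      (use c atlas_inj in auto)
  from frechet_derivative_eqI[OF this] show ?thesis by simp
qed

lemma tangent_of_in:
  assumes c: "c \<in> A" "p \<in> fst c"
  shows "tangent_of A c p w \<in> tangent_space A p"
  unfolding tangent_space_def tangent_of_def using c by (auto intro: transition_cocycle)

lemma snd_tangent_of:
  assumes "c \<in> A" "p \<in> fst c" shows "snd (tangent_of A c p w) c = w"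
  using assms transition_refl by (simp add: tangent_of_def)

lemma tangent_of_snd:
  assumes "v \<in> tangent_space A p" "c \<in> A" "p \<in> fst c"
  shows "tangent_of A c p (snd v c) = v"
proof (rule prod_eqI)
  show "fst (tangent_of A c p (snd v c)) = fst v"
    using assms by (simp add: tangent_of_def tangent_space_fst)
  show "snd (tangent_of A c p (snd v c)) = snd v"
  proof
    fix d
    show "snd (tangent_of A c p (snd v c)) d = snd v d"
    proof (cases "d \<in> A \<and> p \<in> fst d")
      case True
      then show ?thesis using tangent_space_change[OF assms, of d] by (simp add: tangent_of_def)
    next
      case False
      \<comment> \<open>The zero default at indices that are not charts around \<open>p\<close> is
        what lets one component determine the whole tangent vector.\<close>
      then have "snd v d = 0" using assms(1) unfolding tangent_space_iff by blast
      then show ?thesis using False by (auto simp: tangent_of_def)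
    qed
  qed
qed

lemma tangent_eqI:
  assumes "v \<in> tangent_space A p" "w \<in> tangent_space A p" "c \<in> A" "p \<in> fst c" "snd v c = snd w c"
  shows "v = w"
  using assms tangent_of_snd by metis

lemma tangent_of_0:
  assumes "c \<in> A" "p \<in> fst c" shows "tangent_of A c p 0 = tzero p"
  using linear_0[OF transition_linear[OF assms]] by (simp add: tangent_of_def tzero_def fun_eq_iff del: split_paired_All)

lemma tangent_of_tadd:
  assumes "c \<in> A" "p \<in> fst c"
  shows "tangent_of A c p (x + y) = tadd (tangent_of A c p x) (tangent_of A c p y)"
  using linear_add[OF transition_linear[OF assms]] by (simp add: tangent_of_def tadd_def fun_eq_iff del: split_paired_All)

lemma tangent_of_tscale:
  assumes "c \<in> A" "p \<in> fst c"
  shows "tangent_of A c p (r *\<^sub>R x) = tscale r (tangent_of A c p x)"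
  using linear_scale[OF transition_linear[OF assms]] by (simp add: tangent_of_def tscale_def fun_eq_iff del: split_paired_All)

end

lemma fst_tangent_of [simp]: "fst (tangent_of A c p w) = p"
  by (simp add: tangent_of_def)

lemma points_iff: "p \<in> points A \<longleftrightarrow> (\<exists>c\<in>A. p \<in> fst c)"
  by (auto simp: points_def)

lemma chart_at: "p \<in> points A \<Longrightarrow> chart_at A p \<in> A \<and> p \<in> fst (chart_at A p)"
  unfolding chart_at_def points_iff by (rule someI_ex) blast

lemma TM_iff: "v \<in> TM A \<longleftrightarrow> fst v \<in> points A \<and> v \<in> tangent_space A (fst v)"
  unfolding TM_def using tangent_space_fst by fastforce

lemma TM_I: "v \<in> tangent_space A p \<Longrightarrow> p \<in> points A \<Longrightarrow> v \<in> TM A"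
  unfolding TM_def by blast

lemma slit_TM_iff: 
  assumes A: "smooth_atlas A" and v: "v \<in> TM A" and c: "c \<in> A" "fst v \<in> fst c"
  shows "v \<in> slit_TM A \<longleftrightarrow> snd v c \<noteq> 0"
proof -
  have "tzero (fst v) \<in> tangent_space A (fst v)"
    using tangent_of_in[OF A c, of 0] tangent_of_0[OF A c] by simp
  then have "v = tzero (fst v)" if "snd v c = 0"
    using tangent_eqI[OF A _ _ c] v that unfolding TM_iff tzero_def by (metis snd_conv)
  moreover have "snd v c = 0" if "v = tzero (fst v)"
    using arg_cong[OF that, of "\<lambda>w. snd w c"] by (simp add: tzero_def)
  ultimately show ?thesis using v by (auto simp: slit_TM_def)
qed

section \<open>The atlas of the tangent bundle\<close>

lemma fst_tchart: "fst (tchart A c) = {v \<in> TM A. fst v \<in> fst c}"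
  by (simp add: tchart_def)

lemma snd_tchart: "snd (tchart A c) v = (snd c (fst v), snd v c)"
  by (simp add: tchart_def)

lemma tchart_in: "c \<in> A \<Longrightarrow> tchart A c \<in> tatlas A"
  by (simp add: tatlas_def)

context
  fixes A :: "('m, 'a::real_normed_vector) chart set"
  assumes A: "smooth_atlas A"
begin

lemma tchart_image:
  assumes c: "c \<in> A" and W: "W \<subseteq> fst c"
  shows "snd (tchart A c) ` {v \<in> TM A. fst v \<in> W} = (snd c ` W) \<times> UNIV"
proof (intro set_eqI iffI)
  fix z :: "'a \<times> 'a" assume z: "z \<in> (snd c ` W) \<times> UNIV"
  then obtain p u where p: "p \<in> W" "z = (snd c p, u)" by (cases z) auto
  let ?v = "tangent_of A c p u"
  have pc: "p \<in> fst c" using p W by auto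
  have "?v \<in> TM A" by (rule TM_I[OF tangent_of_in[OF A c pc]]) (use c pc in \<open>auto simp: points_def\<close>)
  moreover have "snd (tchart A c) ?v = z" using p by (simp add: snd_tchart snd_tangent_of[OF A c pc])
  ultimately show "z \<in> snd (tchart A c) ` {v \<in> TM A. fst v \<in> W}" using p
    by (intro image_eqI[of _ _ ?v]) auto
qed (auto simp: snd_tchart)

lemma tchart_inj: "c \<in> A \<Longrightarrow> inj_on (snd (tchart A c)) (fst (tchart A c))"
proof (rule inj_onI)
  fix v w assume c: "c \<in> A" and vw: "v \<in> fst (tchart A c)" "w \<in> fst (tchart A c)"
    "snd (tchart A c) v = snd (tchart A c) w"
  then have "fst v = fst w" using atlas_inj[OF A c] by (auto simp: fst_tchart snd_tchart dest: inj_onD)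
  have "v \<in> tangent_space A (fst v)" "w \<in> tangent_space A (fst w)" "fst v \<in> fst c" "snd v c = snd w c"
    using vw by (simp_all add: fst_tchart snd_tchart TM_iff)
  then show "v = w"
    using tangent_eqI[OF A, of v "fst v" w c] c \<open>fst v = fst w\<close> by simp
qed

lemma tchart_inv:
  assumes c: "c \<in> A" and q: "q \<in> snd c ` fst c"
  shows "chart_inv (tchart A c) (q, u) = tangent_of A c (chart_inv c q) u"
proof (rule inv_into_f_eq[OF tchart_inj[OF c]])
  have p: "chart_inv c q \<in> fst c" using q by (rule chart_inv_in)
  show "tangent_of A c (chart_inv c q) u \<in> fst (tchart A c)"
    using p c by (auto simp: fst_tchart points_def intro!: TM_I[OF tangent_of_in[OF A c p]])
  show "snd (tchart A c) (tangent_of A c (chart_inv c q) u) = (q, u)"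
    using p q c by (simp add: snd_tchart snd_tangent_of[OF A] chart_chart_inv)
qed

lemma tchart_transition:
  assumes c: "c \<in> A" and d: "d \<in> A" and q: "q \<in> snd c ` (fst c \<inter> fst d)"
  shows "(snd (tchart A d) \<circ> chart_inv (tchart A c)) (q, u) =
    ((snd d \<circ> chart_inv c) q, frechet_derivative (snd d \<circ> chart_inv c) (at q) u)"
proof -
  have "chart_inv c q \<in> fst d" "snd c (chart_inv c q) = q" using q atlas_inj[OF A c] by auto
  moreover have "q \<in> snd c ` fst c" using q by auto
  ultimately show ?thesis
    using d by (simp add: tchart_inv[OF c] snd_tchart) (simp add: tangent_of_def)
qed

lemma tchart_transition':
  assumes c: "c \<in> A" and d: "d \<in> A" and z: "z \<in> snd c ` (fst c \<inter> fst d) \<times> UNIV"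
  shows "(snd (tchart A d) \<circ> chart_inv (tchart A c)) z =
    ((snd d \<circ> chart_inv c) (fst z), frechet_derivative (snd d \<circ> chart_inv c) (at (fst z)) (snd z))"
  using tchart_transition[OF c d, of "fst z" "snd z"] z by (simp only: mem_Times_iff prod.collapse)

lemma tchart_Int_image:
  assumes c: "c \<in> A"
  shows "snd (tchart A c) ` (fst (tchart A c) \<inter> fst (tchart A d)) = snd c ` (fst c \<inter> fst d) \<times> UNIV"
proof -
  have "fst (tchart A c) \<inter> fst (tchart A d) = {v \<in> TM A. fst v \<in> fst c \<inter> fst d}"
    by (auto simp: fst_tchart)
  then show ?thesis using tchart_image[OF c, of "fst c \<inter> fst d"] by simp
qed

lemma tchart_full_image:
  "c \<in> A \<Longrightarrow> snd (tchart A c) ` fst (tchart A c) = snd c ` fst c \<times> UNIV"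
  using tchart_image[of c "fst c"] by (simp add: fst_tchart)

lemma points_tatlas: "points (tatlas A) = TM A"
proof (rule set_eqI)
  show "v \<in> points (tatlas A) \<longleftrightarrow> v \<in> TM A" for v
    using TM_iff[of v A] points_iff[of "fst v" A] by (auto simp: points_iff[of v] tatlas_def fst_tchart)
qed

end

lemma smooth_atlas_tatlas:
  fixes A :: "('m, 'a::euclidean_space) chart set"
  assumes A: "smooth_atlas A"
  shows "smooth_atlas (tatlas A)"
  unfolding smooth_atlas_def
proof (intro conjI ballI)
  fix C assume "C \<in> tatlas A"
  then obtain c where c: "c \<in> A" "C = tchart A c" by (auto simp: tatlas_def)
  show "inj_on (snd C) (fst C)" using tchart_inj[OF A c(1)] c by simp
  show "open (snd C ` fst C)"
    using tchart_full_image[OF A c(1)] c open_chart[OF smooth_atlas_imp_chart_atlas[OF A]]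
    by (auto intro: open_Times)
  fix D assume "D \<in> tatlas A"
  then obtain d where d: "d \<in> A" "D = tchart A d" by (auto simp: tatlas_def)
  let ?U = "snd c ` (fst c \<inter> fst d)" and ?\<tau> = "snd d \<circ> chart_inv c"
  have im: "snd C ` (fst C \<inter> fst D) = ?U \<times> UNIV"
    using tchart_Int_image[OF A c(1)] c d by simp
  have U: "open ?U" using transition_open[OF A c(1) d(1)] .
  then have UU: "open (?U \<times> (UNIV :: 'a set))" by (simp add: open_Times)
  then show "open (snd C ` (fst C \<inter> fst D))" unfolding im .
  have f: "smooth_on (?U \<times> (UNIV :: 'a set)) fst" and s: "smooth_on (?U \<times> (UNIV :: 'a set)) snd"
    by (rule smooth_on_linear[OF bounded_linear_fst UU], rule smooth_on_linear[OF bounded_linear_snd UU])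
  have "smooth_on (?U \<times> UNIV) (\<lambda>z. (?\<tau> (fst z), frechet_derivative ?\<tau> (at (fst z)) (snd z)))"
    by (rule smooth_on_Pair[OF UU smooth_on_compose[OF transition_smooth[OF A c(1) d(1)] UU f]
          smooth_on_deriv_compose[OF transition_smooth[OF A c(1) d(1)] UU f s]]) auto
  then show "smooth_on (snd C ` (fst C \<inter> fst D)) (snd D \<circ> chart_inv C)"
    unfolding im
    unfolding c d by (rule smooth_on_cong[OF _ UU]) (rule tchart_transition'[OF A c(1) d(1), symmetric])
qed

text \<open>The fibre component picks up a second-derivative term of the transition map, applied to
  the base direction \<open>x\<close>. For vertical vectors \<open>x = 0\<close>, and they transform
  linearly.\<close>

lemma tchart_transition_has_derivative:
  fixes A :: "('m, 'a::euclidean_space) chart set"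
  assumes A: "smooth_atlas A" and c: "c \<in> A" and d: "d \<in> A" and q: "q \<in> snd c ` (fst c \<inter> fst d)"
  shows "((snd (tchart A d) \<circ> chart_inv (tchart A c)) has_derivative
    (\<lambda>(x, y). (frechet_derivative (snd d \<circ> chart_inv c) (at q) x,
       frechet_derivative (\<lambda>r. frechet_derivative (snd d \<circ> chart_inv c) (at r) u) (at q) x +
       frechet_derivative (snd d \<circ> chart_inv c) (at q) y))) (at (q, u))"
proof -
  let ?U = "snd c ` (fst c \<inter> fst d)" and ?\<tau> = "snd d \<circ> chart_inv c"
  have U: "open ?U" using transition_open[OF A c d] .
  then have UU: "open (?U \<times> (UNIV :: 'a set))" by (simp add: open_Times)
  have f: "(fst has_derivative fst) (at (q, u))" and s: "(snd has_derivative snd) (at (q, u))"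
    by (auto intro!: bounded_linear_imp_has_derivative bounded_linear_fst bounded_linear_snd)
  have \<tau>: "(?\<tau> has_derivative frechet_derivative ?\<tau> (at q)) (at (fst (q, u)))"
    using smooth_on_has_derivative[OF transition_smooth[OF A c d] q] by simp
  have 1: "((\<lambda>z. (?\<tau> (fst z), frechet_derivative ?\<tau> (at (fst z)) (snd z))) has_derivative
     (\<lambda>z. (frechet_derivative ?\<tau> (at q) (fst z),
       frechet_derivative (\<lambda>r. frechet_derivative ?\<tau> (at r) (snd (q, u))) (at (fst (q, u))) (fst z) +
       frechet_derivative ?\<tau> (at (fst (q, u))) (snd z)))) (at (q, u))"
    by (rule has_derivative_Pair[OF has_derivative_compose[OF f \<tau>]
          has_derivative_deriv_compose[OF transition_smooth[OF A c d] U _ f s]]) (use q in simp)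
  have "((snd (tchart A d) \<circ> chart_inv (tchart A c)) has_derivative
     (\<lambda>z. (frechet_derivative ?\<tau> (at q) (fst z),
       frechet_derivative (\<lambda>r. frechet_derivative ?\<tau> (at r) (snd (q, u))) (at (fst (q, u))) (fst z) +
       frechet_derivative ?\<tau> (at (fst (q, u))) (snd z)))) (at (q, u))"
    by (rule has_derivative_cong_open[OF 1 UU _ tchart_transition'[OF A c d, symmetric]]) (use q in simp_all)
  then show ?thesis by (simp add: case_prod_beta')
qed

section \<open>Smooth maps in charts\<close>

text \<open>One pair of charts around each point suffices. Since \<open>V\<close> consists of points
  of \<open>S\<close> that are sent into the target chart, openness of \<open>S\<close> and
  continuity can be read off locally; all other pairs of charts follow by composing with transition
  maps on both sides.\<close>

lemma smooth_map_onI: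
  fixes A :: "('m, 'a::euclidean_space) chart set" and B :: "('n, 'b::euclidean_space) chart set"
  assumes A: "smooth_atlas A" and B: "smooth_atlas B"
    and loc: "\<And>p. p \<in> S \<Longrightarrow> \<exists>c\<in>A. \<exists>d\<in>B. \<exists>V. open V \<and> p \<in> fst c \<and> snd c p \<in> V \<and>
      V \<subseteq> snd c ` (fst c \<inter> S \<inter> f -` fst d) \<and> smooth_on V (snd d \<circ> f \<circ> chart_inv c)"
  shows "smooth_map_on A S B f"
proof -
  note cA = smooth_atlas_imp_chart_atlas[OF A] and cB = smooth_atlas_imp_chart_atlas[OF B]
  have key: "\<exists>T c d V. c \<in> A \<and> d \<in> B \<and> open V \<and> p \<in> T \<and> T \<subseteq> fst c \<inter> S \<inter> f -` (fst d \<inter> W) \<and>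
      snd c ` T = V \<and> openin (mtopology A) T \<and> smooth_on V (snd d \<circ> f \<circ> chart_inv c)"
    if p: "p \<in> S" and W: "openin (mtopology B) W" "f p \<in> W" for p W
  proof -
    obtain c d V where c: "c \<in> A" "p \<in> fst c" and d: "d \<in> B" and V: "open V" "snd c p \<in> V"
      and sub: "V \<subseteq> snd c ` (fst c \<inter> S \<inter> f -` fst d)" and sm: "smooth_on V (snd d \<circ> f \<circ> chart_inv c)"
      using loc[OF p] by blast
    note ic = atlas_inj[OF A c(1)] and id = atlas_inj[OF B d]
    \<comment> \<open>\<open>V'\<close> keeps the part of \<open>V\<close> that is sent into
      \<open>W\<close>; \<open>T\<close> is the same set in the manifold. Taking \<open>W\<close>
      arbitrary gives continuity, taking it to be a second target chart gives smoothness
      there.\<close>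
    define V' where "V' = V \<inter> (snd d \<circ> f \<circ> chart_inv c) -` (snd d ` (W \<inter> fst d))"
    define T where "T = fst c \<inter> snd c -` V'"
    have V': "open V'"
      unfolding V'_def
      by (rule continuous_open_preimage[OF smooth_on_continuous_on[OF sm] V(1) open_chart_image[OF cB d W(1)]])
    have inV: "x \<in> S \<and> f x \<in> fst d" if "x \<in> fst c" "snd c x \<in> V" for x
      using sub that ic by (auto dest!: subsetD inj_onD)
    have TW: "T \<subseteq> fst c \<inter> S \<inter> f -` (fst d \<inter> W)"
    proof
      fix x assume x: "x \<in> T"
      then have x': "x \<in> fst c" "snd c x \<in> V" "snd d (f x) \<in> snd d ` (W \<inter> fst d)"
        using ic by (auto simp: T_def V'_def)
      have "f x \<in> W"
        using x'(3) inV[OF x'(1,2)] id by (auto dest: inj_onD)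
      then show "x \<in> fst c \<inter> S \<inter> f -` (fst d \<inter> W)" using x' inV by auto
    qed
    have im: "snd c ` T = V'"
    proof
      show "V' \<subseteq> snd c ` T"
      proof
        fix y assume y: "y \<in> V'"
        then obtain x where "x \<in> fst c" "y = snd c x" using sub unfolding V'_def by auto
        then show "y \<in> snd c ` T" using y by (auto simp: T_def)
      qed
    qed (auto simp: T_def)
    have "openin (mtopology A) T"
      using openin_chart_subset[OF A c(1), of T] V' im by (auto simp: T_def)
    moreover have "p \<in> T"
      using c V W(2) inV[OF c(2) V(2)] ic by (auto simp: T_def V'_def)
    moreover have "smooth_on V' (snd d \<circ> f \<circ> chart_inv c)"
      by (rule smooth_on_subset[OF sm]) (auto simp: V'_def)
    ultimately show ?thesis
      using c(1) d V' TW im by blast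
  qed
  have fS: "f p \<in> points B" if "p \<in> S" for p
  proof -
    obtain c d V where c: "c \<in> A" "p \<in> fst c" and d: "d \<in> B" and V: "snd c p \<in> V"
      and sub: "V \<subseteq> snd c ` (fst c \<inter> S \<inter> f -` fst d)"
      using loc[OF \<open>p \<in> S\<close>] by blast
    then have "f p \<in> fst d" using atlas_inj[OF A c(1)] by (auto dest!: subsetD inj_onD)
    then show ?thesis using d by (auto simp: points_def)
  qed
  have pre: "openin (mtopology A) {p \<in> S. f p \<in> W}" if W: "openin (mtopology B) W" for W
  proof (subst openin_subopen, intro ballI)
    fix p assume "p \<in> {p \<in> S. f p \<in> W}"
    then have "p \<in> S" "f p \<in> W" by auto
    from key[OF this(1) W this(2)] obtain T c d where
      "openin (mtopology A) T" "p \<in> T" "c \<in> A" "d \<in> B" "T \<subseteq> fst c \<inter> S \<inter> f -` (fst d \<inter> W)"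
      by (elim exE conjE) (rule that)
    then show "\<exists>T. openin (mtopology A) T \<and> p \<in> T \<and> T \<subseteq> {p \<in> S. f p \<in> W}"
      by (intro exI[of _ T]) auto
  qed
  have "{p \<in> S. f p \<in> topspace (mtopology B)} = S"
    using fS by (auto simp: topspace_mtopology[OF cB])
  then have S: "openin (mtopology A) S"
    using pre[OF openin_topspace] by simp
  have "continuous_map (subtopology (mtopology A) S) (mtopology B) f"
    unfolding continuous_map_def
  proof (intro conjI allI impI)
    show "f \<in> topspace (subtopology (mtopology A) S) \<rightarrow> topspace (mtopology B)"
      using fS by (auto simp: topspace_mtopology[OF cB])
    fix W assume W: "openin (mtopology B) W"
    have "{x \<in> topspace (subtopology (mtopology A) S). f x \<in> W} = {p \<in> S. f p \<in> W}"
      using openin_subset[OF S] by auto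
    then show "openin (subtopology (mtopology A) S) {x \<in> topspace (subtopology (mtopology A) S). f x \<in> W}"
      using pre[OF W] openin_open_subtopology[OF S] by auto
  qed
  moreover have "smooth_on (snd c' ` (fst c' \<inter> S \<inter> f -` fst d')) (snd d' \<circ> f \<circ> chart_inv c')"
    if c': "c' \<in> A" and d': "d' \<in> B" for c' d'
  proof (rule smooth_on_local)
    fix y assume "y \<in> snd c' ` (fst c' \<inter> S \<inter> f -` fst d')"
    then obtain p where p: "p \<in> fst c'" "p \<in> S" "f p \<in> fst d'" "y = snd c' p" by auto
    from key[OF p(2) openin_chart[OF cB d'] p(3)] obtain T c d V where
      c: "c \<in> A" and d: "d \<in> B" and V: "open V" and T: "p \<in> T" "T \<subseteq> fst c \<inter> S \<inter> f -` (fst d \<inter> fst d')"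
      "snd c ` T = V" "openin (mtopology A) T" and sm: "smooth_on V (snd d \<circ> f \<circ> chart_inv c)"
      by blast
    let ?V = "snd c' ` (T \<inter> fst c')"
    have V': "open ?V" by (rule open_chart_image[OF cA c' T(4)])
    have 1: "smooth_on ?V (snd c \<circ> chart_inv c')"
      by (rule smooth_on_subset[OF transition_smooth[OF A c' c]]) (use T in auto)
    have 2: "(snd c \<circ> chart_inv c') x \<in> V" if "x \<in> ?V" for x
      using that T atlas_inj[OF A c'] by auto
    have 3: "smooth_on ?V (\<lambda>x. (snd d \<circ> f \<circ> chart_inv c) ((snd c \<circ> chart_inv c') x))"
      by (rule smooth_on_compose[OF sm V' 1 2])
    have 4: "(snd d \<circ> f \<circ> chart_inv c) ((snd c \<circ> chart_inv c') x) = snd d (f (chart_inv c' x))" if "x \<in> ?V" for x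
      using that T atlas_inj[OF A c'] atlas_inj[OF A c] by auto
    have 5: "f (chart_inv c' x) \<in> fst d \<inter> fst d'" if "x \<in> ?V" for x
      using that T atlas_inj[OF A c'] by auto
    have "smooth_on ?V (\<lambda>x. (snd d' \<circ> chart_inv d) ((snd d \<circ> f \<circ> chart_inv c) ((snd c \<circ> chart_inv c') x)))"
      by (rule smooth_on_compose[OF transition_smooth[OF B d d'] V' 3]) (use 4 5 in auto)
    then have "smooth_on ?V (snd d' \<circ> f \<circ> chart_inv c')"
      by (rule smooth_on_cong[OF _ V']) (use 4 5 atlas_inj[OF B d] in auto)
    moreover have "y \<in> ?V" using p T by auto
    ultimately show "\<exists>V. open V \<and> y \<in> V \<and> smooth_on V (snd d' \<circ> f \<circ> chart_inv c')"
      using V' by blast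
  qed
  ultimately show ?thesis
    unfolding smooth_map_on_def using S by blast
qed

lemma continuous_map_chartD:
  fixes f :: "'m \<Rightarrow> 'x::topological_space"
  assumes A: "chart_atlas A" and f: "continuous_map (mtopology A) euclidean f" and c: "c \<in> A"
  shows "continuous_on (snd c ` fst c) (f \<circ> chart_inv c)"
  unfolding continuous_on_open_vimage[OF open_chart[OF A c]]
proof (intro allI impI)
  fix U :: "'x set" assume "open U"
  then have "openin (mtopology A) {p \<in> points A. f p \<in> U}"
    using f by (simp add: continuous_map_def topspace_mtopology[OF A])
  moreover have "(f \<circ> chart_inv c) -` U \<inter> snd c ` fst c = snd c ` ({p \<in> points A. f p \<in> U} \<inter> fst c)"
    using chart_atlas_inj[OF A c] c by (auto simp: points_def)
  ultimately show "open ((f \<circ> chart_inv c) -` U \<inter> snd c ` fst c)"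
    using open_chart_image[OF A c] by simp
qed

text \<open>The pointwise form allows zero and nonzero tangent vectors to be treated by different
  arguments later.\<close>

lemma continuous_map_chartI:
  fixes f :: "'m \<Rightarrow> 'x::topological_space"
  assumes A: "smooth_atlas A"
    and f: "\<And>p. p \<in> points A \<Longrightarrow> \<exists>c\<in>A. p \<in> fst c \<and> isCont (f \<circ> chart_inv c) (snd c p)"
  shows "continuous_map (mtopology A) euclidean f"
proof -
  note cA = smooth_atlas_imp_chart_atlas[OF A]
  have cont: "continuous_on (snd c ` fst c) (f \<circ> chart_inv c)" if c: "c \<in> A" for c
  proof (intro continuous_at_imp_continuous_on ballI)
    fix y assume "y \<in> snd c ` fst c"
    then obtain p where p: "p \<in> fst c" "y = snd c p" by auto
    then have "p \<in> points A" using c by (auto simp: points_def)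
    from f[OF this] obtain d where d: "d \<in> A" "p \<in> fst d" "isCont (f \<circ> chart_inv d) (snd d p)"
      by blast
    let ?U = "snd c ` (fst c \<inter> fst d)"
    have U: "open ?U" "y \<in> ?U" using transition_open[OF A c d(1)] p d by auto
    have "isCont (snd d \<circ> chart_inv c) y"
      using smooth_on_continuous_on[OF transition_smooth[OF A c d(1)]] U continuous_on_eq_continuous_at by blast
    moreover have "isCont (f \<circ> chart_inv d) ((snd d \<circ> chart_inv c) y)"
      using d p atlas_inj[OF A c] by simp
    ultimately have "isCont ((f \<circ> chart_inv d) \<circ> (snd d \<circ> chart_inv c)) y"
      by (rule continuous_at_compose)
    moreover have "\<forall>\<^sub>F x in nhds y. ((f \<circ> chart_inv d) \<circ> (snd d \<circ> chart_inv c)) x = (f \<circ> chart_inv c) x"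
      using U atlas_inj[OF A c] atlas_inj[OF A d(1)] unfolding eventually_nhds
      by (intro exI[of _ ?U]) auto
    ultimately show "isCont (f \<circ> chart_inv c) y"
      using isCont_cong by blast
  qed
  have "openin (mtopology A) {p \<in> points A. f p \<in> U}" if U: "open U" for U
    unfolding openin_mtopology[OF cA]
  proof (intro conjI ballI)
    fix c assume c: "c \<in> A"
    have "(f \<circ> chart_inv c) -` U \<inter> snd c ` fst c = snd c ` ({p \<in> points A. f p \<in> U} \<inter> fst c)"
      using atlas_inj[OF A c] c by (auto simp: points_def)
    then show "open (snd c ` ({p \<in> points A. f p \<in> U} \<inter> fst c))"
      using cont[OF c] U unfolding continuous_on_open_vimage[OF open_chart[OF cA c]] by auto
  qed auto
  then show ?thesis
    by (simp add: continuous_map_def topspace_mtopology[OF cA])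
qed

lemma smooth_atlas_vs_atlas: "smooth_atlas (vs_atlas :: ('a, 'a::real_normed_vector) chart set)"
proof -
  have "inv_into UNIV (id :: 'a \<Rightarrow> 'a) = id" by (simp add: inv_id)
  then show ?thesis
    unfolding smooth_atlas_def vs_atlas_def by (simp add: smooth_on_id[OF open_UNIV, unfolded id_def[symmetric]] id_def[symmetric])
qed

section \<open>Chart independence\<close>

lemma tangent_of_change:
  assumes A: "smooth_atlas A" and c: "c \<in> A" "p \<in> fst c" and d: "d \<in> A" "p \<in> fst d"
  shows "tangent_of A d p (frechet_derivative (snd d \<circ> chart_inv c) (at (snd c p)) w) = tangent_of A c p w"
proof (rule tangent_eqI[OF A tangent_of_in[OF A d] tangent_of_in[OF A c] d])
  show "snd (tangent_of A d p (frechet_derivative (snd d \<circ> chart_inv c) (at (snd c p)) w)) d = snd (tangent_of A c p w) d"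
    using d by (subst snd_tangent_of[OF A d]) (simp add: tangent_of_def)
qed

text \<open>Frees the derivative from the arbitrary \<open>chart_at\<close>: the chain rule and the
  transformation law of the components cancel. Differentiability is what makes the chain rule
  available, since otherwise \<open>frechet_derivative\<close> is an unspecified choice.\<close>

lemma tderiv_eq:
  assumes A: "smooth_atlas A" and v: "v \<in> tangent_space A p" and c: "c \<in> A" "p \<in> fst c"
    and g: "(g \<circ> chart_inv c) differentiable (at (snd c p))"
  shows "tderiv A v g = frechet_derivative (g \<circ> chart_inv c) (at (snd c p)) (snd v c)"
proof -
  have p: "fst v = p" using v by (rule tangent_space_fst)
  have e: "chart_at A p \<in> A" "p \<in> fst (chart_at A p)"
    using chart_at[of p A] c by (auto simp: points_def)
  show ?thesis
    using frechet_derivative_eqI[OF chart_change[OF A e c g]] tangent_space_change[OF v e c]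
    by (simp add: tderiv_def p Let_def)
qed

lemma tangent_map_eq:
  assumes A: "smooth_atlas A" and B: "smooth_atlas B" and f: "smooth_map_on A S B f" and p: "p \<in> S"
    and v: "v \<in> tangent_space A p" and c: "c \<in> A" "p \<in> fst c" and d: "d \<in> B" "f p \<in> fst d"
  shows "tangent_map A B f v =
    tangent_of B d (f p) (frechet_derivative (snd d \<circ> f \<circ> chart_inv c) (at (snd c p)) (snd v c))"
proof -
  define c0 where "c0 = chart_at A p"
  define d0 where "d0 = chart_at B (f p)"
  have c0: "c0 \<in> A" "p \<in> fst c0" and d0: "d0 \<in> B" "f p \<in> fst d0"
    using chart_at[of p A] chart_at[of "f p" B] c d by (auto simp: points_def c0_def d0_def)
  note cA = smooth_atlas_imp_chart_atlas[OF A] and cB = smooth_atlas_imp_chart_atlas[OF B]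
  let ?U = "\<lambda>d. snd c ` (fst c \<inter> S \<inter> f -` fst d)"
  let ?g = "\<lambda>d. snd d \<circ> f \<circ> chart_inv c"
  have U: "open (?U d)" "snd c p \<in> ?U d" if "d \<in> B" "f p \<in> fst d" for d
    using smooth_map_on_openD[OF f cA cB c(1) that(1)] p c that by auto
  have diff: "?g d differentiable (at (snd c p))" if "d \<in> B" "f p \<in> fst d" for d
    by (rule smooth_on_differentiable[OF smooth_map_onD[OF f c(1) that(1)] U(2)[OF that]])
  have 1: "frechet_derivative (snd d0 \<circ> f \<circ> chart_inv c0) (at (snd c0 p)) (snd v c0) =
      frechet_derivative (?g d0) (at (snd c p)) (snd v c)"
    using frechet_derivative_eqI[OF chart_change[OF A c0 c diff[OF d0]]]
      tangent_space_change[OF v c0 c] by simp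
  have "((\<lambda>x. (snd d0 \<circ> chart_inv d) (?g d x)) has_derivative
     (\<lambda>x. frechet_derivative (snd d0 \<circ> chart_inv d) (at (snd d (f p)))
        (frechet_derivative (?g d) (at (snd c p)) x))) (at (snd c p))"
  proof (rule has_derivative_compose[OF has_frechet_derivative[OF diff[OF d]]])
    show "(snd d0 \<circ> chart_inv d has_derivative frechet_derivative (snd d0 \<circ> chart_inv d) (at (snd d (f p))))
      (at (?g d (snd c p)))"
      using smooth_on_has_derivative[OF transition_smooth[OF B d(1) d0(1)], of "snd d (f p)"] d d0 c atlas_inj[OF A c(1)]
      by auto
  qed
  then have "(?g d0 has_derivative
     (\<lambda>x. frechet_derivative (snd d0 \<circ> chart_inv d) (at (snd d (f p)))
        (frechet_derivative (?g d) (at (snd c p)) x))) (at (snd c p))"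
    by (rule has_derivative_cong_open[OF _ U(1)[OF d] U(2)[OF d]])
      (use atlas_inj[OF A c(1)] atlas_inj[OF B d(1)] in auto)
  then have 2: "frechet_derivative (?g d0) (at (snd c p)) (snd v c) =
     frechet_derivative (snd d0 \<circ> chart_inv d) (at (snd d (f p)))
        (frechet_derivative (?g d) (at (snd c p)) (snd v c))"
    by (simp add: frechet_derivative_eqI)
  have "tangent_map A B f v = tangent_of B d0 (f p)
      (frechet_derivative (snd d0 \<circ> f \<circ> chart_inv c0) (at (snd c0 p)) (snd v c0))"
    by (simp add: tangent_map_def Let_def tangent_space_fst[OF v] c0_def d0_def)
  then show ?thesis
    unfolding 1 2 tangent_of_change[OF B d d0] .
qed

section \<open>Lifts of vector fields in charts\<close>

lemma components_chart:
  "inj_on (snd c) (fst c) \<Longrightarrow> p \<in> fst c \<Longrightarrow> components c X (snd c p) = snd (X p) c"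
  by (simp add: components_def)

lemma smooth_on_components:
  fixes A :: "('m, 'a::euclidean_space) chart set"
  assumes A: "smooth_atlas A" and X: "vector_field A X" and c: "c \<in> A"
  shows "smooth_on (snd c ` fst c) (components c X)"
proof -
  have Xp: "X p \<in> fst (tchart A c)" if "p \<in> fst c" for p
  proof -
    have "X p \<in> tangent_space A p" "p \<in> points A"
      using X that c by (auto simp: vector_field_on_def points_def)
    then show ?thesis using that by (auto simp: fst_tchart tangent_space_fst intro: TM_I)
  qed
  have "fst c \<inter> points A \<inter> X -` fst (tchart A c) = fst c"
    using Xp c by (auto simp: points_def)
  then have 1: "smooth_on (snd c ` fst c) (snd (tchart A c) \<circ> X \<circ> chart_inv c)"
    using X smooth_map_onD[OF _ c tchart_in[OF c], of "points A" X] by (simp add: vector_field_on_def)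
  have U: "open (snd c ` fst c)" by (rule open_chart[OF smooth_atlas_imp_chart_atlas[OF A] c])
  have "smooth_on (snd c ` fst c) (\<lambda>x. snd ((snd (tchart A c) \<circ> X \<circ> chart_inv c) x))"
    by (rule smooth_on_linear_comp[OF bounded_linear_snd U 1])
  then show ?thesis
    by (rule smooth_on_cong[OF _ U]) (simp add: components_def snd_tchart)
qed

context
  fixes A :: "('m, 'a::euclidean_space) chart set" and X v p
  assumes A: "smooth_atlas A" and X: "X p \<in> tangent_space A p" and p: "p \<in> points A"
    and v: "v \<in> tangent_space A p"
begin

lemma vertical_lift_in: "vertical_lift A X v \<in> tangent_space (tatlas A) v"
proof -
  have "v \<in> fst (tchart A (chart_at A p))"
    using chart_at[OF p] TM_I[OF v p] tangent_space_fst[OF v] by (simp add: fst_tchart)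
  then show ?thesis
    using tangent_of_in[OF smooth_atlas_tatlas[OF A] tchart_in] chart_at[OF p]
    by (simp add: vertical_lift_def Let_def tangent_space_fst[OF v])
qed

lemma complete_lift_in: "complete_lift A X v \<in> tangent_space (tatlas A) v"
proof -
  have "v \<in> fst (tchart A (chart_at A p))"
    using chart_at[OF p] TM_I[OF v p] tangent_space_fst[OF v] by (simp add: fst_tchart)
  then show ?thesis
    using tangent_of_in[OF smooth_atlas_tatlas[OF A] tchart_in] chart_at[OF p]
    by (simp add: complete_lift_def Let_def tangent_space_fst[OF v])
qed

lemma snd_vertical_lift:
  assumes c: "c \<in> A" "p \<in> fst c"
  shows "snd (vertical_lift A X v) (tchart A c) = (0, snd (X p) c)"
proof -
  define c0 where "c0 = chart_at A p"
  have c0: "c0 \<in> A" "p \<in> fst c0" using chart_at[OF p] by (auto simp: c0_def)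
  have vC: "v \<in> fst (tchart A c)" using c TM_I[OF v p] tangent_space_fst[OF v] by (simp add: fst_tchart)
  have z: "snd (tchart A c0) v = (snd c0 p, snd v c0)" by (simp add: snd_tchart tangent_space_fst[OF v])
  have "snd (vertical_lift A X v) (tchart A c) =
    frechet_derivative (snd (tchart A c) \<circ> chart_inv (tchart A c0)) (at (snd c0 p, snd v c0)) (0, snd (X p) c0)"
    using vC tchart_in[OF c(1)] c0 atlas_inj[OF A c0(1)]
    by (simp add: vertical_lift_def tangent_of_def Let_def tangent_space_fst[OF v] c0_def[symmetric]
        components_chart z)
  also have "\<dots> = (0, frechet_derivative (snd c \<circ> chart_inv c0) (at (snd c0 p)) (snd (X p) c0))"
  proof -
    have q: "snd c0 p \<in> snd c0 ` (fst c0 \<inter> fst c)" using c c0 by auto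
    have "linear (frechet_derivative (snd c \<circ> chart_inv c0) (at (snd c0 p)))"
      by (rule transition_linear[OF A c0 c])
    \<comment> \<open>The second-order term of the transition map is evaluated at the base component
      0, where linearity makes it vanish.\<close>
    moreover have "linear (frechet_derivative
        (\<lambda>r. frechet_derivative (snd c \<circ> chart_inv c0) (at r) (snd v c0)) (at (snd c0 p)))"
      by (rule smooth_on_linear_deriv[OF smooth_on_deriv[OF transition_smooth[OF A c0(1) c(1)]] q])
    ultimately show ?thesis
      unfolding frechet_derivative_eqI[OF tchart_transition_has_derivative[OF A c0(1) c(1) q]]
      by (simp add: linear_0)
  qed
  also have "\<dots> = (0, snd (X p) c)"
    using tangent_space_change[OF X c0 c] by simp
  finally show ?thesis .
qed

lemma tderiv_vertical_lift:
  assumes c: "c \<in> A" "p \<in> fst c"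
    and g: "(g \<circ> chart_inv (tchart A c)) differentiable (at (snd c p, snd v c))"
  shows "tderiv (tatlas A) (vertical_lift A X v) g =
    frechet_derivative (g \<circ> chart_inv (tchart A c)) (at (snd c p, snd v c)) (0, snd (X p) c)"
proof -
  have vC: "v \<in> fst (tchart A c)" using c TM_I[OF v p] tangent_space_fst[OF v] by (simp add: fst_tchart)
  have z: "snd (tchart A c) v = (snd c p, snd v c)" by (simp add: snd_tchart tangent_space_fst[OF v])
  show ?thesis
    using tderiv_eq[OF smooth_atlas_tatlas[OF A] vertical_lift_in tchart_in[OF c(1)] vC, of g] g
    by (simp add: z snd_vertical_lift[OF c])
qed

text \<open>Stated only in the chart that the definition picks. This avoids comparing the
  second-order terms of a complete lift in two charts; whoever expands a complete lift later works
  in \<open>chart_at\<close>.\<close>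

lemma tderiv_complete_lift:
  assumes c: "c = chart_at A p"
    and g: "(g \<circ> chart_inv (tchart A c)) differentiable (at (snd c p, snd v c))"
  shows "tderiv (tatlas A) (complete_lift A X v) g =
    frechet_derivative (g \<circ> chart_inv (tchart A c)) (at (snd c p, snd v c))
      (components c X (snd c p), frechet_derivative (components c X) (at (snd c p)) (snd v c))"
proof -
  have c': "c \<in> A" "p \<in> fst c" using chart_at[OF p] c by auto
  have vC: "v \<in> fst (tchart A c)" using c' TM_I[OF v p] tangent_space_fst[OF v] by (simp add: fst_tchart)
  have z: "snd (tchart A c) v = (snd c p, snd v c)" by (simp add: snd_tchart tangent_space_fst[OF v])
  have "snd (complete_lift A X v) (tchart A c) =
      (components c X (snd c p), frechet_derivative (components c X) (at (snd c p)) (snd v c))"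
    using snd_tangent_of[OF smooth_atlas_tatlas[OF A] tchart_in[OF c'(1)] vC]
    by (simp add: complete_lift_def Let_def tangent_space_fst[OF v] c)
  then show ?thesis
    using tderiv_eq[OF smooth_atlas_tatlas[OF A] complete_lift_in tchart_in[OF c'(1)] vC, of g] g
    by (simp add: z)
qed

end

section \<open>Extension of local vector fields\<close>

text \<open>The inverse chart is continuous, so the image is compact, and compact sets are closed in
  a Hausdorff space. Without this a field cut off inside a chart might not extend smoothly by zero,
  as the line with two origins shows.\<close>

lemma closedin_chart_inv_image:
  assumes A: "smooth_atlas A" and H: "Hausdorff_space (mtopology A)" and c: "c \<in> A"
    and K: "compact K" "K \<subseteq> snd c ` fst c"
  shows "closedin (mtopology A) (chart_inv c ` K)"
proof (rule compactin_imp_closedin[OF H], rule image_compactin)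
  show "compactin (top_of_set K) K"
    using K by (simp add: compactin_subtopology)
  show "continuous_map (top_of_set K) (mtopology A) (chart_inv c)"
    unfolding continuous_map_def
  proof (intro conjI allI impI)
    show "chart_inv c \<in> topspace (top_of_set K) \<rightarrow> topspace (mtopology A)"
    proof
      fix x assume "x \<in> topspace (top_of_set K)"
      then have "chart_inv c x \<in> fst c" using K by (intro chart_inv_in) auto
      then show "chart_inv c x \<in> topspace (mtopology A)"
        using c by (auto simp: topspace_mtopology[OF smooth_atlas_imp_chart_atlas[OF A]] points_def)
    qed
    fix W assume W: "openin (mtopology A) W"
    have "{x \<in> topspace (top_of_set K). chart_inv c x \<in> W} = K \<inter> snd c ` (W \<inter> fst c)"
      using K atlas_inj[OF A c] by auto
    then show "openin (top_of_set K) {x \<in> topspace (top_of_set K). chart_inv c x \<in> W}"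
      using open_chart_image[OF smooth_atlas_imp_chart_atlas[OF A] c W] by (auto simp: openin_open)
  qed
qed

text \<open>Cut off by a bump function and extend by zero. The part of the chart over
  \<open>W\<close> and the complement of the closed support \<open>K\<close> are open and cover the
  manifold, and the field is smooth on each. \<open>\<beta>\<close> is handed out so that pointwise
  linear conditions on \<open>y\<close> can be transferred to the extension.\<close>

lemma extend_vector_field:
  fixes A :: "('m, 'a::euclidean_space) chart set"
  assumes A: "smooth_atlas A" and H: "Hausdorff_space (mtopology A)" and c: "c \<in> A"
    and W: "open W" "W \<subseteq> snd c ` fst c" and y: "smooth_on W y" and q: "q \<in> W"
  obtains X \<beta> where "vector_field A X" "\<beta> q = 1"
    "\<And>p. p \<in> fst c \<Longrightarrow> snd c p \<in> W \<Longrightarrow> X p = tangent_of A c p (\<beta> (snd c p) *\<^sub>R y (snd c p))"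
    "\<And>p. \<not> (p \<in> fst c \<and> snd c p \<in> W) \<Longrightarrow> X p = tzero p"
proof -
  obtain r where r: "r > 0" "cball q r \<subseteq> W" using W(1) q open_contains_cball by blast
  obtain \<beta> :: "'a \<Rightarrow> real" where \<beta>: "smooth_on UNIV \<beta>" "\<beta> q = 1" "\<And>x. x \<notin> cball q r \<Longrightarrow> \<beta> x = 0"
    using smooth_bump[OF r(1)] by metis
  define X where "X p = (if p \<in> fst c \<and> snd c p \<in> W
    then tangent_of A c p (\<beta> (snd c p) *\<^sub>R y (snd c p)) else tzero p)" for p
  have fstX: "fst (X p) = p" for p by (simp add: X_def tzero_def)
  have Xin: "X p \<in> tangent_space A p" if p: "p \<in> points A" for p
  proof -
    obtain d where d: "d \<in> A" "p \<in> fst d" using p by (auto simp: points_def)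
    show ?thesis
      using tangent_of_in[OF A c] tangent_of_in[OF A d, of 0] tangent_of_0[OF A d] by (auto simp: X_def)
  qed
  have XT: "X p \<in> TM A" if p: "p \<in> points A" for p
    using TM_I[OF Xin[OF p] p] .
  define K where "K = chart_inv c ` cball q r"
  have K: "closedin (mtopology A) K"
    unfolding K_def by (rule closedin_chart_inv_image[OF A H c]) (use r W in auto)
  have XK: "X p = tzero p" if "p \<notin> K" for p
  proof (cases "p \<in> fst c \<and> snd c p \<in> W")
    case True
    then have "snd c p \<notin> cball q r"
      using that atlas_inj[OF A c] unfolding K_def by (metis chart_inv_chart imageI)
    then show ?thesis using \<beta>(3) True tangent_of_0[OF A c] by (simp add: X_def)
  qed (auto simp: X_def)
  have "smooth_map_on A (points A) (tatlas A) X"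
  proof (rule smooth_map_onI[OF A smooth_atlas_tatlas[OF A]])
    fix p assume p: "p \<in> points A"
    show "\<exists>c\<in>A. \<exists>d\<in>tatlas A. \<exists>V. open V \<and> p \<in> fst c \<and> snd c p \<in> V \<and>
      V \<subseteq> snd c ` (fst c \<inter> points A \<inter> X -` fst d) \<and> smooth_on V (snd d \<circ> X \<circ> chart_inv c)"
    proof (cases "p \<in> fst c \<and> snd c p \<in> W")
      case True
      have "W \<subseteq> snd c ` (fst c \<inter> points A \<inter> X -` fst (tchart A c))"
      proof
        fix z assume "z \<in> W"
        then obtain x where "x \<in> fst c" "z = snd c x" using W by auto
        then show "z \<in> snd c ` (fst c \<inter> points A \<inter> X -` fst (tchart A c))"
          using c XT fstX by (auto simp: fst_tchart points_def)
      qed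
      moreover have "smooth_on W (snd (tchart A c) \<circ> X \<circ> chart_inv c)"
      proof (rule smooth_on_cong[OF _ W(1)])
        show "smooth_on W (\<lambda>z. (z, \<beta> z *\<^sub>R y z))"
          by (intro smooth_on_Pair smooth_on_id smooth_on_scaleR W(1) y smooth_on_subset[OF \<beta>(1)]) auto
        show "(z, \<beta> z *\<^sub>R y z) = (snd (tchart A c) \<circ> X \<circ> chart_inv c) z" if z: "z \<in> W" for z
        proof -
          have x: "chart_inv c z \<in> fst c" "snd c (chart_inv c z) = z"
            using z W chart_inv_in[of z c] chart_chart_inv[of z c] by auto
          then show ?thesis using z by (simp add: X_def snd_tchart snd_tangent_of[OF A c])
        qed
      qed
      ultimately show ?thesis
        using True c W(1) tchart_in[OF c] by blast
    next
      case False
      \<comment> \<open>The closed ball lies in \<open>W\<close>, so a point that is not seen in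
        \<open>W\<close> is off \<open>K\<close>; the complement of \<open>K\<close> is then a
        neighbourhood on which the field vanishes.\<close>
      have pK: "p \<notin> K"
      proof
        assume "p \<in> K"
        then obtain z where z: "z \<in> cball q r" "p = chart_inv c z" by (auto simp: K_def)
        then have "z \<in> W" "z \<in> snd c ` fst c" using r W by blast+
        then show False using False z chart_inv_in[of z c] chart_chart_inv[of z c] by metis
      qed
      obtain d where d: "d \<in> A" "p \<in> fst d" using p by (auto simp: points_def)
      let ?V = "snd d ` ((points A - K) \<inter> fst d)"
      have "openin (mtopology A) (points A - K)"
        using K by (simp add: closedin_def topspace_mtopology[OF smooth_atlas_imp_chart_atlas[OF A]])
      then have V: "open ?V"
        by (rule open_chart_image[OF smooth_atlas_imp_chart_atlas[OF A] d(1)])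
      have sub: "?V \<subseteq> snd d ` (fst d \<inter> points A \<inter> X -` fst (tchart A d))"
        using XT fstX by (auto simp: fst_tchart)
      have "smooth_on ?V (snd (tchart A d) \<circ> X \<circ> chart_inv d)"
      proof (rule smooth_on_cong[OF _ V])
        show "smooth_on ?V (\<lambda>z. (z, 0 :: 'a))"
          by (intro smooth_on_Pair smooth_on_id smooth_on_const V)
        show "(z, 0) = (snd (tchart A d) \<circ> X \<circ> chart_inv d) z" if "z \<in> ?V" for z
          using that XK atlas_inj[OF A d(1)] by (auto simp: snd_tchart tzero_def)
      qed
      then show ?thesis
        using d p pK V sub tchart_in[OF d(1)] by blast
    qed
  qed
  then have "vector_field A X"
    using Xin by (simp add: vector_field_on_def)
  then show ?thesis
    using that[of X \<beta>] \<beta>(2) unfolding X_def by (metis (no_types, lifting))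
qed

section \<open>Second derivatives\<close>

text \<open>Symmetry moves \<open>x\<close> into the outer derivative, where linearity is
  immediate.\<close>

lemma second_derivative_linear_left:
  fixes G :: "'a::euclidean_space \<Rightarrow> 'b::euclidean_space"
  assumes G: "smooth_on T G" and T: "open T" and z: "z \<in> T"
  shows "linear (\<lambda>x. frechet_derivative (\<lambda>y. frechet_derivative G (at y) x) (at z) w)"
  unfolding symmetric_second_derivative[OF G T z, of _ w]
  using smooth_on_linear_deriv[OF smooth_on_deriv[OF G] z] by (simp add: eta_contract_eq)

lemma fibre_hessian_sum:
  fixes G :: "'a \<times> 'a::euclidean_space \<Rightarrow> real"
  assumes G: "smooth_on T G" and T: "open T" and z: "z \<in> T"
  shows "(\<Sum>a\<in>Basis. \<Sum>b\<in>Basis. fibre_hessian G z a b * (w \<bullet> a) * (w \<bullet> b)) =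
    frechet_derivative (\<lambda>y. frechet_derivative G (at y) (0, w)) (at z) (0, w)"
proof -
  let ?B = "\<lambda>x y. frechet_derivative (\<lambda>r. frechet_derivative G (at r) (0, x)) (at z) (0, y)"
  have emb: "linear (\<lambda>x::'a. (0::'a, x))" by (rule linearI) auto
  have l1: "linear (\<lambda>x. ?B x y)" for y
    using linear_compose[OF emb second_derivative_linear_left[OF G T z]] by (simp add: o_def)
  have l2: "linear (\<lambda>y. ?B x y)" for x
    using linear_compose[OF emb smooth_on_linear_deriv[OF smooth_on_deriv[OF G] z]] by (simp add: o_def)
  have "?B w w = (\<Sum>b\<in>Basis. (w \<bullet> b) * ?B b w)"
    using linear_sum_Basis[OF l1, of w w] by simp
  also have "\<dots> = (\<Sum>b\<in>Basis. (w \<bullet> b) * (\<Sum>a\<in>Basis. (w \<bullet> a) * ?B b a))"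
    by (intro sum.cong refl) (use linear_sum_Basis[OF l2, of _ w] in simp)
  also have "\<dots> = (\<Sum>b\<in>Basis. \<Sum>a\<in>Basis. fibre_hessian G z a b * (w \<bullet> a) * (w \<bullet> b))"
    by (simp add: fibre_hessian_def sum_distrib_left ac_simps)
  also have "\<dots> = (\<Sum>a\<in>Basis. \<Sum>b\<in>Basis. fibre_hessian G z a b * (w \<bullet> a) * (w \<bullet> b))"
    by (rule sum.swap)
  finally show ?thesis by simp
qed

text \<open>Basis-free form of the matrix condition, through which Hessians on tangent spaces of
  different dimension can be compared.\<close>

lemma positive_definite_fibre_hessian_iff:
  fixes G :: "'a \<times> 'a::euclidean_space \<Rightarrow> real"
  assumes "smooth_on T G" "open T" "z \<in> T"
  shows "positive_definite (fibre_hessian G z) \<longleftrightarrow>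
    (\<forall>w. w \<noteq> 0 \<longrightarrow> frechet_derivative (\<lambda>y. frechet_derivative G (at y) (0, w)) (at z) (0, w) > 0)"
  unfolding positive_definite_def fibre_hessian_sum[OF assms] ..

section \<open>Energy and splitting in coordinates\<close>

text \<open>
  \<open>P\<close> is the projection, \<open>G\<close> the energy and \<open>H\<close> the fibre component of the splitting, all read in
  charts on \<open>D\<close>, the chart domain, and its part \<open>Q\<close> over a chart of the base.
\<close>

locale splitting_coords =
  fixes D Q :: "'a::euclidean_space set" and P :: "'a \<Rightarrow> 'b::euclidean_space"
    and G :: "'a \<times> 'a \<Rightarrow> real" and H :: "'a \<times> 'b \<Rightarrow> 'a"
  assumes D: "open D" and Q: "open Q" and QD: "Q \<subseteq> D"
    and P: "smooth_on Q P" and G: "smooth_on (D \<times> (- {0})) G" and H: "smooth_on (Q \<times> (- {0})) H"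
    and PH: "q \<in> Q \<Longrightarrow> v \<noteq> 0 \<Longrightarrow> frechet_derivative P (at q) (H (q, v)) = v"
    and crit: "q \<in> Q \<Longrightarrow> v \<noteq> 0 \<Longrightarrow> frechet_derivative P (at q) z = 0 \<Longrightarrow>
       frechet_derivative G (at (q, H (q, v))) (0, z) = 0"
    and pos: "q \<in> D \<Longrightarrow> u \<noteq> 0 \<Longrightarrow> w \<noteq> 0 \<Longrightarrow>
       frechet_derivative (\<lambda>y. frechet_derivative G (at y) (0, w)) (at (q, u)) (0, w) > 0"
begin

lemma linP: "q \<in> Q \<Longrightarrow> linear (frechet_derivative P (at q))"
  using P by (rule smooth_on_linear_deriv)

lemma linG: "q \<in> D \<Longrightarrow> u \<noteq> 0 \<Longrightarrow> linear (frechet_derivative G (at (q, u)))"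
  by (rule smooth_on_linear_deriv[OF G]) simp

lemma H_nonzero: "q \<in> Q \<Longrightarrow> v \<noteq> 0 \<Longrightarrow> H (q, v) \<noteq> 0"
  using PH linear_0[OF linP] by metis

text \<open>A critical point of a function that is convex along the segment. The segment must avoid
  zero, because smoothness and positivity of the Hessian are available only there. Two mean value
  theorems suffice: the first derivative at an inner point is a nonnegative multiple of a second
  derivative.\<close>

lemma minimum:
  assumes q: "q \<in> D" and line: "\<And>t. 0 \<le> t \<Longrightarrow> t \<le> 1 \<Longrightarrow> u + t *\<^sub>R z \<noteq> 0"
    and c: "frechet_derivative G (at (q, u)) (0, z) = 0"
  shows "G (q, u) \<le> G (q, u + z)"
proof -
  let ?D = "\<lambda>y. frechet_derivative G (at y) (0, z)"
  have d: "((\<lambda>t. F (q, u + t *\<^sub>R z)) has_real_derivative frechet_derivative F (at (q, u + t *\<^sub>R z)) (0, z)) (at t)"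
    if "smooth_on (D \<times> (- {0})) F" "0 \<le> t" "t \<le> 1" for F :: "'a \<times> 'a \<Rightarrow> real" and t
  proof -
    have in': "(q, u + t *\<^sub>R z) \<in> D \<times> (- {0})" using q line that by auto
    have "((\<lambda>t. (q, u + t *\<^sub>R z)) has_derivative (\<lambda>h. h *\<^sub>R (0, z))) (at t)"
      by (auto intro!: derivative_eq_intros)
    from has_derivative_compose[OF this smooth_on_has_derivative[OF that(1) in']]
    show ?thesis
      unfolding has_field_derivative_def
      by (rule has_derivative_eq_rhs)
        (simp add: linear_scale[OF smooth_on_linear_deriv[OF that(1) in']] fun_eq_iff del: scaleR_Pair)
  qed
  obtain s where s: "0 < s" "s < 1" "G (q, u + 1 *\<^sub>R z) - G (q, u + 0 *\<^sub>R z) = (1 - 0) * ?D (q, u + s *\<^sub>R z)"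
    using MVT2[of 0 1 "\<lambda>t. G (q, u + t *\<^sub>R z)" "\<lambda>t. ?D (q, u + t *\<^sub>R z)"] d[OF G] by auto
  obtain r where r: "0 < r" "r < s" "?D (q, u + s *\<^sub>R z) - ?D (q, u + 0 *\<^sub>R z) =
      (s - 0) * frechet_derivative ?D (at (q, u + r *\<^sub>R z)) (0, z)"
    using MVT2[of 0 s "\<lambda>t. ?D (q, u + t *\<^sub>R z)" "\<lambda>t. frechet_derivative ?D (at (q, u + t *\<^sub>R z)) (0, z)"]
      s(1,2) d[OF smooth_on_deriv[OF G]] by auto
  have "frechet_derivative ?D (at (q, u + r *\<^sub>R z)) (0, z) \<ge> 0"
  proof (cases "z = 0")
    case True
    then show ?thesis
      using linear_0[OF smooth_on_linear_deriv[OF smooth_on_deriv[OF G, of "(0, z)"], of "(q, u + r *\<^sub>R z)"]]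
        q line[of r] r s by (simp add: zero_prod_def)
  next
    case False
    then show ?thesis using pos[OF q line[of r] False] r s by simp
  qed
  then have "?D (q, u + s *\<^sub>R z) \<ge> 0" using r(3) s c by simp
  then show ?thesis using s(3) by simp
qed

text \<open>By the chain rule the wanted derivative is \<open>dG\<close> at
  \<open>(y, H' y)\<close>, while the hypothesis concerns \<open>(y, y' H)\<close>. Differentiating
  \<open>P' H = v\<close> along \<open>y\<close> and \<open>P' y = 0\<close> along \<open>H\<close>
  gives the second derivative of \<open>P\<close> at the same pair in both orders, so
  \<open>H' y - y' H\<close> lies in the kernel of \<open>P'\<close> and \<open>crit\<close> removes
  it.\<close>

lemma G_H_vertical_derivative:
  assumes q: "q \<in> Q" and v: "v \<noteq> 0" and y: "smooth_on Q y"
    and vert: "\<And>r. r \<in> Q \<Longrightarrow> frechet_derivative P (at r) (y r) = 0"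
    and cl: "frechet_derivative G (at (q, H (q, v))) (y q, frechet_derivative y (at q) (H (q, v))) = 0"
  shows "frechet_derivative (\<lambda>r. G (r, H (r, v))) (at q) (y q) = 0"
    and "(\<lambda>r. G (r, H (r, v))) differentiable (at q)"
proof -
  let ?u = "H (q, v)" and ?P = "\<lambda>r. frechet_derivative P (at r)"
  let ?Hq = "frechet_derivative (\<lambda>r. H (r, v)) (at q)"
  have u: "?u \<noteq> 0" using H_nonzero[OF q v] .
  have "smooth_on Q (\<lambda>r. H (r, v))"
    by (rule smooth_on_compose[OF H Q]) (use v in \<open>auto intro!: smooth_on_Pair smooth_on_id smooth_on_const Q\<close>)
  then have dH: "((\<lambda>r. H (r, v)) has_derivative ?Hq) (at q)"
    using q by (rule smooth_on_has_derivative)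
  have dy: "(y has_derivative frechet_derivative y (at q)) (at q)"
    by (rule smooth_on_has_derivative[OF y q])
  have inD: "(q, ?u) \<in> D \<times> (- {0})" using q u QD by auto
  have dG: "((\<lambda>r. G (r, H (r, v))) has_derivative
      (\<lambda>x. frechet_derivative G (at (q, ?u)) (x, ?Hq x))) (at q)"
    using has_derivative_compose[OF has_derivative_Pair[OF has_derivative_ident dH] smooth_on_has_derivative[OF G inD]] .
  then show "(\<lambda>r. G (r, H (r, v))) differentiable (at q)"
    unfolding differentiable_def by blast
  have "((\<lambda>r. ?P r (H (r, v))) has_derivative
      (\<lambda>x. frechet_derivative (\<lambda>r. ?P r ?u) (at q) x + ?P q (?Hq x))) (at q)"
    by (rule has_derivative_deriv_compose[OF P Q q has_derivative_ident dH])
  moreover have "((\<lambda>r. ?P r (H (r, v))) has_derivative (\<lambda>x. 0)) (at q)"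
    by (rule has_derivative_cong_open[OF has_derivative_const Q q]) (simp add: PH v)
  ultimately have 1: "frechet_derivative (\<lambda>r. ?P r ?u) (at q) x + ?P q (?Hq x) = 0" for x
    using has_derivative_unique by (metis (no_types, lifting))
  have "((\<lambda>r. ?P r (y r)) has_derivative
      (\<lambda>x. frechet_derivative (\<lambda>r. ?P r (y q)) (at q) x + ?P q (frechet_derivative y (at q) x))) (at q)"
    by (rule has_derivative_deriv_compose[OF P Q q has_derivative_ident dy])
  moreover have "((\<lambda>r. ?P r (y r)) has_derivative (\<lambda>x. 0)) (at q)"
    by (rule has_derivative_cong_open[OF has_derivative_const Q q]) (simp add: vert)
  ultimately have 2: "frechet_derivative (\<lambda>r. ?P r (y q)) (at q) x + ?P q (frechet_derivative y (at q) x) = 0" for x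
    using has_derivative_unique by (metis (no_types, lifting))
  let ?z = "?Hq (y q) - frechet_derivative y (at q) ?u"
  have "?P q ?z = 0"
    using 1[of "y q"] 2[of ?u] symmetric_second_derivative[OF P Q q, of ?u "y q"]
    by (simp add: linear_diff[OF linP[OF q]]) (metis add_left_cancel)
  then have "frechet_derivative G (at (q, ?u)) (0, ?z) = 0"
    using crit q v by simp
  moreover have "frechet_derivative G (at (q, ?u)) ((y q, frechet_derivative y (at q) ?u) + (0, ?z)) =
      frechet_derivative G (at (q, ?u)) (y q, frechet_derivative y (at q) ?u)
      + frechet_derivative G (at (q, ?u)) (0, ?z)"
    by (rule linear_add[OF linG[OF _ u]]) (use q QD in auto)
  ultimately have "frechet_derivative G (at (q, ?u)) (y q, ?Hq (y q)) = 0"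
    using cl by simp
  then show "frechet_derivative (\<lambda>r. G (r, H (r, v))) (at q) (y q) = 0"
    by (simp add: frechet_derivative_eqI[OF dG])
qed

text \<open>Constructs a curve in the horizontal manifold whose velocity is a prescribed
  second-order vector \<open>(u, f)\<close>. Its fibre velocity \<open>k\<close> agrees with
  \<open>f\<close> modulo vertical vectors by the choice of \<open>\<nu>\<close>, and the spray
  condition then forces \<open>k = f\<close>.\<close>

lemma horizontal_curve:
  assumes q: "q \<in> Q" and v: "v \<noteq> 0" and u: "u = H (q, v)"
    and spray: "\<And>z. frechet_derivative P (at q) z = 0 \<Longrightarrow> \<exists>y. smooth_on Q y \<and> y q = z \<and>
       (\<forall>r\<in>Q. frechet_derivative P (at r) (y r) = 0) \<and>
       frechet_derivative (\<lambda>w. frechet_derivative G (at w) (0, y (fst w))) (at (q, u)) (u, f) = 0"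
  obtains e \<nu> where "e > 0" "smooth_on {- e<..<e} \<nu>" "\<nu> 0 = v"
    "\<And>t. t \<in> {- e<..<e} \<Longrightarrow> q + t *\<^sub>R u \<in> Q \<and> \<nu> t \<noteq> 0"
    "((\<lambda>t. (q + t *\<^sub>R u, H (q + t *\<^sub>R u, \<nu> t))) has_derivative (\<lambda>t. t *\<^sub>R (u, f))) (at 0)"
proof -
  let ?P = "\<lambda>r. frechet_derivative P (at r)"
  \<comment> \<open>\<open>\<nu>\<close> is the projection of \<open>u + t f\<close>, so the
    horizontal lift of \<open>\<nu>\<close> and \<open>u + t f\<close> have the same projection for
    all small \<open>t\<close>. Differentiating this identity at 0 gives
    \<open>P' k = P' f\<close>.\<close>
  define \<nu> where "\<nu> t = ?P (q + t *\<^sub>R u) (u + t *\<^sub>R f)" for t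
  have un: "u \<noteq> 0" using H_nonzero[OF q v] u by simp
  have \<nu>0: "\<nu> 0 = v" using PH[OF q v] u by (simp add: \<nu>_def)
  define T where "T = {t::real. q + t *\<^sub>R u \<in> Q}"
  have line: "smooth_on S (\<lambda>t::real. a + t *\<^sub>R b)" if "open S" for S and a b :: 'a
    using that by (intro smooth_on_add smooth_on_const smooth_on_linear[OF bounded_linear_scaleR_left])
  have T: "open T" "0 \<in> T"
  proof -
    have "continuous_on UNIV (\<lambda>t::real. q + t *\<^sub>R u)" by (intro continuous_intros)
    from open_vimage[OF Q this] show "open T" by (simp add: T_def vimage_def)
  qed (simp add: T_def q)
  have s\<nu>: "smooth_on T \<nu>"
    unfolding \<nu>_def by (rule smooth_on_deriv_compose[OF P T(1) line line]) (auto simp: T_def T[unfolded T_def])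
  have "open (T \<inter> \<nu> -` (- {0}))"
    by (rule continuous_open_preimage[OF smooth_on_continuous_on[OF s\<nu>] T(1)]) (simp add: open_Compl)
  moreover have "0 \<in> T \<inter> \<nu> -` (- {0})" using T \<nu>0 v by simp
  ultimately obtain e where e: "e > 0" "ball 0 e \<subseteq> T \<inter> \<nu> -` (- {0})"
    using open_contains_ball by blast
  let ?I = "{- e<..<e}"
  have ball: "ball 0 e = ?I" by (auto simp: dist_real_def)
  have I: "open ?I" "0 \<in> ?I" using e by auto
  have inQ: "q + t *\<^sub>R u \<in> Q \<and> \<nu> t \<noteq> 0" if "t \<in> ?I" for t
    using e(2) that unfolding ball by (auto simp: T_def)
  have s\<nu>I: "smooth_on ?I \<nu>"
    by (rule smooth_on_subset[OF s\<nu>]) (use inQ in \<open>auto simp: T_def\<close>)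
  define \<alpha> where "\<alpha> t = H (q + t *\<^sub>R u, \<nu> t)" for t
  have s\<alpha>: "smooth_on ?I \<alpha>"
    unfolding \<alpha>_def by (rule smooth_on_compose[OF H I(1) smooth_on_Pair[OF I(1) line[OF I(1)] s\<nu>I]]) (use inQ in auto)
  have \<alpha>0: "\<alpha> 0 = u" by (simp add: \<alpha>_def \<nu>0 u)
  define k where "k = frechet_derivative \<alpha> (at 0) 1"
  have d\<alpha>: "(\<alpha> has_derivative (\<lambda>t. t *\<^sub>R k)) (at 0)"
  proof -
    have d: "(\<alpha> has_derivative frechet_derivative \<alpha> (at 0)) (at 0)"
      by (rule smooth_on_has_derivative[OF s\<alpha> I(2)])
    have "frechet_derivative \<alpha> (at 0) t = t *\<^sub>R k" for t
      using linear_scale[OF smooth_on_linear_deriv[OF s\<alpha> I(2)], of t 1] by (simp add: k_def)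
    then show ?thesis using has_derivative_eq_rhs[OF d] by (simp add: fun_eq_iff)
  qed
  have dl: "((\<lambda>t. q + t *\<^sub>R u) has_derivative (\<lambda>t. t *\<^sub>R u)) (at 0)"
    "((\<lambda>t. u + t *\<^sub>R f) has_derivative (\<lambda>t. t *\<^sub>R f)) (at 0)"
    by (auto intro!: derivative_eq_intros)
  have q0: "q + 0 *\<^sub>R u \<in> Q" using q by simp
  have "((\<lambda>t. ?P (q + t *\<^sub>R u) (\<alpha> t)) has_derivative
      (\<lambda>t. frechet_derivative (\<lambda>y. ?P y (\<alpha> 0)) (at (q + 0 *\<^sub>R u)) (t *\<^sub>R u) + ?P (q + 0 *\<^sub>R u) (t *\<^sub>R k))) (at 0)"
    by (rule has_derivative_deriv_compose[OF P Q q0 dl(1) d\<alpha>])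
  then have 1: "((\<lambda>t. ?P (q + t *\<^sub>R u) (u + t *\<^sub>R f)) has_derivative
      (\<lambda>t. frechet_derivative (\<lambda>y. ?P y (\<alpha> 0)) (at (q + 0 *\<^sub>R u)) (t *\<^sub>R u) + ?P (q + 0 *\<^sub>R u) (t *\<^sub>R k))) (at 0)"
    by (rule has_derivative_cong_open[OF _ I]) (use inQ PH in \<open>auto simp: \<alpha>_def \<nu>_def\<close>)
  have 2: "((\<lambda>t. ?P (q + t *\<^sub>R u) (u + t *\<^sub>R f)) has_derivative
      (\<lambda>t. frechet_derivative (\<lambda>y. ?P y (u + 0 *\<^sub>R f)) (at (q + 0 *\<^sub>R u)) (t *\<^sub>R u) + ?P (q + 0 *\<^sub>R u) (t *\<^sub>R f))) (at 0)"
    by (rule has_derivative_deriv_compose[OF P Q q0 dl])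
  have "?P q k = ?P q f"
    using fun_cong[OF has_derivative_unique[OF 1 2], of 1] by (simp add: \<alpha>0)
  then have z: "?P q (k - f) = 0" by (simp add: linear_diff[OF linP[OF q]])
  \<comment> \<open>The test field extends the very vector that is to be shown zero.\<close>
  obtain y where y: "smooth_on Q y" "y q = k - f" "\<forall>r\<in>Q. ?P r (y r) = 0"
    and sy: "frechet_derivative (\<lambda>w. frechet_derivative G (at w) (0, y (fst w))) (at (q, u)) (u, f) = 0"
    using spray[OF z] by blast
  let ?W = "\<lambda>w. frechet_derivative G (at w) (0, y (fst w))"
  have QG: "smooth_on (Q \<times> (- {0})) G" by (rule smooth_on_subset[OF G]) (use QD in auto)
  have oQ: "open (Q \<times> (- {0 :: 'a}))" by (intro open_Times Q) (simp add: open_Compl)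
  have "smooth_on (Q \<times> (- {0})) (\<lambda>w::'a \<times> 'a. (0::'a, y (fst w)))"
    by (rule smooth_on_Pair[OF oQ smooth_on_const])
      (rule smooth_on_compose[OF y(1) oQ smooth_on_linear[OF bounded_linear_fst oQ]], auto)
  then have sW: "smooth_on (Q \<times> (- {0})) ?W"
    by (rule smooth_on_deriv_compose[OF QG oQ smooth_on_id[OF oQ]])
  have inW: "(q, u) \<in> Q \<times> (- {0})" using q un by auto
  have dW: "(?W has_derivative frechet_derivative ?W (at (q, u))) (at (q, u))"
    by (rule smooth_on_has_derivative[OF sW inW])
  have dW': "(?W has_derivative (\<lambda>s. frechet_derivative (\<lambda>x. frechet_derivative G (at x) (0, k - f)) (at (q, u)) s
      + frechet_derivative G (at (q, u)) (0, frechet_derivative y (at q) (fst s)))) (at (q, u))"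
  proof -
    have "((\<lambda>w::'a \<times> 'a. y (fst w)) has_derivative (\<lambda>s. frechet_derivative y (at q) (fst s))) (at (q, u))"
      by (rule has_derivative_compose[OF bounded_linear_imp_has_derivative[OF bounded_linear_fst]])
        (simp add: smooth_on_has_derivative[OF y(1) q])
    then have "((\<lambda>w::'a \<times> 'a. (0::'a, y (fst w))) has_derivative (\<lambda>s. (0, frechet_derivative y (at q) (fst s)))) (at (q, u))"
      by (rule has_derivative_Pair[OF has_derivative_const])
    from has_derivative_deriv_compose[OF QG oQ inW has_derivative_ident this]
    show ?thesis by (simp add: y(2))
  qed
  have "((\<lambda>t. ?W (q + t *\<^sub>R u, \<alpha> t)) has_derivative (\<lambda>t. frechet_derivative ?W (at (q, u)) (t *\<^sub>R u, t *\<^sub>R k))) (at 0)"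
    by (rule has_derivative_compose[OF has_derivative_Pair[OF dl(1) d\<alpha>]]) (use dW \<alpha>0 in simp)
  moreover have "((\<lambda>t. ?W (q + t *\<^sub>R u, \<alpha> t)) has_derivative (\<lambda>t. 0)) (at 0)"
    by (rule has_derivative_cong_open[OF has_derivative_const I])
      (use inQ crit y(3) in \<open>auto simp: \<alpha>_def\<close>)
  ultimately have "frechet_derivative ?W (at (q, u)) (1 *\<^sub>R u, 1 *\<^sub>R k) = 0"
    using has_derivative_unique by (metis (no_types, lifting))
  then have a: "frechet_derivative ?W (at (q, u)) (u, k) = 0" by simp
  \<comment> \<open>\<open>?W\<close> vanishes along the horizontal curve, with velocity
    \<open>(u, k)\<close>, and in the direction \<open>(u, f)\<close> by hypothesis. In the
    difference the base components cancel, so the term that differentiates \<open>y\<close> drops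
    out and only the fibre Hessian in the direction \<open>k - f\<close> is left.\<close>
  have "frechet_derivative ?W (at (q, u)) ((u, k) - (u, f)) = 0"
    using a sy linear_diff[OF smooth_on_linear_deriv[OF sW inW], of "(u, k)" "(u, f)"] by simp
  then have "frechet_derivative (\<lambda>x. frechet_derivative G (at x) (0, k - f)) (at (q, u)) (0, k - f)
      + frechet_derivative G (at (q, u)) (0, frechet_derivative y (at q) 0) = 0"
    unfolding frechet_derivative_eqI[OF dW'] by simp
  moreover have "frechet_derivative G (at (q, u)) (0, frechet_derivative y (at q) 0) = 0"
    using linear_0[OF smooth_on_linear_deriv[OF y(1) q]] linear_0[OF linG[OF _ un, of q]] q QD
    by (auto simp: zero_prod_def)
  ultimately have "frechet_derivative (\<lambda>x. frechet_derivative G (at x) (0, k - f)) (at (q, u)) (0, k - f) = 0"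
    by simp
  then have "k - f = 0" using pos[of q u "k - f"] q QD un by (metis less_irrefl subsetD)
  then have kf: "k = f" by simp
  have "((\<lambda>t. (q + t *\<^sub>R u, H (q + t *\<^sub>R u, \<nu> t))) has_derivative (\<lambda>t. t *\<^sub>R (u, f))) (at 0)"
    using has_derivative_Pair[OF dl(1) d\<alpha>] by (simp add: kf \<alpha>_def)
  then show ?thesis
    using that[of e \<nu>] e(1) s\<nu>I \<nu>0 inQ by blast
qed

text \<open>The splitting is a right inverse of \<open>P'\<close> on nonzero vectors, so its fibre
  derivative \<open>\<xi>\<close> at \<open>v\<close> satisfies \<open>P' \<xi> = id\<close>. Hence
  \<open>\<xi>\<close> is injective and positivity passes from \<open>G\<close> to
  \<open>G2\<close>.\<close>

lemma fibre_hessian_pushforward: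
  fixes G2 :: "'b \<times> 'b \<Rightarrow> real"
  assumes q: "q \<in> Q" and v: "v \<noteq> 0"
    and N: "open N" "P q \<in> N" and G2: "smooth_on (N \<times> (- {0})) G2"
    and eq: "\<And>w. w \<noteq> 0 \<Longrightarrow> G2 (P q, w) = G (q, H (q, w))"
  shows "positive_definite (fibre_hessian G2 (P q, v))"
proof -
  let ?n = "P q" and ?O = "- {0 :: 'b}"
  define \<xi> where "\<xi> = frechet_derivative (\<lambda>w. H (q, w)) (at v)"
  have O: "open ?O" by (simp add: open_Compl)
  have oN: "open (N \<times> ?O)" by (intro open_Times N O)
  have dP: "((\<lambda>w. (x, w)) has_derivative (\<lambda>a. (0, a))) (at w)" for x w :: 'b
    by (auto intro!: derivative_eq_intros)
  have "smooth_on ?O (\<lambda>w. H (q, w))"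
    by (rule smooth_on_compose[OF H O smooth_on_Pair[OF O smooth_on_const smooth_on_id[OF O]]]) (use q in auto)
  then have dH: "((\<lambda>w. H (q, w)) has_derivative frechet_derivative (\<lambda>w. H (q, w)) (at w)) (at w)" if "w \<noteq> 0" for w
    by (rule smooth_on_has_derivative) (use that in auto)
  have PdH: "frechet_derivative P (at q) (frechet_derivative (\<lambda>w. H (q, w)) (at w) b) = b" if "w \<noteq> 0" for w b
  proof -
    have bl: "bounded_linear (frechet_derivative P (at q))"
      using has_derivative_bounded_linear[OF smooth_on_has_derivative[OF P q]] .
    have "((\<lambda>w. frechet_derivative P (at q) (H (q, w))) has_derivative
        (\<lambda>b. frechet_derivative P (at q) (frechet_derivative (\<lambda>w. H (q, w)) (at w) b))) (at w)"
      by (rule bounded_linear.has_derivative[OF bl dH[OF that]])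
    moreover have "((\<lambda>w. frechet_derivative P (at q) (H (q, w))) has_derivative (\<lambda>b. b)) (at w)"
      by (rule has_derivative_cong_open[OF has_derivative_ident O]) (use that PH q in auto)
    ultimately show ?thesis using has_derivative_unique by metis
  qed
  \<comment> \<open>\<open>\<xi>\<close> is the fibre derivative at \<open>v\<close>, yet the
    formula holds at every nonzero \<open>w\<close>: the fibre derivatives of \<open>H\<close> at
    \<open>w\<close> and at \<open>v\<close> differ by a vertical vector, which \<open>crit\<close>
    annihilates. With \<open>\<xi>\<close> frozen, the next differentiation does not produce a
    second derivative of \<open>H\<close>.\<close>
  have first: "frechet_derivative G2 (at (?n, w)) (0, b) = frechet_derivative G (at (q, H (q, w))) (0, \<xi> b)"
    if w: "w \<noteq> 0" for w b
  proof -
    let ?dH = "frechet_derivative (\<lambda>w. H (q, w)) (at w)"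
    have inD: "(q, H (q, w)) \<in> D \<times> (- {0})" using q QD H_nonzero[OF q w] by auto
    have "((\<lambda>w. G2 (?n, w)) has_derivative (\<lambda>b. frechet_derivative G2 (at (?n, w)) (0, b))) (at w)"
      by (rule has_derivative_compose[OF dP smooth_on_has_derivative[OF G2]]) (use N w in auto)
    moreover have "((\<lambda>w. G2 (?n, w)) has_derivative (\<lambda>b. frechet_derivative G (at (q, H (q, w))) (0, ?dH b))) (at w)"
      by (rule has_derivative_cong_open[OF has_derivative_compose[OF
            has_derivative_Pair[OF has_derivative_const dH[OF w]] smooth_on_has_derivative[OF G inD]] O])
        (use w eq in auto)
    ultimately have "frechet_derivative G2 (at (?n, w)) (0, b) = frechet_derivative G (at (q, H (q, w))) (0, ?dH b)"
      using has_derivative_unique by metis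
    moreover have "frechet_derivative G (at (q, H (q, w))) (0, ?dH b - \<xi> b) = 0"
      by (rule crit[OF q w]) (simp add: linear_diff[OF linP[OF q]] PdH[OF w] PdH[OF v] \<xi>_def)
    moreover have "frechet_derivative G (at (q, H (q, w))) ((0, \<xi> b) + (0, ?dH b - \<xi> b)) =
        frechet_derivative G (at (q, H (q, w))) (0, \<xi> b) + frechet_derivative G (at (q, H (q, w))) (0, ?dH b - \<xi> b)"
      by (rule linear_add[OF smooth_on_linear_deriv[OF G inD]])
    ultimately show ?thesis by simp
  qed
  have inD: "(q, H (q, v)) \<in> D \<times> (- {0})" using q QD H_nonzero[OF q v] by auto
  have second: "frechet_derivative (\<lambda>y. frechet_derivative G2 (at y) (0, b)) (at (?n, v)) (0, a) =
    frechet_derivative (\<lambda>y. frechet_derivative G (at y) (0, \<xi> b)) (at (q, H (q, v))) (0, \<xi> a)" for a b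
  proof -
    have "((\<lambda>w. frechet_derivative G2 (at (?n, w)) (0, b)) has_derivative
       (\<lambda>a. frechet_derivative (\<lambda>y. frechet_derivative G2 (at y) (0, b)) (at (?n, v)) (0, a))) (at v)"
      by (rule has_derivative_compose[OF dP smooth_on_has_derivative[OF smooth_on_deriv[OF G2]]]) (use N v in auto)
    moreover have "((\<lambda>w. frechet_derivative G2 (at (?n, w)) (0, b)) has_derivative
       (\<lambda>a. frechet_derivative (\<lambda>y. frechet_derivative G (at y) (0, \<xi> b)) (at (q, H (q, v))) (0, \<xi> a))) (at v)"
      unfolding \<xi>_def
      by (rule has_derivative_cong_open[OF has_derivative_compose[OF has_derivative_Pair[OF has_derivative_const dH[OF v]]
         smooth_on_has_derivative[OF smooth_on_deriv[OF G] inD]] O])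
        (use v first in \<open>auto simp: \<xi>_def\<close>)
    ultimately show ?thesis using has_derivative_unique by metis
  qed
  have z: "(?n, v) \<in> N \<times> ?O" using N v by auto
  show ?thesis
    unfolding positive_definite_fibre_hessian_iff[OF G2 oN z]
  proof (intro allI impI)
    fix w :: 'b assume "w \<noteq> 0"
    then have "\<xi> w \<noteq> 0"
      using PdH[OF v, of w] linear_0[OF linP[OF q]] by (metis \<xi>_def)
    then show "frechet_derivative (\<lambda>y. frechet_derivative G2 (at y) (0, w)) (at (?n, v)) (0, w) > 0"
      unfolding second using pos inD by auto
  qed
qed

end

section \<open>Local trivialisations\<close>

text \<open>
  The model space of the fibre is only a normed space, while composition of smooth maps is available
  through Euclidean spaces; conjugation with the derivatives \<open>A\<close>, \<open>B\<close> of \<open>\<Phi>\<close>, \<open>\<Psi>\<close> at one point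
  replaces the product model space by \<open>'a\<close>.
\<close>

lemma local_vertical_field:
  fixes \<Phi> :: "'a::euclidean_space \<Rightarrow> 'b::euclidean_space \<times> 'k::real_normed_vector"
  assumes U: "open U" and V: "open V" and \<Phi>: "smooth_on U \<Phi>" and \<Psi>: "smooth_on V \<Psi>"
    and \<Phi>U: "\<And>x. x \<in> U \<Longrightarrow> \<Phi> x \<in> V" and \<Psi>V: "\<And>z. z \<in> V \<Longrightarrow> \<Psi> z \<in> U"
    and \<Psi>\<Phi>: "\<And>x. x \<in> U \<Longrightarrow> \<Psi> (\<Phi> x) = x" and \<Phi>\<Psi>: "\<And>z. z \<in> V \<Longrightarrow> \<Phi> (\<Psi> z) = z"
    and P: "\<And>x. x \<in> U \<Longrightarrow> P x = fst (\<Phi> x)"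
    and q: "q \<in> U" and w: "frechet_derivative P (at q) w = 0"
  obtains y where "smooth_on U y" "y q = w" "\<And>x. x \<in> U \<Longrightarrow> frechet_derivative P (at x) (y x) = 0"
proof -
  define A where "A = frechet_derivative \<Phi> (at q)"
  define B where "B = frechet_derivative \<Psi> (at (\<Phi> q))"
  have dA: "(\<Phi> has_derivative A) (at q)"
    unfolding A_def by (rule smooth_on_has_derivative[OF \<Phi> q])
  have dB: "(\<Psi> has_derivative B) (at (\<Phi> q))"
    unfolding B_def by (rule smooth_on_has_derivative[OF \<Psi> \<Phi>U[OF q]])
  have blA: "bounded_linear A" and blB: "bounded_linear B"
    using dA dB by (auto intro: has_derivative_bounded_linear)
  have BA: "B (A x) = x" for x
  proof -
    have "((\<lambda>x. \<Psi> (\<Phi> x)) has_derivative (\<lambda>x. B (A x))) (at q)"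
      by (rule has_derivative_compose[OF dA dB])
    moreover have "((\<lambda>x. \<Psi> (\<Phi> x)) has_derivative (\<lambda>x. x)) (at q)"
      by (rule has_derivative_cong_open[OF has_derivative_ident U q]) (simp add: \<Psi>\<Phi>)
    ultimately show ?thesis using has_derivative_unique by metis
  qed
  have AB: "A (B z) = z" for z
  proof -
    have "((\<lambda>x. \<Phi> (\<Psi> x)) has_derivative (\<lambda>x. A (B x))) (at (\<Phi> q))"
      by (rule has_derivative_compose[OF dB]) (simp add: \<Psi>\<Phi>[OF q] dA)
    moreover have "((\<lambda>x. \<Phi> (\<Psi> x)) has_derivative (\<lambda>x. x)) (at (\<Phi> q))"
      by (rule has_derivative_cong_open[OF has_derivative_ident V \<Phi>U[OF q]]) (simp add: \<Phi>\<Psi>)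
    ultimately show ?thesis using has_derivative_unique by metis
  qed
  have dP: "(P has_derivative (\<lambda>x. fst (frechet_derivative \<Phi> (at r) x))) (at r)" if "r \<in> U" for r
    by (rule has_derivative_cong_open[OF has_derivative_fst[OF smooth_on_has_derivative[OF \<Phi> that]] U that])
      (simp add: P)
  define \<Psi>' where "\<Psi>' x = \<Psi> (A x)" for x
  define \<Phi>' where "\<Phi>' x = B (\<Phi> x)" for x
  define V' where "V' = A -` V"
  have V': "open V'"
    unfolding V'_def using blA by (intro open_vimage V) (simp add: linear_continuous_on)
  have s\<Psi>: "smooth_on V' \<Psi>'"
    unfolding \<Psi>'_def using smooth_on_affine_precomp[OF \<Psi> blA V', of 0] by (simp add: V'_def)
  have s\<Phi>: "smooth_on U \<Phi>'"
    unfolding \<Phi>'_def by (rule smooth_on_linear_comp[OF blB U \<Phi>])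
  have \<Phi>V': "\<Phi>' x \<in> V'" if "x \<in> U" for x
    using \<Phi>U[OF that] by (simp add: \<Phi>'_def V'_def AB)
  \<comment> \<open>In the linearly adjusted trivialisation the field is constant with value
    \<open>w\<close>, and \<open>\<Psi>'\<close> carries it back. There the projection is the linear
    map \<open>fst \<circ> A\<close>, so a constant field that is vertical at one point is vertical
    everywhere.\<close>
  define y where "y x = frechet_derivative \<Psi>' (at (\<Phi>' x)) w" for x
  have "smooth_on U y"
    unfolding y_def by (rule smooth_on_deriv_compose[OF s\<Psi> U s\<Phi> smooth_on_const \<Phi>V'])
  moreover have "y q = w"
  proof -
    have "(\<Psi>' has_derivative (\<lambda>x. B (A x))) (at (\<Phi>' q))"
      unfolding \<Psi>'_def
      by (rule has_derivative_compose[OF bounded_linear_imp_has_derivative[OF blA]]) (simp add: \<Phi>'_def AB dB)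
    then show ?thesis by (simp add: y_def frechet_derivative_eqI BA)
  qed
  moreover have "frechet_derivative P (at x) (y x) = 0" if x: "x \<in> U" for x
  proof -
    have \<Psi>x: "\<Psi>' (\<Phi>' x) = x" by (simp add: \<Psi>'_def \<Phi>'_def AB \<Psi>\<Phi>[OF x])
    have "(P has_derivative frechet_derivative P (at x)) (at (\<Psi>' (\<Phi>' x)))"
      unfolding \<Psi>x using dP[OF x] frechet_derivative_eqI by metis
    from has_derivative_compose[OF smooth_on_has_derivative[OF s\<Psi> \<Phi>V'[OF x]] this]
    have "((\<lambda>r. P (\<Psi>' r)) has_derivative (\<lambda>r. frechet_derivative P (at x) (frechet_derivative \<Psi>' (at (\<Phi>' x)) r))) (at (\<Phi>' x))" .
    moreover have "((\<lambda>r. P (\<Psi>' r)) has_derivative (\<lambda>r. fst (A r))) (at (\<Phi>' x))"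
    proof (rule has_derivative_cong_open[OF has_derivative_fst[OF bounded_linear_imp_has_derivative[OF blA]] V' \<Phi>V'[OF x]])
      show "fst (A r) = P (\<Psi>' r)" if "r \<in> V'" for r
        using that P[OF \<Psi>V] \<Phi>\<Psi> by (simp add: \<Psi>'_def V'_def)
    qed
    ultimately have "frechet_derivative P (at x) (y x) = fst (A w)"
      using has_derivative_unique unfolding y_def by metis
    also have "\<dots> = 0"
      using w frechet_derivative_eqI[OF dP[OF q]] by (simp add: A_def)
    finally show ?thesis .
  qed
  ultimately show ?thesis using that by blast
qed

section \<open>Fibre bundles in charts\<close>

lemma chart_atlas_prod_atlas:
  assumes A: "chart_atlas A" and B: "chart_atlas B"
  shows "chart_atlas (prod_atlas A B)"
  unfolding chart_atlas_def
proof (intro conjI ballI)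
  fix C assume "C \<in> prod_atlas A B"
  then obtain c d where C: "C = (fst c \<times> fst d, map_prod (snd c) (snd d))" and cd: "c \<in> A" "d \<in> B"
    by (auto simp: prod_atlas_def)
  show "inj_on (snd C) (fst C)"
    using map_prod_inj_on[OF chart_atlas_inj[OF A cd(1)] chart_atlas_inj[OF B cd(2)]] C by simp
  fix D assume "D \<in> prod_atlas A B"
  then obtain c' d' where D: "D = (fst c' \<times> fst d', map_prod (snd c') (snd d'))" and cd': "c' \<in> A" "d' \<in> B"
    by (auto simp: prod_atlas_def)
  have "snd C ` (fst C \<inter> fst D) = snd c ` (fst c \<inter> fst c') \<times> snd d ` (fst d \<inter> fst d')"
    unfolding C D by (simp add: Times_Int_Times map_prod_surj_on)
  then show "open (snd C ` (fst C \<inter> fst D))"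
    using A B cd cd' unfolding chart_atlas_def by (metis open_Times)
qed

locale fibre_bundle =
  fixes AM :: "('m, 'a::euclidean_space) chart set" and AN :: "('n, 'b::euclidean_space) chart set"
    and AF :: "('f, 'k::real_normed_vector) chart set" and \<pi> :: "'m \<Rightarrow> 'n"
  assumes fibred: "smooth_fibre_bundle AM AN AF \<pi>"
begin

lemma AM: "smooth_atlas AM" and AN: "smooth_atlas AN" and AF: "smooth_atlas AF"
  and HM: "Hausdorff_space (mtopology AM)" and \<pi>_smooth: "smooth_map_on AM (points AM) AN \<pi>"
  and \<pi>_surj: "\<pi> ` points AM = points AN"
  using fibred unfolding smooth_fibre_bundle_def smooth_manifold_def by blast+

lemmas cM = smooth_atlas_imp_chart_atlas[OF AM]
  and cN = smooth_atlas_imp_chart_atlas[OF AN]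
  and cF = smooth_atlas_imp_chart_atlas[OF AF]

definition Pc :: "('m, 'a) chart \<Rightarrow> ('n, 'b) chart \<Rightarrow> 'a \<Rightarrow> 'b" where
  "Pc c d = snd d \<circ> \<pi> \<circ> chart_inv c"

definition Qc :: "('m, 'a) chart \<Rightarrow> ('n, 'b) chart \<Rightarrow> 'a set" where
  "Qc c d = snd c ` (fst c \<inter> points AM \<inter> \<pi> -` fst d)"

lemma chart_point: "c \<in> AM \<Longrightarrow> m \<in> fst c \<Longrightarrow> m \<in> points AM"
  by (auto simp: points_def)

lemma Qc_iff:
  assumes "c \<in> AM"
  shows "q \<in> Qc c d \<longleftrightarrow> q \<in> snd c ` fst c \<and> \<pi> (chart_inv c q) \<in> fst d"
  using atlas_inj[OF AM assms] chart_point[OF assms] unfolding Qc_def by auto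

lemma Qc_chart:
  "c \<in> AM \<Longrightarrow> m \<in> fst c \<Longrightarrow> \<pi> m \<in> fst d \<Longrightarrow> snd c m \<in> Qc c d"
  by (simp add: Qc_iff atlas_inj[OF AM])

lemma Pc_chart: "c \<in> AM \<Longrightarrow> m \<in> fst c \<Longrightarrow> Pc c d (snd c m) = snd d (\<pi> m)"
  by (simp add: Pc_def atlas_inj[OF AM])

lemma open_Qc: "c \<in> AM \<Longrightarrow> d \<in> AN \<Longrightarrow> open (Qc c d)"
  unfolding Qc_def by (rule smooth_map_on_openD[OF \<pi>_smooth cM cN])

lemma smooth_Pc: "c \<in> AM \<Longrightarrow> d \<in> AN \<Longrightarrow> smooth_on (Qc c d) (Pc c d)"
  unfolding Qc_def Pc_def by (rule smooth_map_onD[OF \<pi>_smooth])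

lemma linear_Pc: "c \<in> AM \<Longrightarrow> d \<in> AN \<Longrightarrow> q \<in> Qc c d \<Longrightarrow> linear (frechet_derivative (Pc c d) (at q))"
  by (rule smooth_on_linear_deriv[OF smooth_Pc])

lemma tangent_map_\<pi>:
  assumes v: "v \<in> tangent_space AM m" and c: "c \<in> AM" "m \<in> fst c" and d: "d \<in> AN" "\<pi> m \<in> fst d"
  shows "tangent_map AM AN \<pi> v = tangent_of AN d (\<pi> m) (frechet_derivative (Pc c d) (at (snd c m)) (snd v c))"
  unfolding Pc_def using tangent_map_eq[OF AM AN \<pi>_smooth chart_point[OF c] v c d] .

lemma tangent_map_\<pi>_eq_iff:
  assumes v: "v \<in> tangent_space AM m" and c: "c \<in> AM" "m \<in> fst c" and d: "d \<in> AN" "\<pi> m \<in> fst d"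
    and w: "w \<in> tangent_space AN (\<pi> m)"
  shows "tangent_map AM AN \<pi> v = w \<longleftrightarrow> frechet_derivative (Pc c d) (at (snd c m)) (snd v c) = snd w d"
  unfolding tangent_map_\<pi>[OF v c d]
  using snd_tangent_of[OF AN d] tangent_of_snd[OF AN w d] by metis

lemma tzero_in: "c \<in> AM \<Longrightarrow> m \<in> fst c \<Longrightarrow> tzero m \<in> tangent_space AM m"
  using tangent_of_in[OF AM, of c m 0] tangent_of_0[OF AM] by simp

lemma tzero_inN: "d \<in> AN \<Longrightarrow> n \<in> fst d \<Longrightarrow> tzero n \<in> tangent_space AN n"
  using tangent_of_in[OF AN, of d n 0] tangent_of_0[OF AN] by simp

lemma tangent_map_\<pi>_vertical_iff:
  assumes v: "v \<in> tangent_space AM m" and c: "c \<in> AM" "m \<in> fst c" and d: "d \<in> AN" "\<pi> m \<in> fst d"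
  shows "tangent_map AM AN \<pi> v = tzero (\<pi> m) \<longleftrightarrow> frechet_derivative (Pc c d) (at (snd c m)) (snd v c) = 0"
  using tangent_map_\<pi>_eq_iff[OF v c d tzero_inN[OF d]] by (simp add: tzero_def)

lemma components_vertical:
  assumes Y: "vector_field AM Y" "proj_vertical AM AN \<pi> Y" and c: "c \<in> AM" and d: "d \<in> AN" and q: "q \<in> Qc c d"
  shows "frechet_derivative (Pc c d) (at q) (components c Y q) = 0"
proof -
  obtain m where m: "m \<in> fst c" "\<pi> m \<in> fst d" "q = snd c m" using q by (auto simp: Qc_def)
  have "Y m \<in> tangent_space AM m" "tangent_map AM AN \<pi> (Y m) = tzero (\<pi> m)"
    using Y chart_point[OF c m(1)] by (auto simp: vector_field_on_def proj_vertical_def)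
  then show ?thesis
    using tangent_map_\<pi>_vertical_iff[OF _ c m(1) d m(2)] by (simp add: m components_chart atlas_inj[OF AM c])
qed

section \<open>A bundle trivialisation read in product charts\<close>

context
  fixes U0 :: "'n set" and \<Phi> :: "'m \<Rightarrow> 'n \<times> 'f"
  assumes U0: "openin (mtopology AN) U0"
    and diffeo: "diffeo_on AM (points AM \<inter> \<pi> -` U0) (prod_atlas AN AF) (U0 \<times> points AF) \<Phi>"
    and fst\<Phi>: "\<forall>m \<in> points AM \<inter> \<pi> -` U0. fst (\<Phi> m) = \<pi> m"
begin

definition \<Phi>inv where "\<Phi>inv = inv_into (points AM \<inter> \<pi> -` U0) \<Phi>"

lemma \<Phi>inv_\<Phi>: "m \<in> points AM \<Longrightarrow> \<pi> m \<in> U0 \<Longrightarrow> \<Phi>inv (\<Phi> m) = m"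
  using diffeo bij_betw_inv_into_left unfolding \<Phi>inv_def diffeo_on_def by fastforce

lemma \<Phi>_in: "m \<in> points AM \<Longrightarrow> \<pi> m \<in> U0 \<Longrightarrow> \<Phi> m \<in> U0 \<times> points AF"
  using diffeo bij_betwE unfolding diffeo_on_def by fastforce

lemma \<Phi>_\<Phi>inv: "z \<in> U0 \<times> points AF \<Longrightarrow> \<Phi> (\<Phi>inv z) = z"
  using diffeo bij_betw_inv_into_right unfolding \<Phi>inv_def diffeo_on_def by fastforce

lemma \<Phi>inv_in: "z \<in> U0 \<times> points AF \<Longrightarrow> \<Phi>inv z \<in> points AM \<and> \<pi> (\<Phi>inv z) \<in> U0"
  using diffeo bij_betwE[OF bij_betw_inv_into] unfolding \<Phi>inv_def diffeo_on_def by fastforce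

lemma \<pi>_\<Phi>inv: "z \<in> U0 \<times> points AF \<Longrightarrow> \<pi> (\<Phi>inv z) = fst z"
  using fst\<Phi> \<Phi>inv_in \<Phi>_\<Phi>inv by (metis IntI vimageI)

context
  fixes c d e
  assumes c: "c \<in> AM" and d: "d \<in> AN" and e: "e \<in> AF"
begin

text \<open>Domains and maps are written exactly as they occur in \<open>smooth_map_on\<close> for
  the trivialisation and for its inverse, so that openness and smoothness come straight from
  \<open>diffeo_on\<close>.\<close>

definition triv_dom where
  "triv_dom = snd c ` (fst c \<inter> (points AM \<inter> \<pi> -` U0) \<inter> \<Phi> -` (fst d \<times> fst e))"

definition triv_ran where
  "triv_ran = map_prod (snd d) (snd e) ` ((fst d \<times> fst e) \<inter> (U0 \<times> points AF) \<inter> \<Phi>inv -` fst c)"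

definition triv where
  "triv = map_prod (snd d) (snd e) \<circ> \<Phi> \<circ> chart_inv c"

definition triv_inv where
  "triv_inv = snd c \<circ> \<Phi>inv \<circ> chart_inv (fst d \<times> fst e, map_prod (snd d) (snd e))"

lemma triv_chart_inv:
  assumes "n \<in> fst d" "f \<in> fst e"
  shows "triv_inv (snd d n, snd e f) = snd c (\<Phi>inv (n, f))"
proof -
  have "inj_on (map_prod (snd d) (snd e)) (fst d \<times> fst e)"
    by (rule map_prod_inj_on[OF atlas_inj[OF AN d] atlas_inj[OF AF e]])
  from inv_into_f_f[OF this, of "(n, f)"] show ?thesis
    using assms by (simp add: triv_inv_def)
qed

lemma triv_ran_iff:
  assumes "n \<in> fst d" "f \<in> fst e"
  shows "(snd d n, snd e f) \<in> triv_ran \<longleftrightarrow> n \<in> U0 \<and> \<Phi>inv (n, f) \<in> fst c"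
proof
  assume "(snd d n, snd e f) \<in> triv_ran"
  then obtain n' f' where *: "n' \<in> fst d" "f' \<in> fst e" "n' \<in> U0" "\<Phi>inv (n', f') \<in> fst c"
    "snd d n = snd d n'" "snd e f = snd e f'" by (auto simp: triv_ran_def)
  then have "n' = n" "f' = f"
    using assms atlas_inj[OF AN d] atlas_inj[OF AF e] by (metis inj_onD)+
  then show "n \<in> U0 \<and> \<Phi>inv (n, f) \<in> fst c" using * by simp
next
  assume "n \<in> U0 \<and> \<Phi>inv (n, f) \<in> fst c"
  then show "(snd d n, snd e f) \<in> triv_ran"
    unfolding triv_ran_def using assms e by (intro image_eqI[of _ _ "(n, f)"]) (auto simp: points_def)
qed

lemma triv_ranE:
  assumes "z \<in> triv_ran"
  obtains n f where "n \<in> fst d" "f \<in> fst e" "n \<in> U0" "\<Phi>inv (n, f) \<in> fst c" "z = (snd d n, snd e f)"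
    "triv_inv z = snd c (\<Phi>inv (n, f))" "(n, f) \<in> U0 \<times> points AF"
  using assms triv_chart_inv unfolding triv_ran_def by auto

lemma triv_domE:
  assumes "x \<in> triv_dom"
  obtains m where "m \<in> fst c" "m \<in> points AM" "\<pi> m \<in> U0" "\<pi> m \<in> fst d" "snd (\<Phi> m) \<in> fst e"
    "\<Phi> m = (\<pi> m, snd (\<Phi> m))" "x = snd c m" "triv x = (snd d (\<pi> m), snd e (snd (\<Phi> m)))"
proof -
  obtain m where m: "m \<in> fst c" "m \<in> points AM" "\<pi> m \<in> U0" "\<Phi> m \<in> fst d \<times> fst e" "x = snd c m"
    using assms by (auto simp: triv_dom_def)
  then have "fst (\<Phi> m) = \<pi> m" using fst\<Phi> by auto
  then have "\<Phi> m = (\<pi> m, snd (\<Phi> m))" by (metis prod.collapse)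
  moreover have "triv x = map_prod (snd d) (snd e) (\<Phi> m)"
    using m atlas_inj[OF AM c] by (simp add: triv_def)
  ultimately show ?thesis using that m by (metis map_prod_simp mem_Sigma_iff)
qed

lemma triv_props:
  shows "open triv_dom" "open triv_ran" "smooth_on triv_dom triv" "smooth_on triv_ran triv_inv"
    "x \<in> triv_dom \<Longrightarrow> triv x \<in> triv_ran" "z \<in> triv_ran \<Longrightarrow> triv_inv z \<in> triv_dom"
    "x \<in> triv_dom \<Longrightarrow> triv_inv (triv x) = x" "z \<in> triv_ran \<Longrightarrow> triv (triv_inv z) = z"
    "x \<in> triv_dom \<Longrightarrow> Pc c d x = fst (triv x)" "triv_dom \<subseteq> Qc c d"
proof -
  let ?de = "(fst d \<times> fst e, map_prod (snd d) (snd e))"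
  have de: "?de \<in> prod_atlas AN AF" using d e unfolding prod_atlas_def by blast
  note cNF = chart_atlas_prod_atlas[OF cN cF]
  have s1: "smooth_map_on AM (points AM \<inter> \<pi> -` U0) (prod_atlas AN AF) \<Phi>"
    and s2: "smooth_map_on (prod_atlas AN AF) (U0 \<times> points AF) AM \<Phi>inv"
    using diffeo unfolding diffeo_on_def \<Phi>inv_def by blast+
  show "open triv_dom"
    using smooth_map_on_openD[OF s1 cM cNF c de] by (simp add: triv_dom_def)
  show "open triv_ran"
    using smooth_map_on_openD[OF s2 cNF cM de c] by (simp add: triv_ran_def)
  show "smooth_on triv_dom triv"
    using smooth_map_onD[OF s1 c de] by (simp add: triv_dom_def triv_def)
  show "smooth_on triv_ran triv_inv"
    using smooth_map_onD[OF s2 de c] by (simp add: triv_ran_def triv_inv_def)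
  show "triv x \<in> triv_ran" "triv_inv (triv x) = x" "Pc c d x = fst (triv x)" if "x \<in> triv_dom"
    using that
    by (auto elim!: triv_domE simp: triv_ran_iff \<Phi>inv_\<Phi> triv_chart_inv Pc_chart c)
  show "triv_inv z \<in> triv_dom" "triv (triv_inv z) = z" if z: "z \<in> triv_ran"
  proof -
    obtain n f where nf: "n \<in> fst d" "f \<in> fst e" "n \<in> U0" "\<Phi>inv (n, f) \<in> fst c" "z = (snd d n, snd e f)"
      "triv_inv z = snd c (\<Phi>inv (n, f))" "(n, f) \<in> U0 \<times> points AF"
      using z by (rule triv_ranE)
    show "triv_inv z \<in> triv_dom"
      unfolding nf(6) triv_dom_def using nf \<Phi>inv_in[OF nf(7)] \<Phi>_\<Phi>inv[OF nf(7)] by auto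
    show "triv (triv_inv z) = z"
      using nf \<Phi>_\<Phi>inv[OF nf(7)] atlas_inj[OF AM c] by (simp add: triv_def)
  qed
  show "triv_dom \<subseteq> Qc c d"
    by (auto elim!: triv_domE simp: Qc_chart c)
qed

end
end

section \<open>Vertical extensions, local sections and functions on fibres\<close>

lemma trivialization:
  assumes m: "m \<in> points AM"
  obtains U0 \<Phi> where "openin (mtopology AN) U0" "\<pi> m \<in> U0"
    "diffeo_on AM (points AM \<inter> \<pi> -` U0) (prod_atlas AN AF) (U0 \<times> points AF) \<Phi>"
    "\<forall>m \<in> points AM \<inter> \<pi> -` U0. fst (\<Phi> m) = \<pi> m"
  using fibred m \<pi>_surj unfolding smooth_fibre_bundle_def by (metis imageI)

text \<open>Adapted coordinates in which the projection is the first factor. They replace an appeal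
  to the implicit function theorem, and every local use of the bundle structure goes through them;
  only the argument along a whole fibre returns to the trivialisation itself.\<close>

lemma local_coordinates:
  assumes c: "c \<in> AM" "m \<in> fst c" and d: "d \<in> AN" "\<pi> m \<in> fst d"
  obtains U and V :: "('b \<times> 'k) set" and \<Phi> \<Psi> where "open U" "open V" "smooth_on U \<Phi>" "smooth_on V \<Psi>"
    "\<And>x. x \<in> U \<Longrightarrow> \<Phi> x \<in> V" "\<And>z. z \<in> V \<Longrightarrow> \<Psi> z \<in> U"
    "\<And>x. x \<in> U \<Longrightarrow> \<Psi> (\<Phi> x) = x" "\<And>z. z \<in> V \<Longrightarrow> \<Phi> (\<Psi> z) = z"
    "\<And>x. x \<in> U \<Longrightarrow> Pc c d x = fst (\<Phi> x)" "U \<subseteq> Qc c d" "snd c m \<in> U"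
proof -
  have m: "m \<in> points AM" using chart_point[OF c] .
  obtain U0 \<Phi> where t: "openin (mtopology AN) U0"
    "diffeo_on AM (points AM \<inter> \<pi> -` U0) (prod_atlas AN AF) (U0 \<times> points AF) \<Phi>"
    "\<forall>m \<in> points AM \<inter> \<pi> -` U0. fst (\<Phi> m) = \<pi> m" and mU: "\<pi> m \<in> U0"
    using trivialization[OF m] by metis
  have \<Phi>m: "\<Phi> m \<in> U0 \<times> points AF" "fst (\<Phi> m) = \<pi> m" using \<Phi>_in[OF t m mU] t(3) m mU by auto
  then obtain e where e: "e \<in> AF" "snd (\<Phi> m) \<in> fst e" by (auto simp: points_def)
  note tp = triv_props[OF t c(1) d(1) e(1)]
  have mt: "snd c m \<in> triv_dom U0 \<Phi> c d e"
    unfolding triv_dom_def[OF t c(1) d(1) e(1)] using c d e m mU \<Phi>m by (auto simp: mem_Times_iff)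
  show ?thesis
    by (rule that[OF tp(1-4)]) (fact tp mt)+
qed

lemma vertical_extension:
  assumes c: "c \<in> AM" "m \<in> fst c" and d: "d \<in> AN" "\<pi> m \<in> fst d"
    and w: "frechet_derivative (Pc c d) (at (snd c m)) w = 0"
  obtains Y where "vector_field AM Y" "proj_vertical AM AN \<pi> Y" "snd (Y m) c = w"
proof -
  obtain U and V :: "('b \<times> 'k) set" and \<Phi> \<Psi> where UV: "open U" "open V" "smooth_on U \<Phi>" "smooth_on V \<Psi>"
    "\<And>x. x \<in> U \<Longrightarrow> \<Phi> x \<in> V" "\<And>z. z \<in> V \<Longrightarrow> \<Psi> z \<in> U"
    "\<And>x. x \<in> U \<Longrightarrow> \<Psi> (\<Phi> x) = x" "\<And>z. z \<in> V \<Longrightarrow> \<Phi> (\<Psi> z) = z"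
    "\<And>x. x \<in> U \<Longrightarrow> Pc c d x = fst (\<Phi> x)" and UQ: "U \<subseteq> Qc c d" and mU: "snd c m \<in> U"
    by (rule local_coordinates[OF c d]) (rule that)
  obtain y where y: "smooth_on U y" "y (snd c m) = w"
    "\<And>x. x \<in> U \<Longrightarrow> frechet_derivative (Pc c d) (at x) (y x) = 0"
    by (rule local_vertical_field[OF UV mU w]) (assumption | rule that)+
  have Uc: "U \<subseteq> snd c ` fst c" using UQ by (auto simp: Qc_def)
  obtain Y \<beta> where Y: "vector_field AM Y" "\<beta> (snd c m) = 1"
    "\<And>p. p \<in> fst c \<Longrightarrow> snd c p \<in> U \<Longrightarrow> Y p = tangent_of AM c p (\<beta> (snd c p) *\<^sub>R y (snd c p))"
    "\<And>p. \<not> (p \<in> fst c \<and> snd c p \<in> U) \<Longrightarrow> Y p = tzero p"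
    by (rule extend_vector_field[OF AM HM c(1) UV(1) Uc y(1) mU]) (assumption | rule that)+
  have "proj_vertical AM AN \<pi> Y"
    unfolding proj_vertical_def
  proof
    fix p assume p: "p \<in> points AM"
    show "tangent_map AM AN \<pi> (Y p) = tzero (\<pi> p)"
    proof (cases "p \<in> fst c \<and> snd c p \<in> U")
      case True
      then have pc: "p \<in> fst c" and pU: "snd c p \<in> U" by auto
      have pd: "\<pi> p \<in> fst d" using pU UQ pc atlas_inj[OF AM c(1)] by (auto simp: Qc_iff[OF c(1)])
      \<comment> \<open>The kernel of the projection is closed under scaling, so the cut-off keeps
        the field vertical at every point.\<close>
      have "frechet_derivative (Pc c d) (at (snd c p)) (\<beta> (snd c p) *\<^sub>R y (snd c p)) = 0"
        using y(3)[OF pU] linear_scale[OF linear_Pc[OF c(1) d(1)]] pU UQ by auto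
      then show ?thesis
        using tangent_map_\<pi>_vertical_iff[OF tangent_of_in[OF AM c(1) pc] c(1) pc d(1) pd]
        by (simp add: Y(3)[OF pc pU] snd_tangent_of[OF AM c(1) pc])
    next
      case False
      obtain c' where c': "c' \<in> AM" "p \<in> fst c'" using p by (auto simp: points_def)
      have "\<pi> p \<in> points AN" using p \<pi>_surj by auto
      then obtain d' where d': "d' \<in> AN" "\<pi> p \<in> fst d'" by (auto simp: points_def)
      have "frechet_derivative (Pc c' d') (at (snd c' p)) 0 = 0"
        by (rule linear_0[OF linear_Pc[OF c'(1) d'(1) Qc_chart[OF c' d'(2)]]])
      then show ?thesis
        using tangent_map_\<pi>_vertical_iff[OF tzero_in[OF c'] c' d'] Y(4)[OF False] by (simp add: tzero_def)
    qed
  qed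
  moreover have "snd (Y m) c = w"
    using Y(2) Y(3)[OF c(2) mU] y(2) by (simp add: snd_tangent_of[OF AM c])
  ultimately show ?thesis using that Y(1) by blast
qed

text \<open>Freeze the fibre coordinate at its value at \<open>m\<close>. The section serves twice:
  it gives smoothness of the pushed-down function, and it lifts tangent vectors linearly near the
  zero section.\<close>

lemma local_section:
  assumes c: "c \<in> AM" "m \<in> fst c" and d: "d \<in> AN" "\<pi> m \<in> fst d"
  obtains N \<sigma> where "open N" "snd d (\<pi> m) \<in> N" "smooth_on N \<sigma>" "\<sigma> (snd d (\<pi> m)) = snd c m"
    "\<And>z. z \<in> N \<Longrightarrow> \<sigma> z \<in> Qc c d \<and> Pc c d (\<sigma> z) = z"
proof -
  obtain U and V :: "('b \<times> 'k) set" and \<Phi> \<Psi> where UV: "open U" "open V" "smooth_on U \<Phi>" "smooth_on V \<Psi>"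
    "\<And>x. x \<in> U \<Longrightarrow> \<Phi> x \<in> V" "\<And>z. z \<in> V \<Longrightarrow> \<Psi> z \<in> U"
    "\<And>x. x \<in> U \<Longrightarrow> \<Psi> (\<Phi> x) = x" "\<And>z. z \<in> V \<Longrightarrow> \<Phi> (\<Psi> z) = z"
    "\<And>x. x \<in> U \<Longrightarrow> Pc c d x = fst (\<Phi> x)" and UQ: "U \<subseteq> Qc c d" and mU: "snd c m \<in> U"
    by (rule local_coordinates[OF c d]) (rule that)
  let ?k = "snd (\<Phi> (snd c m))" and ?n = "snd d (\<pi> m)"
  have fst: "fst (\<Phi> (snd c m)) = ?n" using UV(9)[OF mU] Pc_chart[OF c] by simp
  then have nk: "(?n, ?k) = \<Phi> (snd c m)" by (metis prod.collapse)
  define N where "N = (\<lambda>z. (z, ?k)) -` V"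
  have N: "open N" unfolding N_def by (intro open_vimage UV continuous_intros)
  \<comment> \<open>Written as a linear embedding plus a constant, so that the affine composition
    rule applies to the normed fibre model.\<close>
  have "smooth_on N (\<lambda>z. \<Psi> ((z, 0) + (0, ?k)))"
    by (rule smooth_on_affine_precomp[OF UV(4) _ N])
      (auto simp: N_def intro!: bounded_linear_Pair bounded_linear_ident bounded_linear_zero)
  then have "smooth_on N (\<lambda>z. \<Psi> (z, ?k))" by simp
  moreover have "\<Psi> (z, ?k) \<in> Qc c d \<and> Pc c d (\<Psi> (z, ?k)) = z" if "z \<in> N" for z
  proof -
    have zV: "(z, ?k) \<in> V" using that by (simp add: N_def)
    then show ?thesis using UV(6)[OF zV] UV(8)[OF zV] UV(9) UQ by auto
  qed
  moreover have "?n \<in> N" using UV(5)[OF mU] nk by (simp add: N_def)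
  moreover have "\<Psi> (?n, ?k) = snd c m" using UV(7)[OF mU] nk by simp
  ultimately show ?thesis using that[of N "\<lambda>z. \<Psi> (z, ?k)"] N by blast
qed

text \<open>Through the trivialisation the fibre is parametrised by the typical fibre. Curves in it
  move vertically, so the transported function \<open>g\<close> has zero derivative in every chart
  and is locally constant; connectedness finishes. The chart in the hypothesis may vary with the
  point.\<close>

lemma constant_on_fibres:
  fixes val :: "'m \<Rightarrow> real"
  assumes conn: "connected_space (mtopology AF)" and d: "d \<in> AN" "n \<in> fst d"
    and val: "\<And>m. m \<in> points AM \<Longrightarrow> \<pi> m = n \<Longrightarrow> \<exists>c\<in>AM. m \<in> fst c \<and>
      (val \<circ> chart_inv c) differentiable (at (snd c m)) \<and>
      (\<forall>w. frechet_derivative (Pc c d) (at (snd c m)) w = 0 \<longrightarrow>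
         frechet_derivative (val \<circ> chart_inv c) (at (snd c m)) w = 0)"
    and m: "m \<in> points AM" "\<pi> m = n" and m': "m' \<in> points AM" "\<pi> m' = n"
  shows "val m = val m'"
proof -
  obtain U0 \<Phi> where t: "openin (mtopology AN) U0"
    "diffeo_on AM (points AM \<inter> \<pi> -` U0) (prod_atlas AN AF) (U0 \<times> points AF) \<Phi>"
    "\<forall>m \<in> points AM \<inter> \<pi> -` U0. fst (\<Phi> m) = \<pi> m" and nU: "n \<in> U0"
    using trivialization[OF m(1)] m(2) by metis
  define \<Psi> where "\<Psi> = \<Phi>inv U0 \<Phi>"
  define g where "g f = val (\<Psi> (n, f))" for f
  have nf: "(n, f) \<in> U0 \<times> points AF" if "f \<in> points AF" for f using nU that by auto
  have zero: "((g \<circ> chart_inv e) has_derivative (\<lambda>x. 0)) (at k)" if e: "e \<in> AF" and k: "k \<in> snd e ` fst e" for e k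
  proof -
    obtain f where f: "f \<in> fst e" "k = snd e f" using k by auto
    have fF: "f \<in> points AF" using f e by (auto simp: points_def)
    let ?m = "\<Psi> (n, f)"
    have mm: "?m \<in> points AM" "\<pi> ?m = n"
      using \<Phi>inv_in[OF t nf[OF fF]] \<pi>_\<Phi>inv[OF t nf[OF fF]] by (auto simp: \<Psi>_def)
    obtain c where c: "c \<in> AM" "?m \<in> fst c" and diff: "(val \<circ> chart_inv c) differentiable (at (snd c ?m))"
      and vz: "\<And>w. frechet_derivative (Pc c d) (at (snd c ?m)) w = 0 \<Longrightarrow>
         frechet_derivative (val \<circ> chart_inv c) (at (snd c ?m)) w = 0"
      using val[OF mm] by blast
    let ?V = "triv_ran U0 \<Phi> c d e" and ?\<psi> = "triv_inv U0 \<Phi> c d e"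
    note tp = triv_props[OF t c(1) d(1) e]
    have inV: "(snd d n, k) \<in> ?V"
      unfolding f(2) triv_ran_iff[OF t c(1) d(1) e d(2) f(1)] using nU c(2) by (simp add: \<Psi>_def)
    define W where "W = (\<lambda>k'. (snd d n, k')) -` ?V"
    have W: "open W" unfolding W_def by (intro open_vimage tp(2) continuous_intros)
    have kW: "k \<in> W" using inV by (simp add: W_def)
    have \<psi>: "\<exists>f'. f' \<in> fst e \<and> k' = snd e f' \<and> ?\<psi> (snd d n, k') = snd c (\<Psi> (n, f')) \<and>
       \<Psi> (n, f') \<in> fst c \<and> \<pi> (\<Psi> (n, f')) = n" if k': "k' \<in> W" for k'
    proof -
      have "(snd d n, k') \<in> ?V" using k' by (simp add: W_def)
      then obtain n' f' where *: "n' \<in> fst d" "f' \<in> fst e" "\<Phi>inv U0 \<Phi> (n', f') \<in> fst c"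
        "(snd d n, k') = (snd d n', snd e f')" "?\<psi> (snd d n, k') = snd c (\<Phi>inv U0 \<Phi> (n', f'))"
        "(n', f') \<in> U0 \<times> points AF"
        by (rule triv_ranE[OF t c(1) d(1) e])
      then have "n' = n" using d atlas_inj[OF AN d(1)] by (auto dest: inj_onD)
      with * \<pi>_\<Phi>inv[OF t *(6)] show ?thesis by (auto simp: \<Psi>_def)
    qed
    \<comment> \<open>Varying only the fibre coordinate leaves the projection fixed, so
      \<open>\<kappa>\<close> takes values in the kernel of its derivative, where the hypothesis on
      \<open>val\<close> applies.\<close>
    define \<kappa> where "\<kappa> x = frechet_derivative ?\<psi> (at (snd d n, k)) (0, x)" for x
    have d\<psi>: "((\<lambda>k'. ?\<psi> (snd d n, k')) has_derivative \<kappa>) (at k)"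
      unfolding \<kappa>_def
      by (rule has_derivative_compose[OF has_derivative_Pair[OF has_derivative_const has_derivative_ident]
            smooth_on_has_derivative[OF tp(4) inV]])
    have \<psi>k: "?\<psi> (snd d n, k) = snd c ?m"
      using triv_chart_inv[OF t c(1) d(1) e d(2) f(1)] f(2) by (simp add: \<Psi>_def)
    have mQ: "snd c ?m \<in> Qc c d" using Qc_chart[OF c] mm d by simp
    have "((\<lambda>k'. Pc c d (?\<psi> (snd d n, k'))) has_derivative (\<lambda>x. frechet_derivative (Pc c d) (at (snd c ?m)) (\<kappa> x))) (at k)"
      by (rule has_derivative_compose[OF d\<psi>])
        (use smooth_on_has_derivative[OF smooth_Pc[OF c(1) d(1)] mQ] \<psi>k in simp)
    moreover have "((\<lambda>k'. Pc c d (?\<psi> (snd d n, k'))) has_derivative (\<lambda>x. 0)) (at k)"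
    proof (rule has_derivative_cong_open[OF has_derivative_const W kW])
      show "snd d n = Pc c d (?\<psi> (snd d n, k'))" if "k' \<in> W" for k'
        using \<psi>[OF that] Pc_chart[OF c(1)] by metis
    qed
    ultimately have "frechet_derivative (Pc c d) (at (snd c ?m)) (\<kappa> x) = 0" for x
      using has_derivative_unique by metis
    then have "frechet_derivative (val \<circ> chart_inv c) (at (snd c ?m)) (\<kappa> x) = 0" for x
      by (rule vz)
    moreover have "((\<lambda>k'. (val \<circ> chart_inv c) (?\<psi> (snd d n, k'))) has_derivative
        (\<lambda>x. frechet_derivative (val \<circ> chart_inv c) (at (snd c ?m)) (\<kappa> x))) (at k)"
      by (rule has_derivative_compose[OF d\<psi>]) (unfold \<psi>k, rule has_frechet_derivative[OF diff])
    ultimately have "((\<lambda>k'. (val \<circ> chart_inv c) (?\<psi> (snd d n, k'))) has_derivative (\<lambda>x. 0)) (at k)"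
      by simp
    then show ?thesis
    proof (rule has_derivative_cong_open[OF _ W kW])
      fix k' assume "k' \<in> W"
      then obtain f' where f': "f' \<in> fst e" "k' = snd e f'" "?\<psi> (snd d n, k') = snd c (\<Psi> (n, f'))" "\<Psi> (n, f') \<in> fst c"
        using \<psi> by blast
      then show "(val \<circ> chart_inv c) (?\<psi> (snd d n, k')) = (g \<circ> chart_inv e) k'"
        using atlas_inj[OF AM c(1)] atlas_inj[OF AF e] by (simp add: g_def)
    qed
  qed
  have loc: "\<exists>T. openin (mtopology AF) T \<and> f \<in> T \<and> (\<forall>f'\<in>T. g f' = g f)" if fF: "f \<in> points AF" for f
  proof -
    obtain e where e: "e \<in> AF" "f \<in> fst e" using fF by (auto simp: points_def)
    have "open (snd e ` fst e)" by (rule open_chart[OF cF e(1)])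
    then obtain r where r: "r > 0" "ball (snd e f) r \<subseteq> snd e ` fst e"
      using e(2) open_contains_ball by blast
    have "\<exists>a. \<forall>x\<in>ball (snd e f) r. (g \<circ> chart_inv e) x = a"
    proof (rule has_derivative_zero_constant[OF convex_ball])
      show "((g \<circ> chart_inv e) has_derivative (\<lambda>h. 0)) (at x within ball (snd e f) r)"
        if "x \<in> ball (snd e f) r" for x
        by (rule has_derivative_at_withinI[OF zero[OF e(1)]]) (use that r(2) in blast)
    qed
    then obtain a where a: "\<And>x. x \<in> ball (snd e f) r \<Longrightarrow> g (chart_inv e x) = a" by auto
    define T where "T = fst e \<inter> snd e -` ball (snd e f) r"
    have "snd e ` T = ball (snd e f) r" using r(2) by (auto simp: T_def)
    then have "openin (mtopology AF) T"
      using openin_chart_subset[OF AF e(1), of T] by (simp add: T_def)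
    moreover have "f \<in> T" using e r by (simp add: T_def)
    moreover have "g f' = a" if "f' \<in> T" for f'
      using a[of "snd e f'"] that atlas_inj[OF AF e(1)] by (simp add: T_def)
    ultimately show ?thesis by metis
  qed
  have top: "topspace (mtopology AF) = points AF" by (rule topspace_mtopology[OF cF])
  \<comment> \<open>Local constancy makes this level set and its complement open; being nonempty, it
    is the whole connected fibre.\<close>
  define S where "S = {f \<in> points AF. g f = val m}"
  have "openin (mtopology AF) S"
  proof (subst openin_subopen, intro ballI)
    fix f assume f: "f \<in> S"
    then have "f \<in> points AF" by (simp add: S_def)
    from loc[OF this] obtain T where T: "openin (mtopology AF) T" "f \<in> T" "\<forall>f'\<in>T. g f' = g f"
      by blast
    have "T \<subseteq> points AF" using openin_subset[OF T(1)] top by blast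
    moreover have "g f' = val m" if "f' \<in> T" for f'
      using bspec[OF T(3) that] f by (simp add: S_def)
    ultimately have "T \<subseteq> S" unfolding S_def by blast
    then show "\<exists>T. openin (mtopology AF) T \<and> f \<in> T \<and> T \<subseteq> S"
      using T(1,2) by blast
  qed
  moreover have "openin (mtopology AF) (points AF - S)"
  proof (subst openin_subopen, intro ballI)
    fix f assume f: "f \<in> points AF - S"
    then have "f \<in> points AF" by simp
    from loc[OF this] obtain T where T: "openin (mtopology AF) T" "f \<in> T" "\<forall>f'\<in>T. g f' = g f"
      by blast
    have "T \<subseteq> points AF" using openin_subset[OF T(1)] top by blast
    moreover have "g f' \<noteq> val m" if "f' \<in> T" for f'
      using bspec[OF T(3) that] f by (simp add: S_def)
    ultimately have "T \<subseteq> points AF - S" unfolding S_def by blast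
    then show "\<exists>T. openin (mtopology AF) T \<and> f \<in> T \<and> T \<subseteq> points AF - S"
      using T(1,2) by blast
  qed
  ultimately have "S = {} \<or> S = points AF"
    using conn top unfolding connected_space_clopen_in closedin_def S_def by auto
  moreover have mg: "snd (\<Phi> p) \<in> points AF \<and> g (snd (\<Phi> p)) = val p" if "p \<in> points AM" "\<pi> p = n" for p
  proof -
    have "\<Phi> p \<in> U0 \<times> points AF" "fst (\<Phi> p) = n" using \<Phi>_in[OF t that(1)] t(3) that nU by auto
    moreover then have "(n, snd (\<Phi> p)) = \<Phi> p" by (metis prod.collapse)
    ultimately show ?thesis using \<Phi>inv_\<Phi>[OF t that(1)] that nU by (auto simp: g_def \<Psi>_def mem_Times_iff)
  qed
  moreover have "snd (\<Phi> m) \<in> S" using mg[OF m] by (simp add: S_def)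
  ultimately have "S = points AF" by blast
  then have "snd (\<Phi> m') \<in> S" using mg[OF m'] by simp
  then show ?thesis using mg[OF m'] by (simp add: S_def)
qed

end

section \<open>The induced splitting in charts\<close>

lemma slit_tchart_image:
  fixes A :: "('m, 'b::real_normed_vector) chart set"
  assumes A: "smooth_atlas A" and c: "c \<in> A"
  shows "snd (tchart A c) ` (fst (tchart A c) \<inter> slit_TM A) = snd c ` fst c \<times> (- {0})"
proof (intro set_eqI iffI)
  fix z assume "z \<in> snd (tchart A c) ` (fst (tchart A c) \<inter> slit_TM A)"
  then obtain v where v: "v \<in> TM A" "fst v \<in> fst c" "v \<in> slit_TM A" "z = (snd c (fst v), snd v c)"
    by (auto simp: fst_tchart snd_tchart)
  then show "z \<in> snd c ` fst c \<times> (- {0})" using slit_TM_iff[OF A v(1) c v(2)] by auto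
next
  fix z :: "'b \<times> 'b" assume z: "z \<in> snd c ` fst c \<times> (- {0})"
  then have "z \<in> snd (tchart A c) ` fst (tchart A c)" using tchart_full_image[OF A c] by auto
  then obtain v where v: "v \<in> TM A" "fst v \<in> fst c" "z = (snd c (fst v), snd v c)"
    by (auto simp: fst_tchart snd_tchart)
  then have "v \<in> slit_TM A" using z slit_TM_iff[OF A v(1) c v(2)] by auto
  then show "z \<in> snd (tchart A c) ` (fst (tchart A c) \<inter> slit_TM A)"
    using v by (intro image_eqI[of _ _ v]) (auto simp: fst_tchart snd_tchart)
qed

text \<open>Assumes smoothness alone, so that it also serves for the pushed-down function before
  that is known to be a Finsler function.\<close>

lemma slit_smooth_chart:
  fixes A :: "('m, 'a::euclidean_space) chart set" and F :: "('m, 'a) tangent \<Rightarrow> real"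
  assumes A: "smooth_atlas A" and F: "smooth_map_on (tatlas A) (slit_TM A) vs_atlas F" and c: "c \<in> A"
  shows "smooth_on (snd c ` fst c \<times> (- {0})) (F \<circ> chart_inv (tchart A c))"
  using smooth_map_onD[OF F tchart_in[OF c], of "(UNIV, id)"] slit_tchart_image[OF A c]
  by (simp add: vs_atlas_def)

lemma slit_energy_smooth_chart:
  fixes A :: "('m, 'a::euclidean_space) chart set" and F :: "('m, 'a) tangent \<Rightarrow> real"
  assumes A: "smooth_atlas A" and F: "smooth_map_on (tatlas A) (slit_TM A) vs_atlas F" and c: "c \<in> A"
  shows "smooth_on (snd c ` fst c \<times> (- {0})) (energy F \<circ> chart_inv (tchart A c))"
proof -
  let ?S = "snd c ` fst c \<times> (- {0 :: 'a})"
  have S: "open ?S"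
    by (intro open_Times open_chart[OF smooth_atlas_imp_chart_atlas[OF A] c]) (simp add: open_Compl)
  note F' = slit_smooth_chart[OF A F c]
  have "smooth_on ?S (\<lambda>z. (1 / 2) * ((F \<circ> chart_inv (tchart A c)) z * (F \<circ> chart_inv (tchart A c)) z))"
    by (intro smooth_on_mult smooth_on_const S F')
  then show ?thesis
    by (rule smooth_on_cong[OF _ S]) (simp add: energy_def power2_eq_square)
qed

lemma finsler_smooth: "finsler_function A F \<Longrightarrow> smooth_map_on (tatlas A) (slit_TM A) vs_atlas F"
  by (simp add: finsler_function_def)

lemmas energy_smooth_chart = slit_energy_smooth_chart[OF _ finsler_smooth]

lemma energy_pos_chart:
  fixes A :: "('m, 'a::euclidean_space) chart set"
  assumes A: "smooth_atlas A" and F: "finsler_function A F" and c: "c \<in> A"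
    and q: "q \<in> snd c ` fst c" and u: "u \<noteq> 0" and w: "w \<noteq> 0"
  shows "frechet_derivative (\<lambda>y. frechet_derivative (energy F \<circ> chart_inv (tchart A c)) (at y) (0, w)) (at (q, u)) (0, w) > 0"
proof -
  have "(q, u) \<in> snd (tchart A c) ` (fst (tchart A c) \<inter> slit_TM A)"
    using slit_tchart_image[OF A c] q u by simp
  then obtain v where v: "fst v \<in> fst c" "v \<in> slit_TM A" "snd (tchart A c) v = (q, u)"
    by (auto simp: fst_tchart)
  have "positive_definite (fibre_hessian (energy F \<circ> chart_inv (tchart A c)) (q, u))"
    using F v c unfolding finsler_function_def by metis
  moreover have "open (snd c ` fst c \<times> (- {0 :: 'a}))"
    by (intro open_Times open_chart[OF smooth_atlas_imp_chart_atlas[OF A] c]) (simp add: open_Compl)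
  ultimately show ?thesis
    using positive_definite_fibre_hessian_iff[OF energy_smooth_chart[OF A F c], of "(q, u)"] q u w by simp
qed

lemma finsler_nonneg: "finsler_function A F \<Longrightarrow> v \<in> TM A \<Longrightarrow> F v \<ge> 0"
  unfolding finsler_function_def by blast

lemma finsler_homogeneous: "finsler_function A F \<Longrightarrow> v \<in> TM A \<Longrightarrow> r > 0 \<Longrightarrow> F (tscale r v) = r * F v"
  unfolding finsler_function_def by blast

text \<open>Homogeneity is assumed for positive factors only. Doubling fixes the zero vector, so the
  value there equals its own double.\<close>

lemma finsler_tzero:
  assumes "finsler_function A F" "tzero p \<in> TM A" shows "F (tzero p) = 0"
proof -
  have "tscale 2 (tzero p) = (tzero p :: ('a, 'b) tangent)" by (simp add: tscale_def tzero_def)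
  then show ?thesis using finsler_homogeneous[OF assms, of 2] by simp
qed

lemma energy_le_iff:
  "finsler_function A F \<Longrightarrow> v \<in> TM A \<Longrightarrow> w \<in> TM A \<Longrightarrow> energy F v \<le> energy F w \<longleftrightarrow> F v \<le> F w"
  using finsler_nonneg[of A F] by (simp add: energy_def)

locale finsler_splitting = fibre_bundle AM AN AF \<pi>
  for AM :: "('m, 'a::euclidean_space) chart set" and AN :: "('n, 'b::euclidean_space) chart set"
    and AF :: "('f, 'k::real_normed_vector) chart set" and \<pi> :: "'m \<Rightarrow> 'n" +
  fixes F1 :: "('m, 'a) tangent \<Rightarrow> real"
    and h :: "'m \<times> ('n, 'b) tangent \<Rightarrow> ('m, 'a) tangent"
  assumes finsler: "finsler_function AM F1"
    and splitting: "induced_splitting AM AN \<pi> F1 h"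
begin

definition Gc :: "('m, 'a) chart \<Rightarrow> 'a \<times> 'a \<Rightarrow> real" where
  "Gc c = energy F1 \<circ> chart_inv (tchart AM c)"

definition Hc :: "('m, 'a) chart \<Rightarrow> ('n, 'b) chart \<Rightarrow> 'a \<times> 'b \<Rightarrow> 'a" where
  "Hc c d z = snd (h (chart_inv c (fst z), tangent_of AN d (\<pi> (chart_inv c (fst z))) (snd z))) c"

lemma h_in: "(m, v) \<in> pullback AM AN \<pi> \<Longrightarrow> h (m, v) \<in> tangent_space AM m"
  and h_over: "(m, v) \<in> pullback AM AN \<pi> \<Longrightarrow> tangent_map AM AN \<pi> (h (m, v)) = v"
  using splitting unfolding induced_splitting_def by blast+

lemma h_tzero: "m \<in> points AM \<Longrightarrow> h (m, tzero (\<pi> m)) = tzero m"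
  using splitting unfolding induced_splitting_def by blast

lemma h_TM: "(m, v) \<in> pullback AM AN \<pi> \<Longrightarrow> h (m, v) \<in> TM AM"
  using TM_I[OF h_in] by (auto simp: pullback_def)

lemma slit_pullback_iff: "(m, v) \<in> slit_pullback AM AN \<pi> \<longleftrightarrow> (m, v) \<in> pullback AM AN \<pi> \<and> v \<noteq> tzero (\<pi> m)"
  by (auto simp: slit_pullback_def pullback_def slit_TM_def)

lemma pullbackI: "m \<in> points AM \<Longrightarrow> v \<in> tangent_space AN (\<pi> m) \<Longrightarrow> (m, v) \<in> pullback AM AN \<pi>"
  using \<pi>_surj tangent_space_fst[of v AN "\<pi> m"] TM_I[of v AN "\<pi> m"] by (auto simp: pullback_def)

lemma pullbackD:
  assumes "(m, v) \<in> pullback AM AN \<pi>"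
  shows "m \<in> points AM" "v \<in> tangent_space AN (\<pi> m)" "v \<in> TM AN" "fst v = \<pi> m"
  using assms by (auto simp: pullback_def TM_iff)

lemma pullback_chart:
  assumes "c \<in> AM" "m \<in> fst c" "d \<in> AN" "\<pi> m \<in> fst d"
  shows "(m, tangent_of AN d (\<pi> m) w) \<in> pullback AM AN \<pi>"
  by (rule pullbackI[OF chart_point[OF assms(1,2)] tangent_of_in[OF AN assms(3,4)]])

lemma slit_pullback_chart:
  assumes "c \<in> AM" "m \<in> fst c" "d \<in> AN" "\<pi> m \<in> fst d" "w \<noteq> 0"
  shows "(m, tangent_of AN d (\<pi> m) w) \<in> slit_pullback AM AN \<pi>"
proof -
  have "tangent_of AN d (\<pi> m) w \<noteq> tzero (\<pi> m)"
    using snd_tangent_of[OF AN assms(3,4), of w] assms(5) by (auto simp: tzero_def)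
  then show ?thesis using pullback_chart[OF assms(1-4)] by (simp add: slit_pullback_iff)
qed

lemma Hc_chart:
  assumes "c \<in> AM" "m \<in> fst c" "d \<in> AN" "\<pi> m \<in> fst d" "v \<in> tangent_space AN (\<pi> m)"
  shows "Hc c d (snd c m, snd v d) = snd (h (m, v)) c"
  using tangent_of_snd[OF AN assms(5,3,4)] atlas_inj[OF AM assms(1)] assms(2) by (simp add: Hc_def)

lemma h_nonzero:
  assumes x: "(m, v) \<in> slit_pullback AM AN \<pi>"
  shows "h (m, v) \<in> slit_TM AM"
proof -
  have pb: "(m, v) \<in> pullback AM AN \<pi>" and vn: "v \<noteq> tzero (\<pi> m)" using x by (auto simp: slit_pullback_iff)
  note pbD = pullbackD[OF pb]
  obtain c where c: "c \<in> AM" "m \<in> fst c" using pbD(1) by (auto simp: points_def)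
  have "\<pi> m \<in> points AN" using pbD(1) \<pi>_surj by auto
  then obtain d where d: "d \<in> AN" "\<pi> m \<in> fst d" by (auto simp: points_def)
  have "tangent_map AM AN \<pi> (tzero m) = tzero (\<pi> m)"
    using tangent_map_\<pi>_vertical_iff[OF tzero_in[OF c] c d] linear_0[OF linear_Pc[OF c(1) d(1) Qc_chart[OF c d(2)]]]
    by (simp add: tzero_def)
  then have "h (m, v) \<noteq> tzero m" using h_over[OF pb] vn by metis
  then show ?thesis using h_TM[OF pb] tangent_space_fst[OF h_in[OF pb]] by (simp add: slit_TM_def)
qed

lemma tderiv_vertical_lift_energy:
  assumes Y: "vector_field AM Y" and v: "v \<in> slit_TM AM" and c: "c \<in> AM" "fst v \<in> fst c"
  shows "tderiv (tatlas AM) (vertical_lift AM Y v) (energy F1) =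
    frechet_derivative (Gc c) (at (snd c (fst v), snd v c)) (0, components c Y (snd c (fst v)))"
proof -
  have vT: "v \<in> TM AM" using v by (simp add: slit_TM_def)
  have p: "fst v \<in> points AM" "v \<in> tangent_space AM (fst v)" using vT by (auto simp: TM_iff)
  have "Y (fst v) \<in> tangent_space AM (fst v)" using Y p by (simp add: vector_field_on_def)
  moreover have "snd v c \<noteq> 0" using slit_TM_iff[OF AM vT c] v by simp
  ultimately show ?thesis
    using tderiv_vertical_lift[OF AM _ p c, of Y "energy F1"]
      smooth_on_differentiable[OF energy_smooth_chart[OF AM finsler c(1)], of "(snd c (fst v), snd v c)"] c
    by (simp add: Gc_def components_chart atlas_inj[OF AM c(1)])
qed

text \<open>Smoothness of \<open>h\<close> is given for charts of the pullback bundle. The content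
  is that such a chart maps the slit part exactly onto \<open>Qc\<close> times the nonzero vectors,
  with the inverse that is built into \<open>Hc\<close>.\<close>

lemma smooth_Hc:
  assumes c: "c \<in> AM" and d: "d \<in> AN"
  shows "smooth_on (Qc c d \<times> (- {0})) (Hc c d)"
proof -
  define C :: "('m \<times> ('n, 'b) tangent, 'a \<times> 'b) chart" where "C = ({(m, v) \<in> pullback AM AN \<pi>. m \<in> fst c \<and> fst v \<in> fst d}, \<lambda>(m, v). (snd c m, snd v d))"
  have C: "C \<in> pullback_atlas AM AN \<pi>"
    unfolding C_def pullback_atlas_def using c d by blast
  have inj: "inj_on (snd C) (fst C)"
  proof (rule inj_onI)
    fix x y assume x: "x \<in> fst C" and y: "y \<in> fst C" and eq: "snd C x = snd C y"
    obtain m v m' v' where xy: "x = (m, v)" "y = (m', v')" by (cases x, cases y)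
    have 1: "(m, v) \<in> pullback AM AN \<pi>" "m \<in> fst c" "fst v \<in> fst d" "(m', v') \<in> pullback AM AN \<pi>" "m' \<in> fst c"
      "snd c m = snd c m'" "snd v d = snd v' d"
      using x y eq by (auto simp: C_def xy)
    then have mm: "m = m'" using atlas_inj[OF AM c] by (auto dest: inj_onD)
    have "v = v'"
      using tangent_eqI[OF AN pullbackD(2)[OF 1(1)] _ d] pullbackD(2)[OF 1(4)] pullbackD(4)[OF 1(1)] 1 mm by metis
    then show "x = y" using mm xy by simp
  qed
  have slit: "w \<noteq> 0" if "(m, tangent_of AN d (\<pi> m) w) \<in> slit_pullback AM AN \<pi>" "\<pi> m \<in> fst d" for m w
    using that tangent_of_0[OF AN d] by (auto simp: slit_pullback_iff)
  have dom: "snd C ` (fst C \<inter> slit_pullback AM AN \<pi> \<inter> h -` fst (tchart AM c)) = Qc c d \<times> (- {0})"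
  proof (intro set_eqI iffI)
    fix z assume "z \<in> snd C ` (fst C \<inter> slit_pullback AM AN \<pi> \<inter> h -` fst (tchart AM c))"
    then obtain m v where mv: "(m, v) \<in> slit_pullback AM AN \<pi>" "m \<in> fst c" "fst v \<in> fst d" "z = (snd c m, snd v d)"
      by (auto simp: C_def)
    have pb: "(m, v) \<in> pullback AM AN \<pi>" using mv by (simp add: slit_pullback_iff)
    have d': "\<pi> m \<in> fst d" using mv pullbackD[OF pb] by simp
    have "tangent_of AN d (\<pi> m) (snd v d) = v" by (rule tangent_of_snd[OF AN pullbackD(2)[OF pb] d d'])
    then have "snd v d \<noteq> 0" using slit[OF _ d', of "snd v d"] mv by simp
    then show "z \<in> Qc c d \<times> (- {0})" using mv Qc_chart[OF c mv(2) d'] by simp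
  next
    fix z :: "'a \<times> 'b" assume "z \<in> Qc c d \<times> (- {0})"
    then obtain q w where z: "z = (q, w)" "q \<in> Qc c d" "w \<noteq> 0" by auto
    then obtain m where m: "m \<in> fst c" "\<pi> m \<in> fst d" "q = snd c m" by (auto simp: Qc_def)
    let ?v = "tangent_of AN d (\<pi> m) w"
    have pb: "(m, ?v) \<in> pullback AM AN \<pi>" by (rule pullback_chart[OF c m(1) d m(2)])
    have "(m, ?v) \<in> fst C" using pb m by (simp add: C_def)
    moreover have "(m, ?v) \<in> slit_pullback AM AN \<pi>" by (rule slit_pullback_chart[OF c m(1) d m(2) z(3)])
    moreover have "h (m, ?v) \<in> fst (tchart AM c)"
      using h_TM[OF pb] tangent_space_fst[OF h_in[OF pb]] m by (simp add: fst_tchart)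
    moreover have "snd C (m, ?v) = z" using z m snd_tangent_of[OF AN d m(2)] by (simp add: C_def)
    ultimately show "z \<in> snd C ` (fst C \<inter> slit_pullback AM AN \<pi> \<inter> h -` fst (tchart AM c))"
      by (intro image_eqI[of _ _ "(m, ?v)"]) auto
  qed
  have O: "open (Qc c d \<times> (- {0 :: 'b}))"
    by (intro open_Times open_Qc c d) (simp add: open_Compl)
  have "smooth_map_on (pullback_atlas AM AN \<pi>) (slit_pullback AM AN \<pi>) (tatlas AM) h"
    using splitting by (simp add: induced_splitting_def)
  from smooth_map_onD[OF this C tchart_in[OF c]]
  have "smooth_on (Qc c d \<times> (- {0})) (snd (tchart AM c) \<circ> h \<circ> chart_inv C)"
    unfolding dom .
  from smooth_on_linear_comp[OF bounded_linear_snd O this]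
  show ?thesis
  proof (rule smooth_on_cong[OF _ O])
    fix z assume "z \<in> Qc c d \<times> (- {0 :: 'b})"
    then obtain q w where z: "z = (q, w)" "q \<in> Qc c d" "w \<noteq> 0" by auto
    then obtain m where m: "m \<in> fst c" "\<pi> m \<in> fst d" "q = snd c m" by (auto simp: Qc_def)
    let ?v = "tangent_of AN d (\<pi> m) w"
    have "(m, ?v) \<in> fst C" using pullback_chart[OF c m(1) d m(2)] m by (simp add: C_def)
    then have "chart_inv C z = (m, ?v)"
      by (rule inv_into_f_eq[OF inj]) (use z m snd_tangent_of[OF AN d m(2)] in \<open>simp add: C_def\<close>)
    then show "snd ((snd (tchart AM c) \<circ> h \<circ> chart_inv C) z) = Hc c d z"
      using z m atlas_inj[OF AM c] by (simp add: Hc_def snd_tchart)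
  qed
qed

lemma Pc_Hc:
  assumes c: "c \<in> AM" and d: "d \<in> AN" and q: "q \<in> Qc c d"
  shows "frechet_derivative (Pc c d) (at q) (Hc c d (q, v)) = v"
proof -
  obtain m where m: "m \<in> fst c" "\<pi> m \<in> fst d" "q = snd c m" using q by (auto simp: Qc_def)
  let ?v = "tangent_of AN d (\<pi> m) v"
  have pb: "(m, ?v) \<in> pullback AM AN \<pi>" by (rule pullback_chart[OF c m(1) d m(2)])
  have v: "?v \<in> tangent_space AN (\<pi> m)" by (rule tangent_of_in[OF AN d m(2)])
  have "Hc c d (q, v) = snd (h (m, ?v)) c"
    using m atlas_inj[OF AM c] by (simp add: Hc_def)
  then show ?thesis
    using tangent_map_\<pi>_eq_iff[OF h_in[OF pb] c m(1) d m(2) v] h_over[OF pb] snd_tangent_of[OF AN d m(2)]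
    by (simp add: m(3))
qed

lemma splitting_coords:
  assumes c: "c \<in> AM" and d: "d \<in> AN"
  shows "splitting_coords (snd c ` fst c) (Qc c d) (Pc c d) (Gc c) (Hc c d)"
proof
  show "open (snd c ` fst c)" by (rule open_chart[OF cM c])
  show "open (Qc c d)" by (rule open_Qc[OF c d])
  show "Qc c d \<subseteq> snd c ` fst c" by (auto simp: Qc_def)
  show "smooth_on (Qc c d) (Pc c d)" by (rule smooth_Pc[OF c d])
  show "smooth_on (snd c ` fst c \<times> (- {0})) (Gc c)"
    unfolding Gc_def by (rule energy_smooth_chart[OF AM finsler c])
  show "smooth_on (Qc c d \<times> (- {0})) (Hc c d)" by (rule smooth_Hc[OF c d])
  show "frechet_derivative (Pc c d) (at q) (Hc c d (q, v)) = v" if "q \<in> Qc c d" for q v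
    by (rule Pc_Hc[OF c d that])
  show "frechet_derivative (\<lambda>y. frechet_derivative (Gc c) (at y) (0, w)) (at (q, u)) (0, w) > 0"
    if "q \<in> snd c ` fst c" "u \<noteq> 0" "w \<noteq> 0" for q u w
    unfolding Gc_def by (rule energy_pos_chart[OF AM finsler c that])
  fix q v z assume q: "q \<in> Qc c d" and v: "v \<noteq> (0 :: 'b)" and z: "frechet_derivative (Pc c d) (at q) z = 0"
  obtain m where m: "m \<in> fst c" "\<pi> m \<in> fst d" "q = snd c m" using q by (auto simp: Qc_def)
  \<comment> \<open>The defining condition of the splitting quantifies over global fields; extending
    the single vector \<open>z\<close> turns it into the pointwise critical condition.\<close>
  obtain Y where Y: "vector_field AM Y" "proj_vertical AM AN \<pi> Y" "snd (Y m) c = z"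
    using vertical_extension[OF c m(1) d m(2)] z m by metis
  let ?v = "tangent_of AN d (\<pi> m) v"
  have x: "(m, ?v) \<in> slit_pullback AM AN \<pi>" by (rule slit_pullback_chart[OF c m(1) d m(2) v])
  then have fst: "fst (h (m, ?v)) = m" using tangent_space_fst[OF h_in] by (simp add: slit_pullback_iff)
  have "tderiv (tatlas AM) (vertical_lift AM Y (h (m, ?v))) (energy F1) = 0"
    using splitting Y x unfolding induced_splitting_def by blast
  moreover have "Hc c d (q, v) = snd (h (m, ?v)) c"
    using m atlas_inj[OF AM c] by (simp add: Hc_def)
  moreover have "components c Y (snd c m) = z" using Y(3) m components_chart[OF atlas_inj[OF AM c]] by simp
  ultimately show "frechet_derivative (Gc c) (at (q, Hc c d (q, v))) (0, z) = 0"
    using tderiv_vertical_lift_energy[OF Y(1) h_nonzero[OF x] c] m fst by simp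
qed

section \<open>The spray and complete lifts along the horizontal manifold\<close>

lemma tderiv_complete_lift_energy:
  assumes Y: "vector_field AM Y" and v: "v \<in> slit_TM AM" and c: "c = chart_at AM (fst v)"
  shows "tderiv (tatlas AM) (complete_lift AM Y v) (energy F1) =
    frechet_derivative (Gc c) (at (snd c (fst v), snd v c))
      (components c Y (snd c (fst v)), frechet_derivative (components c Y) (at (snd c (fst v))) (snd v c))"
proof -
  have vT: "v \<in> TM AM" using v by (simp add: slit_TM_def)
  have p: "fst v \<in> points AM" "v \<in> tangent_space AM (fst v)" using vT by (auto simp: TM_iff)
  have c': "c \<in> AM" "fst v \<in> fst c" using chart_at[OF p(1)] c by auto
  have "Y (fst v) \<in> tangent_space AM (fst v)" using Y p by (simp add: vector_field_on_def)
  moreover have "snd v c \<noteq> 0" using slit_TM_iff[OF AM vT c'] v by simp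
  ultimately show ?thesis
    using tderiv_complete_lift[OF AM _ p c, of Y "energy F1"]
      smooth_on_differentiable[OF energy_smooth_chart[OF AM finsler c'(1)], of "(snd c (fst v), snd v c)"] c'
    by (simp add: Gc_def)
qed

text \<open>The function \<open>Y\<^sup>V(E)\<close> in the natural chart. It vanishes on the
  nonzero part of the horizontal manifold when \<open>Y\<close> is vertical, and the spray
  differentiates it to \<open>Y\<^sup>C(E)\<close>.\<close>

definition Wc :: "('m, 'a) chart \<Rightarrow> ('m \<Rightarrow> ('m, 'a) tangent) \<Rightarrow> 'a \<times> 'a \<Rightarrow> real" where
  "Wc c Y = (\<lambda>w. frechet_derivative (Gc c) (at w) (0, components c Y (fst w)))"

lemma open_slit: "c \<in> AM \<Longrightarrow> open (snd c ` fst c \<times> (- {0 :: 'a}))"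
  by (intro open_Times open_chart[OF cM]) (simp_all add: open_Compl)

lemma smooth_Wc:
  assumes Y: "vector_field AM Y" and c: "c \<in> AM"
  shows "smooth_on (snd c ` fst c \<times> (- {0})) (Wc c Y)"
proof -
  note O = open_slit[OF c]
  have "smooth_on (snd c ` fst c \<times> (- {0 :: 'a})) (\<lambda>w. (0 :: 'a, components c Y (fst w)))"
    by (rule smooth_on_Pair[OF O smooth_on_const])
      (rule smooth_on_compose[OF smooth_on_components[OF AM Y c] O smooth_on_linear[OF bounded_linear_fst O]], auto)
  then show ?thesis
    unfolding Wc_def
    by (rule smooth_on_deriv_compose[OF energy_smooth_chart[OF AM finsler c, folded Gc_def] O smooth_on_id[OF O]])
qed

text \<open>The spray equation differentiates the derivative along the vertical lift as a function
  on the tangent bundle. On the open slit chart domain that function coincides with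
  \<open>Wc\<close>, so both have the same derivative at \<open>v\<close>. The complete lift stays
  unexpanded, hence any chart is allowed.\<close>

lemma canonical_spray_chart:
  assumes S: "canonical_spray AM F1 S" and Y: "vector_field AM Y" and v: "v \<in> slit_TM AM"
    and c: "c \<in> AM" "fst v \<in> fst c"
  shows "frechet_derivative (Wc c Y) (at (snd c (fst v), snd v c)) (snd (S v) (tchart AM c)) =
    tderiv (tatlas AM) (complete_lift AM Y v) (energy F1)"
    and "S v \<in> tangent_space (tatlas AM) v"
    and "fst (snd (S v) (tchart AM c)) = snd v c"
proof -
  let ?g = "\<lambda>w. tderiv (tatlas AM) (vertical_lift AM Y w) (energy F1)"
  let ?O = "snd c ` fst c \<times> (- {0 :: 'a})"
  have vT: "v \<in> TM AM" using v by (simp add: slit_TM_def)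
  have vC: "v \<in> fst (tchart AM c)" using vT c by (simp add: fst_tchart)
  have z: "(snd c (fst v), snd v c) \<in> ?O" using slit_TM_iff[OF AM vT c] v c by simp
  show Sv: "S v \<in> tangent_space (tatlas AM) v" and "fst (snd (S v) (tchart AM c)) = snd v c"
  proof -
    have sp: "spray AM S" using S unfolding canonical_spray_def by (rule conjunct1)
    show "S v \<in> tangent_space (tatlas AM) v"
      using sp v unfolding spray_def vector_field_on_def by blast
    show "fst (snd (S v) (tchart AM c)) = snd v c"
      using sp v c unfolding spray_def by blast
  qed
  have eq: "Wc c Y z = (?g \<circ> chart_inv (tchart AM c)) z" if zO: "z \<in> ?O" for z
  proof -
    obtain w where w: "w \<in> fst (tchart AM c)" "w \<in> slit_TM AM" "z = snd (tchart AM c) w"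
      using zO unfolding slit_tchart_image[OF AM c(1), symmetric] by blast
    have wc: "fst w \<in> fst c" using w(1) by (simp add: fst_tchart)
    have z': "z = (snd c (fst w), snd w c)" unfolding w(3) snd_tchart ..
    have "?g w = Wc c Y z"
      unfolding Wc_def z' using tderiv_vertical_lift_energy[OF Y w(2) c(1) wc] by simp
    moreover have "chart_inv (tchart AM c) z = w"
      unfolding w(3) by (rule chart_inv_chart[OF tchart_inj[OF AM c(1)] w(1)])
    ultimately show ?thesis by simp
  qed
  have d: "((?g \<circ> chart_inv (tchart AM c)) has_derivative frechet_derivative (Wc c Y) (at (snd c (fst v), snd v c)))
      (at (snd (tchart AM c) v))"
    unfolding snd_tchart[of AM c v]
    by (rule has_derivative_cong_open[OF smooth_on_has_derivative[OF smooth_Wc[OF Y c(1)] z] open_slit[OF c(1)] z eq])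
  then have "tderiv (tatlas AM) (S v) ?g = frechet_derivative (Wc c Y) (at (snd c (fst v), snd v c)) (snd (S v) (tchart AM c))"
    using tderiv_eq[OF smooth_atlas_tatlas[OF AM] Sv tchart_in[OF c(1)] vC, of ?g] frechet_derivative_eqI[OF d]
    by (auto simp: differentiable_def)
  moreover have "tderiv (tatlas AM) (S v) ?g - tderiv (tatlas AM) (complete_lift AM Y v) (energy F1) = 0"
    using S Y v unfolding canonical_spray_def by blast
  ultimately show "frechet_derivative (Wc c Y) (at (snd c (fst v), snd v c)) (snd (S v) (tchart AM c)) =
    tderiv (tatlas AM) (complete_lift AM Y v) (energy F1)" by simp
qed

lemma vs_atlas_tangent:
  "snd (tangent_of (vs_atlas :: (real, real) chart set) (UNIV, id) t 1) (UNIV, id) = 1"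
  "tangent_of (vs_atlas :: (real, real) chart set) (UNIV, id) t 1 \<in> tangent_space vs_atlas t"
  by (rule snd_tangent_of[OF smooth_atlas_vs_atlas] tangent_of_in[OF smooth_atlas_vs_atlas]; simp add: vs_atlas_def)+

lemma Wc_h_eq_0:
  assumes Y: "vector_field AM Y" "proj_vertical AM AN \<pi> Y" and x: "x \<in> slit_pullback AM AN \<pi>"
    and c: "c \<in> AM" "fst (h x) \<in> fst c"
  shows "Wc c Y (snd (tchart AM c) (h x)) = 0"
proof -
  obtain m v where mv: "x = (m, v)" by (cases x)
  have "tderiv (tatlas AM) (vertical_lift AM Y (h x)) (energy F1) = 0"
    using splitting Y x unfolding induced_splitting_def by blast
  then show ?thesis
    using tderiv_vertical_lift_energy[OF Y(1) h_nonzero[of m v] c(1)] x c(2) by (simp add: Wc_def snd_tchart mv)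
qed

text \<open>\<open>Wc\<close> is zero along a curve in the horizontal manifold with velocity
  \<open>S (h x)\<close>; its derivative at time 0 is the left-hand side.\<close>

lemma complete_lift_eq_0:
  assumes S: "canonical_spray AM F1 S" and tangent: "spray_tangent_to_image AM AN \<pi> h S"
    and Y: "vector_field AM Y" "proj_vertical AM AN \<pi> Y" and x: "x \<in> slit_pullback AM AN \<pi>"
  shows "tderiv (tatlas AM) (complete_lift AM Y (h x)) (energy F1) = 0"
proof -
  obtain m v where mv: "x = (m, v)" by (cases x)
  have hx: "h x \<in> slit_TM AM" using h_nonzero x mv by simp
  have hT: "h x \<in> TM AM" using hx by (simp add: slit_TM_def)
  then obtain c where c: "c \<in> AM" "fst (h x) \<in> fst c" by (auto simp: TM_iff points_def)
  note Sc = canonical_spray_chart[OF S Y(1) hx c]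
  obtain \<gamma> e where e: "e > 0" and \<gamma>: "smooth_map_on (vs_atlas :: (real, real) chart set) {-e<..<e} (tatlas AM) \<gamma>"
    and im: "\<gamma> ` {-e<..<e} \<subseteq> h ` pullback AM AN \<pi>"
    and vel: "tangent_map vs_atlas (tatlas AM) \<gamma> (tangent_of vs_atlas (UNIV, id) 0 1) = S (h x)"
    using tangent x unfolding spray_tangent_to_image_def tangent_to_def by blast
  have id: "(UNIV, id) \<in> (vs_atlas :: (real, real) chart set)" by (simp add: vs_atlas_def)
  \<comment> \<open>\<open>tangent_to\<close> gives only the velocity; the initial point
    \<open>\<gamma> 0 = h x\<close> is recovered from the base point of that tangent vector.\<close>
  have "fst (tangent_map vs_atlas (tatlas AM) \<gamma> (tangent_of (vs_atlas :: (real, real) chart set) (UNIV, id) 0 1)) = \<gamma> 0"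
    by (simp add: tangent_map_def Let_def)
  then have \<gamma>0: "\<gamma> 0 = h x" using vel tangent_space_fst[OF Sc(2)] by simp
  have C: "h x \<in> fst (tchart AM c)" using hT c by (simp add: fst_tchart)
  define \<beta> where "\<beta> = snd (tchart AM c) \<circ> \<gamma>"
  define T where "T = {t \<in> {-e<..<e}. \<gamma> t \<in> fst (tchart AM c)}"
  have Tim: "snd (UNIV, id) ` (fst (UNIV, id) \<inter> {-e<..<e} \<inter> \<gamma> -` fst (tchart AM c)) = T"
    by (auto simp: T_def)
  have T: "open T"
    using smooth_map_on_openD[OF \<gamma> smooth_atlas_imp_chart_atlas[OF smooth_atlas_vs_atlas]
        smooth_atlas_imp_chart_atlas[OF smooth_atlas_tatlas[OF AM]] id tchart_in[OF c(1)]] unfolding Tim .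
  have s\<beta>: "smooth_on T \<beta>"
    using smooth_map_onD[OF \<gamma> id tchart_in[OF c(1)]] unfolding Tim by (simp add: \<beta>_def inv_id)
  have T0: "0 \<in> T" using e C \<gamma>0 by (simp add: T_def)
  let ?O = "snd c ` fst c \<times> (- {0 :: 'a})"
  \<comment> \<open>The image of \<open>h\<close> contains zero vectors, where \<open>Wc\<close> is
    not controlled. By continuity the curve avoids them for times near 0.\<close>
  define T' where "T' = T \<inter> \<beta> -` ?O"
  have T': "open T'"
    unfolding T'_def by (rule continuous_open_preimage[OF smooth_on_continuous_on[OF s\<beta>] T open_slit[OF c(1)]])
  have \<beta>0: "\<beta> 0 = (snd c (fst (h x)), snd (h x) c)" by (simp add: \<beta>_def \<gamma>0 snd_tchart)
  have z: "\<beta> 0 \<in> ?O" using slit_TM_iff[OF AM hT c] hx c by (simp add: \<beta>0)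
  have T'0: "0 \<in> T'" using T0 z by (simp add: T'_def)
  have "tangent_map vs_atlas (tatlas AM) \<gamma> (tangent_of vs_atlas (UNIV, id) 0 1) =
    tangent_of (tatlas AM) (tchart AM c) (\<gamma> 0) (frechet_derivative \<beta> (at 0) 1)"
    using tangent_map_eq[OF smooth_atlas_vs_atlas smooth_atlas_tatlas[OF AM] \<gamma> _ vs_atlas_tangent(2) id _ tchart_in[OF c(1)], of 0]
      e C \<gamma>0 vs_atlas_tangent(1)[of 0] by (simp add: \<beta>_def inv_id)
  then have vel': "snd (S (h x)) (tchart AM c) = frechet_derivative \<beta> (at 0) 1"
    using vel snd_tangent_of[OF smooth_atlas_tatlas[OF AM] tchart_in[OF c(1)] C] \<gamma>0 by simp
  have W0: "Wc c Y (\<beta> t) = 0" if t: "t \<in> T'" for t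
  proof -
    have t': "t \<in> {-e<..<e}" "\<gamma> t \<in> fst (tchart AM c)" "\<beta> t \<in> ?O" using t by (auto simp: T'_def T_def)
    obtain m' v' where mv': "(m', v') \<in> pullback AM AN \<pi>" "\<gamma> t = h (m', v')" using im t'(1) by fastforce
    have fst': "fst (h (m', v')) = m'" using tangent_space_fst[OF h_in[OF mv'(1)]] .
    have "snd (h (m', v')) c \<noteq> 0" using t'(3) by (simp add: \<beta>_def mv'(2) snd_tchart)
    \<comment> \<open>\<open>h\<close> sends zero vectors to zero vectors, so a nonzero value comes
      from a nonzero argument, at which the splitting condition is available.\<close>
    then have "v' \<noteq> tzero (\<pi> m')"
      using h_tzero pullbackD(1)[OF mv'(1)] by (auto simp: tzero_def)
    then have x': "(m', v') \<in> slit_pullback AM AN \<pi>" using mv' by (simp add: slit_pullback_iff)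
    have "fst (h (m', v')) \<in> fst c" using t'(2) by (simp add: mv'(2) fst_tchart)
    then show ?thesis using Wc_h_eq_0[OF Y x' c(1)] by (simp add: \<beta>_def mv'(2))
  qed
  have "((\<lambda>t. Wc c Y (\<beta> t)) has_derivative (\<lambda>t. frechet_derivative (Wc c Y) (at (\<beta> 0)) (frechet_derivative \<beta> (at 0) t))) (at 0)"
    by (rule has_derivative_compose[OF smooth_on_has_derivative[OF s\<beta> T0] smooth_on_has_derivative[OF smooth_Wc[OF Y(1) c(1)] z]])
  moreover have "((\<lambda>t. Wc c Y (\<beta> t)) has_derivative (\<lambda>t. 0)) (at 0)"
    by (rule has_derivative_cong_open[OF has_derivative_const T' T'0]) (simp add: W0)
  ultimately have "frechet_derivative (Wc c Y) (at (\<beta> 0)) (frechet_derivative \<beta> (at 0) 1) = 0"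
    using has_derivative_unique by metis
  then show ?thesis using Sc(1) vel' \<beta>0 by simp
qed

lemma tangent_to_image:
  assumes S: "canonical_spray AM F1 S" and x: "x \<in> slit_pullback AM AN \<pi>"
    and cl: "\<And>Y. vector_field AM Y \<Longrightarrow> proj_vertical AM AN \<pi> Y \<Longrightarrow>
       tderiv (tatlas AM) (complete_lift AM Y (h x)) (energy F1) = 0"
  shows "tangent_to (tatlas AM) (h ` pullback AM AN \<pi>) (S (h x))"
proof -
  obtain m v where mv: "x = (m, v)" by (cases x)
  have pb: "(m, v) \<in> pullback AM AN \<pi>" and vn: "v \<noteq> tzero (\<pi> m)" using x mv by (auto simp: slit_pullback_iff)
  note pbD = pullbackD[OF pb]
  have hx: "h x \<in> slit_TM AM" using h_nonzero x mv by simp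
  have fst: "fst (h x) = m" using tangent_space_fst[OF h_in[OF pb]] mv by simp
  obtain c where c: "c \<in> AM" "m \<in> fst c" using pbD(1) by (auto simp: points_def)
  have "\<pi> m \<in> points AN" using pbD(1) \<pi>_surj by auto
  then obtain d where d: "d \<in> AN" "\<pi> m \<in> fst d" by (auto simp: points_def)
  interpret splitting_coords "snd c ` fst c" "Qc c d" "Pc c d" "Gc c" "Hc c d"
    by (rule splitting_coords[OF c(1) d(1)])
  define u where "u = snd (h x) c"
  define f where "f = snd (snd (S (h x)) (tchart AM c))"
  have cx: "fst (h x) \<in> fst c" using c fst by simp
  have uf: "snd (S (h x)) (tchart AM c) = (u, f)" if "vector_field AM Y" for Y
    using canonical_spray_chart(3)[OF S that hx c(1) cx] by (auto simp: u_def f_def prod_eq_iff)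
  have mQ: "snd c m \<in> Qc c d" by (rule Qc_chart[OF c d(2)])
  have vd: "snd v d \<noteq> 0"
    using vn tangent_eqI[OF AN pbD(2) tzero_inN[OF d] d] by (auto simp: tzero_def)
  have uH: "u = Hc c d (snd c m, snd v d)"
    using Hc_chart[OF c d pbD(2)] by (simp add: u_def mv)
  have spr: "\<exists>y. smooth_on (Qc c d) y \<and> y (snd c m) = z \<and>
       (\<forall>r\<in>Qc c d. frechet_derivative (Pc c d) (at r) (y r) = 0) \<and>
       frechet_derivative (\<lambda>w. frechet_derivative (Gc c) (at w) (0, y (fst w))) (at (snd c m, u)) (u, f) = 0"
    if z: "frechet_derivative (Pc c d) (at (snd c m)) z = 0" for z
  proof -
    obtain Y where Y: "vector_field AM Y" "proj_vertical AM AN \<pi> Y" "snd (Y m) c = z"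
      using vertical_extension[OF c d z] by metis
    have "smooth_on (Qc c d) (components c Y)"
      by (rule smooth_on_subset[OF smooth_on_components[OF AM Y(1) c(1)] QD])
    moreover have "components c Y (snd c m) = z"
      using Y(3) components_chart[OF atlas_inj[OF AM c(1)] c(2)] by simp
    moreover have "\<forall>r\<in>Qc c d. frechet_derivative (Pc c d) (at r) (components c Y r) = 0"
      using components_vertical[OF Y(1,2) c(1) d(1)] by blast
    moreover have "frechet_derivative (Wc c Y) (at (snd c m, u)) (u, f) = 0"
      using canonical_spray_chart(1)[OF S Y(1) hx c(1) cx] cl[OF Y(1,2)] uf[OF Y(1)] by (simp add: u_def fst)
    ultimately show ?thesis unfolding Wc_def by blast
  qed
  obtain e \<nu> where e: "e > 0" and \<nu>: "smooth_on {- e<..<e} \<nu>" "\<nu> 0 = snd v d"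
    and inQ: "\<And>t. t \<in> {- e<..<e} \<Longrightarrow> snd c m + t *\<^sub>R u \<in> Qc c d \<and> \<nu> t \<noteq> 0"
    and der: "((\<lambda>t. (snd c m + t *\<^sub>R u, Hc c d (snd c m + t *\<^sub>R u, \<nu> t))) has_derivative (\<lambda>t. t *\<^sub>R (u, f))) (at 0)"
    by (rule horizontal_curve[OF mQ vd uH spr]) (assumption | rule that)+
  let ?I = "{- e<..<e}"
  \<comment> \<open>The coordinate curve is carried back to the pullback bundle: \<open>mt\<close>
    gives the base points and \<open>vt\<close> the vectors over them. Then \<open>\<gamma>\<close>
    lies in the image of \<open>h\<close> by construction and has the chart expression
    \<open>\<alpha>\<close>.\<close>
  define mt where "mt t = chart_inv c (snd c m + t *\<^sub>R u)" for t
  define vt where "vt t = tangent_of AN d (\<pi> (mt t)) (\<nu> t)" for t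
  define \<gamma> where "\<gamma> t = h (mt t, vt t)" for t
  define \<alpha> where "\<alpha> t = (snd c m + t *\<^sub>R u, Hc c d (snd c m + t *\<^sub>R u, \<nu> t))" for t
  have I: "open ?I" "0 \<in> ?I" using e by auto
  have mtp: "mt t \<in> fst c" "snd c (mt t) = snd c m + t *\<^sub>R u" "\<pi> (mt t) \<in> fst d" if "t \<in> ?I" for t
    using inQ[OF that] chart_inv_in[of _ c] chart_chart_inv[of _ c] by (auto simp: mt_def Qc_iff[OF c(1)])
  have pbt: "(mt t, vt t) \<in> pullback AM AN \<pi>" if "t \<in> ?I" for t
    unfolding vt_def using pullback_chart[OF c(1) mtp(1)[OF that] d(1) mtp(3)[OF that]] .
  have \<gamma>C: "\<gamma> t \<in> fst (tchart AM c)" "snd (tchart AM c) (\<gamma> t) = \<alpha> t" if "t \<in> ?I" for t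
    using h_TM[OF pbt[OF that]] tangent_space_fst[OF h_in[OF pbt[OF that]]] mtp[OF that]
    by (simp_all add: \<gamma>_def fst_tchart snd_tchart \<alpha>_def Hc_def mt_def[symmetric] vt_def[symmetric])
  have s\<alpha>: "smooth_on ?I \<alpha>"
  proof -
    have 1: "smooth_on ?I (\<lambda>t. snd c m + t *\<^sub>R u)"
      by (intro smooth_on_add smooth_on_const smooth_on_linear[OF bounded_linear_scaleR_left] I)
    show ?thesis
      unfolding \<alpha>_def
      by (rule smooth_on_Pair[OF I(1) 1 smooth_on_compose[OF H I(1) smooth_on_Pair[OF I(1) 1 \<nu>(1)]]]) (use inQ in auto)
  qed
  have \<gamma>s: "smooth_on ?I (snd (tchart AM c) \<circ> \<gamma>)"
    by (rule smooth_on_cong[OF s\<alpha> I(1)]) (simp add: \<gamma>C)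
  have id: "(UNIV, id) \<in> (vs_atlas :: (real, real) chart set)" by (simp add: vs_atlas_def)
  have sm: "smooth_map_on (vs_atlas :: (real, real) chart set) ?I (tatlas AM) \<gamma>"
  proof (rule smooth_map_onI[OF smooth_atlas_vs_atlas smooth_atlas_tatlas[OF AM]])
    fix t assume t: "t \<in> ?I"
    have "?I \<subseteq> snd (UNIV, id) ` (fst (UNIV, id) \<inter> ?I \<inter> \<gamma> -` fst (tchart AM c))"
      using \<gamma>C by auto
    then show "\<exists>c\<in>vs_atlas. \<exists>d\<in>tatlas AM. \<exists>V. open V \<and> t \<in> fst c \<and> snd c t \<in> V \<and>
      V \<subseteq> snd c ` (fst c \<inter> ?I \<inter> \<gamma> -` fst d) \<and> smooth_on V (snd d \<circ> \<gamma> \<circ> chart_inv c)"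
      by (intro bexI[OF _ id] bexI[OF _ tchart_in[OF c(1)]] exI[of _ ?I]) (use t \<gamma>s in \<open>simp add: inv_id\<close>)
  qed
  have \<gamma>0: "\<gamma> 0 = h x"
    using atlas_inj[OF AM c(1)] c tangent_of_snd[OF AN pbD(2) d] by (simp add: \<gamma>_def vt_def mt_def \<nu>(2) mv)
  have "((snd (tchart AM c) \<circ> \<gamma>) has_derivative (\<lambda>t. t *\<^sub>R (u, f))) (at 0)"
    by (rule has_derivative_cong_open[OF der I]) (simp add: \<gamma>C \<alpha>_def)
  then have "frechet_derivative (snd (tchart AM c) \<circ> \<gamma>) (at 0) 1 = (u, f)"
    by (simp add: frechet_derivative_eqI)
  then have "tangent_map vs_atlas (tatlas AM) \<gamma> (tangent_of vs_atlas (UNIV, id) 0 1) =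
      tangent_of (tatlas AM) (tchart AM c) (h x) (u, f)"
    using tangent_map_eq[OF smooth_atlas_vs_atlas smooth_atlas_tatlas[OF AM] sm I(2) vs_atlas_tangent(2) id _
        tchart_in[OF c(1)]] \<gamma>C(1)[OF I(2)] vs_atlas_tangent(1)[of 0] by (simp add: inv_id \<gamma>0)
  also have "\<dots> = S (h x)"
  proof -
    \<comment> \<open>\<open>canonical_spray_chart\<close> speaks of a vector field; the extension
      of the zero vector serves as one.\<close>
    obtain Y where Y: "vector_field AM Y" "proj_vertical AM AN \<pi> Y" "snd (Y m) c = 0"
      using vertical_extension[OF c d linear_0[OF linP[OF mQ]]] by metis
    show ?thesis
      using tangent_of_snd[OF smooth_atlas_tatlas[OF AM] canonical_spray_chart(2)[OF S Y(1) hx c(1) cx]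
          tchart_in[OF c(1)]] \<gamma>C(1)[OF I(2)] \<gamma>0 uf[OF Y(1)] by simp
  qed
  finally have "tangent_map vs_atlas (tatlas AM) \<gamma> (tangent_of vs_atlas (UNIV, id) 0 1) = S (h x)" .
  moreover have "\<gamma> ` ?I \<subseteq> h ` pullback AM AN \<pi>"
    using pbt by (auto simp: \<gamma>_def)
  ultimately show ?thesis
    unfolding tangent_to_def using e sm by blast
qed

text \<open>At the zero vector, where the energy need not be differentiable, the value is 0 over
  every point. Elsewhere \<open>G_H_vertical_derivative\<close> provides the vanishing vertical
  derivative that \<open>constant_on_fibres\<close> integrates; equal energies give equal values
  since F1 is nonnegative.\<close>

lemma energy_h_constant:
  assumes conn: "connected_space (mtopology AF)"
    and cl: "\<And>Y x. vector_field AM Y \<Longrightarrow> proj_vertical AM AN \<pi> Y \<Longrightarrow> x \<in> slit_pullback AM AN \<pi> \<Longrightarrow>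
       tderiv (tatlas AM) (complete_lift AM Y (h x)) (energy F1) = 0"
    and x: "(m, v) \<in> pullback AM AN \<pi>" and x': "(m', v) \<in> pullback AM AN \<pi>"
  shows "F1 (h (m, v)) = F1 (h (m', v))"
proof (cases "v = tzero (fst v)")
  case True
  have "F1 (h (p, v)) = 0" if "(p, v) \<in> pullback AM AN \<pi>" for p
  proof -
    have "v = tzero (\<pi> p)" using True pullbackD(4)[OF that] by simp
    then have "h (p, v) = tzero p" using h_tzero[OF pullbackD(1)[OF that]] by simp
    then show ?thesis using finsler_tzero[OF finsler] h_TM[OF that] by metis
  qed
  then show ?thesis using x x' by metis
next
  case False
  note pbD = pullbackD[OF x] and pbD' = pullbackD[OF x']
  have "fst v \<in> points AN" using pbD(3) by (simp add: TM_iff)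
  then obtain d where d: "d \<in> AN" "fst v \<in> fst d" by (auto simp: points_def)
  have vd: "snd v d \<noteq> 0"
    using slit_TM_iff[OF AN pbD(3) d] False pbD(3) by (simp add: slit_TM_def)
  \<comment> \<open>off the fibre, \<open>v\<close> is continued with constant components in the chart \<open>d\<close>\<close>
  define val where "val p = energy F1 (h (p, tangent_of AN d (\<pi> p) (snd v d)))" for p
  have vv: "val p = energy F1 (h (p, v))" if "(p, v) \<in> pullback AM AN \<pi>" for p
    using tangent_of_snd[OF AN pullbackD(2)[OF that] d(1)] pullbackD(4)[OF that] d(2) by (simp add: val_def)
  have "val m = val m'"
  proof (rule constant_on_fibres[OF conn d _ pbD(1) _ pbD'(1)])
    show "\<pi> m = fst v" "\<pi> m' = fst v" using pbD(4) pbD'(4) by simp_all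
    fix p assume p: "p \<in> points AM" "\<pi> p = fst v"
    \<comment> \<open>The complete lift is expanded below, which is possible in this chart.\<close>
    define c where "c = chart_at AM p"
    have c: "c \<in> AM" "p \<in> fst c" using chart_at[OF p(1)] by (auto simp: c_def)
    have dp: "\<pi> p \<in> fst d" using d p by simp
    have v: "v \<in> tangent_space AN (\<pi> p)" using pbD(3) p(2) by (simp add: TM_iff)
    interpret splitting_coords "snd c ` fst c" "Qc c d" "Pc c d" "Gc c" "Hc c d"
      by (rule splitting_coords[OF c(1) d(1)])
    have pQ: "snd c p \<in> Qc c d" by (rule Qc_chart[OF c dp])
    have eq: "Gc c (q, Hc c d (q, snd v d)) = (val \<circ> chart_inv c) q" if q: "q \<in> Qc c d" for q
    proof -
      obtain r where r: "r \<in> fst c" "\<pi> r \<in> fst d" "q = snd c r" using q by (auto simp: Qc_def)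
      let ?v = "tangent_of AN d (\<pi> r) (snd v d)"
      have pb: "(r, ?v) \<in> pullback AM AN \<pi>" by (rule pullback_chart[OF c(1) r(1) d(1) r(2)])
      have "(q, Hc c d (q, snd v d)) = snd (tchart AM c) (h (r, ?v))"
        using r atlas_inj[OF AM c(1)] tangent_space_fst[OF h_in[OF pb]] by (simp add: Hc_def snd_tchart)
      moreover have "h (r, ?v) \<in> fst (tchart AM c)"
        using h_TM[OF pb] tangent_space_fst[OF h_in[OF pb]] r by (simp add: fst_tchart)
      ultimately show ?thesis
        using r tchart_inj[OF AM c(1)] atlas_inj[OF AM c(1)] by (simp add: Gc_def val_def)
    qed
    have xp: "(p, v) \<in> slit_pullback AM AN \<pi>"
      using pullbackI[OF p(1) v] False p(2) by (simp add: slit_pullback_iff)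
    have pbp: "(p, v) \<in> pullback AM AN \<pi>" by (rule pullbackI[OF p(1) v])
    have fsth: "fst (h (p, v)) = p" using tangent_space_fst[OF h_in[OF pbp]] .
    have vert: "frechet_derivative (\<lambda>q. Gc c (q, Hc c d (q, snd v d))) (at (snd c p)) w = 0 \<and>
        (\<lambda>q. Gc c (q, Hc c d (q, snd v d))) differentiable (at (snd c p))"
      if w: "frechet_derivative (Pc c d) (at (snd c p)) w = 0" for w
    proof -
      obtain Y where Y: "vector_field AM Y" "proj_vertical AM AN \<pi> Y" "snd (Y p) c = w"
        using vertical_extension[OF c d(1) dp w] by metis
      have "components c Y (snd c p) = w"
        using Y(3) components_chart[OF atlas_inj[OF AM c(1)] c(2)] by simp
      moreover have "smooth_on (Qc c d) (components c Y)"
        by (rule smooth_on_subset[OF smooth_on_components[OF AM Y(1) c(1)] QD])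
      moreover have "frechet_derivative (Gc c) (at (snd c p, Hc c d (snd c p, snd v d)))
         (components c Y (snd c p), frechet_derivative (components c Y) (at (snd c p)) (Hc c d (snd c p, snd v d))) = 0"
        using tderiv_complete_lift_energy[OF Y(1) h_nonzero[OF xp], of c] cl[OF Y(1,2) xp] fsth
          Hc_chart[OF c d(1) dp v] by (simp add: c_def)
      ultimately show ?thesis
        using G_H_vertical_derivative[OF pQ vd, of "components c Y"] components_vertical[OF Y(1,2) c(1) d(1)] by blast
    qed
    have cong: "frechet_derivative (\<lambda>q. Gc c (q, Hc c d (q, snd v d))) (at (snd c p)) =
        frechet_derivative (val \<circ> chart_inv c) (at (snd c p))"
      by (rule frechet_derivative_cong_open[OF Q pQ eq])
    have "(\<lambda>q. Gc c (q, Hc c d (q, snd v d))) differentiable (at (snd c p))"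
      using vert[OF linear_0[OF linP[OF pQ]]] by blast
    then have "(val \<circ> chart_inv c) differentiable (at (snd c p))"
      by (rule differentiable_cong_open[OF _ Q pQ eq])
    then show "\<exists>c\<in>AM. p \<in> fst c \<and> (val \<circ> chart_inv c) differentiable (at (snd c p)) \<and>
        (\<forall>w. frechet_derivative (Pc c d) (at (snd c p)) w = 0 \<longrightarrow>
           frechet_derivative (val \<circ> chart_inv c) (at (snd c p)) w = 0)"
      using vert c unfolding cong by blast
  qed
  then have "energy F1 (h (m, v)) = energy F1 (h (m', v))" using vv x x' by simp
  then show ?thesis
    using energy_le_iff[OF finsler h_TM[OF x] h_TM[OF x']] energy_le_iff[OF finsler h_TM[OF x'] h_TM[OF x]] by simp
qed

end

section \<open>The Finsler function on the base\<close>

context finsler_splitting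
begin

lemma linear_tangent_map_\<pi>:
  assumes m: "m \<in> points AM" and v: "v \<in> tangent_space AM m" and w: "w \<in> tangent_space AM m"
  shows "tangent_map AM AN \<pi> v \<in> tangent_space AN (\<pi> m)"
    and "tscale r v \<in> tangent_space AM m"
    and "tangent_map AM AN \<pi> (tscale r v) = tscale r (tangent_map AM AN \<pi> v)"
    and "tangent_map AM AN \<pi> (tadd v w) = tadd (tangent_map AM AN \<pi> v) (tangent_map AM AN \<pi> w)"
proof -
  obtain c where c: "c \<in> AM" "m \<in> fst c" using m by (auto simp: points_def)
  have "\<pi> m \<in> points AN" using m \<pi>_surj by auto
  then obtain d where d: "d \<in> AN" "\<pi> m \<in> fst d" by (auto simp: points_def)
  let ?L = "frechet_derivative (Pc c d) (at (snd c m))"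
  have L: "linear ?L" by (rule linear_Pc[OF c(1) d(1) Qc_chart[OF c d(2)]])
  show "tangent_map AM AN \<pi> v \<in> tangent_space AN (\<pi> m)"
    unfolding tangent_map_\<pi>[OF v c d] by (rule tangent_of_in[OF AN d])
  have rv: "tscale r v = tangent_of AM c m (r *\<^sub>R snd v c)"
    unfolding tangent_of_tscale[OF AM c] tangent_of_snd[OF AM v c] ..
  show rin: "tscale r v \<in> tangent_space AM m"
    unfolding rv by (rule tangent_of_in[OF AM c])
  show "tangent_map AM AN \<pi> (tscale r v) = tscale r (tangent_map AM AN \<pi> v)"
    unfolding tangent_map_\<pi>[OF rin c d] tangent_map_\<pi>[OF v c d] tangent_of_tscale[OF AN d, symmetric]
    by (simp add: tscale_def linear_scale[OF L])
  have vw: "tadd v w = tangent_of AM c m (snd v c + snd w c)"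
    unfolding tangent_of_tadd[OF AM c] tangent_of_snd[OF AM v c] tangent_of_snd[OF AM w c] ..
  have ain: "tadd v w \<in> tangent_space AM m"
    unfolding vw by (rule tangent_of_in[OF AM c])
  show "tangent_map AM AN \<pi> (tadd v w) = tadd (tangent_map AM AN \<pi> v) (tangent_map AM AN \<pi> w)"
    unfolding tangent_map_\<pi>[OF ain c d] tangent_map_\<pi>[OF v c d] tangent_map_\<pi>[OF w c d]
      tangent_of_tadd[OF AN d, symmetric]
    by (simp add: tadd_def linear_add[OF L])
qed

lemma pullback_tangent_map:
  "m \<in> points AM \<Longrightarrow> w \<in> tangent_space AM m \<Longrightarrow> (m, tangent_map AM AN \<pi> w) \<in> pullback AM AN \<pi>"
  by (rule pullbackI[OF _ linear_tangent_map_\<pi>(1)])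

lemma Gc_snd_tchart:
  "c \<in> AM \<Longrightarrow> w \<in> fst (tchart AM c) \<Longrightarrow> Gc c (snd (tchart AM c) w) = energy F1 w"
  by (simp add: Gc_def tchart_inj[OF AM])

text \<open>The segment from the splitting to \<open>w\<close> has vertical direction, so the
  splitting is critical along it, and all its points project to \<open>v\<close>. For nonzero
  \<open>v\<close> it therefore misses the zero vector and \<open>minimum\<close> applies.\<close>

lemma h_minimal:
  assumes m: "m \<in> points AM" and w: "w \<in> tangent_space AM m" and v: "v = tangent_map AM AN \<pi> w"
  shows "F1 (h (m, v)) \<le> F1 w"
proof -
  have pb: "(m, v) \<in> pullback AM AN \<pi>" unfolding v by (rule pullback_tangent_map[OF m w])
  have wT: "w \<in> TM AM" by (rule TM_I[OF w m])
  show ?thesis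
  proof (cases "v = tzero (\<pi> m)")
    case True
    then have "h (m, v) = tzero m" using h_tzero[OF m] by simp
    then show ?thesis using finsler_tzero[OF finsler] h_TM[OF pb] finsler_nonneg[OF finsler wT] by metis
  next
    case False
    obtain c where c: "c \<in> AM" "m \<in> fst c" using m by (auto simp: points_def)
    have "\<pi> m \<in> points AN" using m \<pi>_surj by auto
    then obtain d where d: "d \<in> AN" "\<pi> m \<in> fst d" by (auto simp: points_def)
    note pbD = pullbackD[OF pb]
    interpret splitting_coords "snd c ` fst c" "Qc c d" "Pc c d" "Gc c" "Hc c d"
      by (rule splitting_coords[OF c(1) d(1)])
    have mQ: "snd c m \<in> Qc c d" by (rule Qc_chart[OF c d(2)])
    have vd: "snd v d \<noteq> 0"
      using False tangent_eqI[OF AN pbD(2) tzero_inN[OF d] d] by (auto simp: tzero_def)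
    define u where "u = Hc c d (snd c m, snd v d)"
    let ?L = "frechet_derivative (Pc c d) (at (snd c m))"
    have L: "linear ?L" by (rule linP[OF mQ])
    have Lu: "?L u = snd v d" unfolding u_def by (rule Pc_Hc[OF c(1) d(1) mQ])
    have Lw: "?L (snd w c) = snd v d"
      using tangent_map_\<pi>_eq_iff[OF w c d pbD(2)] v by simp
    have Lz: "?L (snd w c - u) = 0" by (simp add: linear_diff[OF L] Lu Lw)
    have "Gc c (snd c m, u) \<le> Gc c (snd c m, u + (snd w c - u))"
    proof (rule minimum)
      show "u + t *\<^sub>R (snd w c - u) \<noteq> 0" for t
      proof
        assume "u + t *\<^sub>R (snd w c - u) = 0"
        then have "?L (u + t *\<^sub>R (snd w c - u)) = 0" using linear_0[OF L] by simp
        then show False using vd by (simp add: linear_add[OF L] linear_scale[OF L] Lu Lz)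
      qed
      show "frechet_derivative (Gc c) (at (snd c m, u)) (0, snd w c - u) = 0"
        unfolding u_def by (rule crit[OF mQ vd Lz[unfolded u_def]])
    qed (use c in auto)
    moreover have "snd (tchart AM c) (h (m, v)) = (snd c m, u)" "h (m, v) \<in> fst (tchart AM c)"
      using Hc_chart[OF c d pbD(2)] tangent_space_fst[OF h_in[OF pb]] h_TM[OF pb] c
      by (simp_all add: snd_tchart fst_tchart u_def)
    moreover have "snd (tchart AM c) w = (snd c m, snd w c)" "w \<in> fst (tchart AM c)"
      using tangent_space_fst[OF w] wT c by (simp_all add: snd_tchart fst_tchart)
    ultimately have "energy F1 (h (m, v)) \<le> energy F1 w"
      using Gc_snd_tchart[OF c(1), of w] Gc_snd_tchart[OF c(1), of "h (m, v)"] by simp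
    then show ?thesis using energy_le_iff[OF finsler h_TM[OF pb] wT] by simp
  qed
qed

text \<open>The base point is an arbitrary choice, which becomes irrelevant once constancy along the
  fibres is assumed.\<close>

definition F2 :: "('n, 'b) tangent \<Rightarrow> real" where
  "F2 v = F1 (h (SOME m. (m, v) \<in> pullback AM AN \<pi>, v))"

lemma pullback_over:
  assumes v: "v \<in> TM AN" shows "\<exists>m. (m, v) \<in> pullback AM AN \<pi>"
proof -
  have "fst v \<in> \<pi> ` points AM" using v \<pi>_surj by (simp add: TM_iff)
  then obtain m where "m \<in> points AM" "\<pi> m = fst v" by force
  then show ?thesis using v by (auto simp: pullback_def)
qed

section \<open>The pushed-down function, given constancy along the fibres\<close>

context
  assumes const: "\<And>m m' v. (m, v) \<in> pullback AM AN \<pi> \<Longrightarrow> (m', v) \<in> pullback AM AN \<pi> \<Longrightarrow>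
    F1 (h (m, v)) = F1 (h (m', v))"
begin

lemma F2_eq: "(m, v) \<in> pullback AM AN \<pi> \<Longrightarrow> F2 v = F1 (h (m, v))"
  unfolding F2_def by (rule const[OF someI])

text \<open>Together with attainment at \<open>h\<close>, this makes \<open>F2\<close> a quotient
  norm. Any point of the fibre may be used for the comparison, which is where constancy
  enters.\<close>

lemma F2_le:
  assumes "m \<in> points AM" "w \<in> tangent_space AM m"
  shows "F2 (tangent_map AM AN \<pi> w) \<le> F1 w"
  using h_minimal[OF assms refl] F2_eq[OF pullback_tangent_map[OF assms]] by simp

lemma F2_nonneg: "v \<in> TM AN \<Longrightarrow> F2 v \<ge> 0"
  using pullback_over[of v] F2_eq finsler_nonneg[OF finsler h_TM] by metis

lemma F2_scale_le:
  assumes v: "v \<in> TM AN" and r: "r > 0"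
  shows "F2 (tscale r v) \<le> r * F2 v" and "tscale r v \<in> TM AN"
proof -
  obtain m where pb: "(m, v) \<in> pullback AM AN \<pi>" using pullback_over[OF v] by blast
  note m = pullbackD(1)[OF pb] and h = h_in[OF pb]
  note lin = linear_tangent_map_\<pi>[OF m h h]
  have eq: "tangent_map AM AN \<pi> (tscale r (h (m, v))) = tscale r v"
    using lin(3) h_over[OF pb] by simp
  have "F2 (tscale r v) \<le> F1 (tscale r (h (m, v)))"
    using F2_le[OF m lin(2)] by (metis eq)
  then show "F2 (tscale r v) \<le> r * F2 v"
    using finsler_homogeneous[OF finsler h_TM[OF pb] r] F2_eq[OF pb] by simp
  show "tscale r v \<in> TM AN"
    using pullbackD(3)[OF pullback_tangent_map[OF m lin(2)]] by (metis eq)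
qed

text \<open>Obtained from minimality: a scaled lift is a competitor over the scaled vector, which
  gives one inequality, and scaling back by \<open>1 / r\<close> gives the other.\<close>

lemma F2_homogeneous:
  assumes v: "v \<in> TM AN" and r: "r > 0"
  shows "F2 (tscale r v) = r * F2 v"
proof (rule antisym)
  show "F2 (tscale r v) \<le> r * F2 v" by (rule F2_scale_le(1)[OF v r])
  have "tscale (1 / r) (tscale r v) = v" using r by (simp add: tscale_def)
  then have "F2 v \<le> 1 / r * F2 (tscale r v)"
    using F2_scale_le(1)[OF F2_scale_le(2)[OF v r], of "1 / r"] r by simp
  then show "r * F2 v \<le> F2 (tscale r v)" using r by (simp add: field_simps)
qed

lemma F2_chart:
  assumes c: "c \<in> AM" and d: "d \<in> AN" and q: "q \<in> Qc c d"
  shows "F2 (chart_inv (tchart AN d) (Pc c d q, w)) = F1 (chart_inv (tchart AM c) (q, Hc c d (q, w)))"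
proof -
  obtain m where m: "m \<in> fst c" "\<pi> m \<in> fst d" "q = snd c m" using q by (auto simp: Qc_def)
  let ?v = "tangent_of AN d (\<pi> m) w"
  have pb: "(m, ?v) \<in> pullback AM AN \<pi>" by (rule pullback_chart[OF c m(1) d m(2)])
  have "(q, Hc c d (q, w)) = snd (tchart AM c) (h (m, ?v))"
    using m atlas_inj[OF AM c] tangent_space_fst[OF h_in[OF pb]] by (simp add: Hc_def snd_tchart)
  moreover have "h (m, ?v) \<in> fst (tchart AM c)"
    using h_TM[OF pb] tangent_space_fst[OF h_in[OF pb]] m by (simp add: fst_tchart)
  ultimately have "chart_inv (tchart AM c) (q, Hc c d (q, w)) = h (m, ?v)"
    using tchart_inj[OF AM c] by simp
  moreover have "chart_inv (tchart AN d) (Pc c d q, w) = ?v"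
    using m atlas_inj[OF AN d] by (simp add: Pc_chart[OF c] tchart_inv[OF AN d])
  ultimately show ?thesis using F2_eq[OF pb] by simp
qed

lemma chart_over:
  assumes "n \<in> points AN" "d \<in> AN" "n \<in> fst d"
  obtains m c where "c \<in> AM" "m \<in> fst c" "\<pi> m = n" "m \<in> points AM"
  using assms \<pi>_surj by (metis imageE points_iff)

text \<open>Along a local section the function is F1 composed with the splitting over the section, a
  composition of smooth maps away from zero vectors.\<close>

lemma F2_smooth: "smooth_map_on (tatlas AN) (slit_TM AN) vs_atlas F2"
proof (rule smooth_map_onI[OF smooth_atlas_tatlas[OF AN] smooth_atlas_vs_atlas])
  fix v assume v: "v \<in> slit_TM AN"
  then have vT: "v \<in> TM AN" by (simp add: slit_TM_def)
  then have "fst v \<in> points AN" by (simp add: TM_iff)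
  then obtain d where d: "d \<in> AN" "fst v \<in> fst d" by (auto simp: points_def)
  obtain m c where c: "c \<in> AM" "m \<in> fst c" and m: "\<pi> m = fst v"
    using chart_over[OF \<open>fst v \<in> points AN\<close> d] by metis
  obtain N \<sigma> where N: "open N" "snd d (\<pi> m) \<in> N" and \<sigma>: "smooth_on N \<sigma>"
    and P\<sigma>: "\<And>z. z \<in> N \<Longrightarrow> \<sigma> z \<in> Qc c d \<and> Pc c d (\<sigma> z) = z"
    using local_section[OF c d(1)] d m by metis
  interpret splitting_coords "snd c ` fst c" "Qc c d" "Pc c d" "Gc c" "Hc c d"
    by (rule splitting_coords[OF c(1) d(1)])
  let ?V = "N \<times> (- {0 :: 'b})"
  have V: "open ?V" by (intro open_Times N) (simp add: open_Compl)
  have Nd: "N \<subseteq> snd d ` fst d"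
  proof
    fix z assume "z \<in> N"
    then have "\<sigma> z \<in> Qc c d" "Pc c d (\<sigma> z) = z" using P\<sigma> by auto
    then show "z \<in> snd d ` fst d" unfolding Qc_def using Pc_chart[OF c(1)] by fastforce
  qed
  have "?V \<subseteq> snd (tchart AN d) ` (fst (tchart AN d) \<inter> slit_TM AN \<inter> F2 -` fst (UNIV, id))"
    using slit_tchart_image[OF AN d(1)] Nd by auto
  moreover have "smooth_on ?V (snd (UNIV, id) \<circ> F2 \<circ> chart_inv (tchart AN d))"
  proof (rule smooth_on_cong[OF _ V])
    have 1: "smooth_on ?V (\<lambda>z. \<sigma> (fst z))"
      by (rule smooth_on_compose[OF \<sigma> V smooth_on_linear[OF bounded_linear_fst V]]) auto
    have 2: "smooth_on ?V (\<lambda>z. Hc c d (\<sigma> (fst z), snd z))"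
      by (rule smooth_on_compose[OF H V smooth_on_Pair[OF V 1 smooth_on_linear[OF bounded_linear_snd V]]])
        (use P\<sigma> in auto)
    show "smooth_on ?V (\<lambda>z. (F1 \<circ> chart_inv (tchart AM c)) (\<sigma> (fst z), Hc c d (\<sigma> (fst z), snd z)))"
      by (rule smooth_on_compose[OF slit_smooth_chart[OF AM finsler_smooth[OF finsler] c(1)] V
            smooth_on_Pair[OF V 1 2]]) (use P\<sigma> QD H_nonzero in auto)
    fix z assume "z \<in> ?V"
    then have "\<sigma> (fst z) \<in> Qc c d" "Pc c d (\<sigma> (fst z)) = fst z" using P\<sigma> by auto
    then show "(F1 \<circ> chart_inv (tchart AM c)) (\<sigma> (fst z), Hc c d (\<sigma> (fst z), snd z)) =
      (snd (UNIV, id) \<circ> F2 \<circ> chart_inv (tchart AN d)) z"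
      using F2_chart[OF c(1) d(1), of "\<sigma> (fst z)" "snd z"] by simp
  qed
  moreover have "snd (tchart AN d) v \<in> ?V"
    using N(2) m slit_TM_iff[OF AN vT d] v by (simp add: snd_tchart)
  moreover have "v \<in> fst (tchart AN d)" using vT d by (simp add: fst_tchart)
  moreover have "(UNIV, id) \<in> (vs_atlas :: (real, real) chart set)" by (simp add: vs_atlas_def)
  ultimately show "\<exists>c\<in>tatlas AN. \<exists>d\<in>vs_atlas. \<exists>V. open V \<and> v \<in> fst c \<and> snd c v \<in> V \<and>
      V \<subseteq> snd c ` (fst c \<inter> slit_TM AN \<inter> F2 -` fst d) \<and> smooth_on V (snd d \<circ> F2 \<circ> chart_inv c)"
    using V by (intro bexI[OF _ tchart_in[OF d(1)]] bexI[of _ "(UNIV, id)"] exI[of _ ?V] conjI)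
qed

text \<open>
  At the zero section the value is squeezed: a smooth local section of the bundle lifts tangent vectors
  linearly, and the splitting minimises the norm over each affine fibre.
\<close>

lemma F2_continuous: "continuous_map (mtopology (tatlas AN)) euclideanreal F2"
proof (rule continuous_map_chartI[OF smooth_atlas_tatlas[OF AN]])
  fix v assume "v \<in> points (tatlas AN)"
  then have vT: "v \<in> TM AN" by (simp add: points_tatlas[OF AN])
  then have "fst v \<in> points AN" by (simp add: TM_iff)
  then obtain d where d: "d \<in> AN" "fst v \<in> fst d" by (auto simp: points_def)
  have vC: "v \<in> fst (tchart AN d)" using vT d by (simp add: fst_tchart)
  have "isCont (F2 \<circ> chart_inv (tchart AN d)) (snd (tchart AN d) v)"
  proof (cases "snd v d = 0")
    case False
    have O: "open (snd d ` fst d \<times> (- {0 :: 'b}))"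
      by (intro open_Times open_chart[OF cN d(1)]) (simp add: open_Compl)
    have "snd (tchart AN d) v \<in> snd d ` fst d \<times> (- {0})" using d False by (simp add: snd_tchart)
    then show ?thesis
      by (rule bspec[OF smooth_on_continuous_on[OF slit_smooth_chart[OF AN F2_smooth d(1)],
            unfolded continuous_on_eq_continuous_at[OF O]]])
  next
    case True
    obtain m c where c: "c \<in> AM" "m \<in> fst c" and m: "\<pi> m = fst v"
      using chart_over[OF \<open>fst v \<in> points AN\<close> d] by metis
    obtain N \<sigma> where N: "open N" "snd d (\<pi> m) \<in> N" and \<sigma>: "smooth_on N \<sigma>" "\<sigma> (snd d (\<pi> m)) = snd c m"
      and P\<sigma>: "\<And>z. z \<in> N \<Longrightarrow> \<sigma> z \<in> Qc c d \<and> Pc c d (\<sigma> z) = z"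
      using local_section[OF c d(1)] d m by metis
    let ?V = "N \<times> (UNIV :: 'b set)" and ?z = "(snd d (\<pi> m), 0 :: 'b)"
    let ?f = "F2 \<circ> chart_inv (tchart AN d)"
    \<comment> \<open>F1 of the lift by the derivative of the section. Unlike the splitting, this
      lift is linear in the vector and continuous across the zero section, where it gives the value
      0.\<close>
    define \<Lambda> where "\<Lambda> z = (F1 \<circ> chart_inv (tchart AM c)) (\<sigma> (fst z), frechet_derivative \<sigma> (at (fst z)) (snd z))" for z
    have V: "open ?V" by (intro open_Times N open_UNIV)
    have 1: "smooth_on ?V fst" and 2: "smooth_on ?V snd"
      by (rule smooth_on_linear[OF bounded_linear_fst V], rule smooth_on_linear[OF bounded_linear_snd V])
    have 3: "smooth_on ?V (\<lambda>z. \<sigma> (fst z))" by (rule smooth_on_compose[OF \<sigma>(1) V 1]) auto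
    have 4: "smooth_on ?V (\<lambda>z. frechet_derivative \<sigma> (at (fst z)) (snd z))"
      by (rule smooth_on_deriv_compose[OF \<sigma>(1) V 1 2]) auto
    have "continuous_map (mtopology (tatlas AM)) euclideanreal F1"
      using finsler by (simp add: finsler_function_def)
    from continuous_map_chartD[OF smooth_atlas_imp_chart_atlas[OF smooth_atlas_tatlas[OF AM]] this tchart_in[OF c(1)]]
    have "continuous_on (snd c ` fst c \<times> UNIV) (F1 \<circ> chart_inv (tchart AM c))"
      unfolding tchart_full_image[OF AM c(1)] .
    then have "continuous_on ?V \<Lambda>"
      unfolding \<Lambda>_def
      by (rule continuous_on_compose2[OF _ continuous_on_Pair[OF smooth_on_continuous_on[OF 3] smooth_on_continuous_on[OF 4]]])
        (use P\<sigma> Qc_iff[OF c(1)] in auto)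
    then have cont: "isCont \<Lambda> ?z" unfolding continuous_on_eq_continuous_at[OF V] using N(2) by simp
    have "linear (frechet_derivative \<sigma> (at (snd d (\<pi> m))))" by (rule smooth_on_linear_deriv[OF \<sigma>(1) N(2)])
    then have "\<Lambda> ?z = F1 (chart_inv (tchart AM c) (snd c m, 0))" by (simp add: \<Lambda>_def \<sigma>(2) linear_0)
    also have "chart_inv (tchart AM c) (snd c m, 0) = tzero m"
      using tchart_inv[OF AM c(1), of "snd c m" 0] c atlas_inj[OF AM c(1)] tangent_of_0[OF AM c] by simp
    also have "F1 (tzero m) = 0"
      by (rule finsler_tzero[OF finsler TM_I[OF tzero_in[OF c] chart_point[OF c]]])
    finally have \<Lambda>0: "\<Lambda> ?z = 0" .
    \<comment> \<open>Differentiating \<open>Pc c d (\<sigma> r) = r\<close> shows that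
      \<open>?W\<close> projects to the vector with coordinates \<open>z\<close>, so it is a
      competitor in the minimisation.\<close>
    have bounds: "0 \<le> ?f z \<and> ?f z \<le> \<Lambda> z" if z: "z \<in> ?V" for z
    proof -
      obtain r w where rw: "z = (r, w)" "r \<in> N" using z by auto
      have \<sigma>Q: "\<sigma> r \<in> Qc c d" "Pc c d (\<sigma> r) = r" using P\<sigma>[OF rw(2)] by auto
      obtain p where p: "p \<in> fst c" "\<pi> p \<in> fst d" "\<sigma> r = snd c p" using \<sigma>Q(1) by (auto simp: Qc_def)
      let ?x = "frechet_derivative \<sigma> (at r) w"
      let ?W = "tangent_of AM c p ?x"
      have W: "?W \<in> tangent_space AM p" by (rule tangent_of_in[OF AM c(1) p(1)])
      have rp: "r = snd d (\<pi> p)" using \<sigma>Q(2) p Pc_chart[OF c(1) p(1)] by simp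
      have dP: "(Pc c d has_derivative frechet_derivative (Pc c d) (at (\<sigma> r))) (at (\<sigma> r))"
        by (rule smooth_on_has_derivative[OF smooth_Pc[OF c(1) d(1)] \<sigma>Q(1)])
      have "((\<lambda>r. Pc c d (\<sigma> r)) has_derivative (\<lambda>w. frechet_derivative (Pc c d) (at (\<sigma> r)) (frechet_derivative \<sigma> (at r) w))) (at r)"
        by (rule has_derivative_compose[OF smooth_on_has_derivative[OF \<sigma>(1) rw(2)] dP])
      moreover have "((\<lambda>r. Pc c d (\<sigma> r)) has_derivative (\<lambda>w. w)) (at r)"
        by (rule has_derivative_cong_open[OF has_derivative_ident N(1) rw(2)]) (use P\<sigma> in auto)
      ultimately have "frechet_derivative (Pc c d) (at (\<sigma> r)) ?x = w"
        using has_derivative_unique by metis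
      then have "tangent_map AM AN \<pi> ?W = tangent_of AN d (\<pi> p) w"
        unfolding tangent_map_\<pi>[OF W c(1) p(1) d(1) p(2)] snd_tangent_of[OF AM c(1) p(1)] p(3) by simp
      also have "\<dots> = chart_inv (tchart AN d) z"
        using tchart_inv[OF AN d(1), of r w] p(2) atlas_inj[OF AN d(1)] by (simp add: rw rp)
      finally have eq: "tangent_map AM AN \<pi> ?W = chart_inv (tchart AN d) z" .
      have pM: "p \<in> points AM" by (rule chart_point[OF c(1) p(1)])
      have "\<Lambda> z = F1 ?W"
        using tchart_inv[OF AM c(1), of "snd c p" ?x] p atlas_inj[OF AM c(1)] by (simp add: \<Lambda>_def rw)
      moreover have "F2 (chart_inv (tchart AN d) z) \<ge> 0"
        unfolding eq[symmetric] by (rule F2_nonneg[OF pullbackD(3)[OF pullback_tangent_map[OF pM W]]])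
      ultimately show ?thesis using F2_le[OF pM W] by (simp add: eq)
    qed
    have zV: "?z \<in> ?V" using N(2) by simp
    then have f0: "?f ?z = 0" using bounds[OF zV] \<Lambda>0 by simp
    have ev: "\<forall>\<^sub>F z in at ?z. z \<in> ?V" using V zV by (rule eventually_at_in_open')
    have "(?f \<longlongrightarrow> 0) (at ?z)"
    proof (rule tendsto_sandwich)
      show "((\<lambda>_. 0) \<longlongrightarrow> 0) (at ?z)" by (rule tendsto_const)
      show "(\<Lambda> \<longlongrightarrow> 0) (at ?z)" using cont \<Lambda>0 by (simp add: isCont_def)
      show "\<forall>\<^sub>F z in at ?z. 0 \<le> ?f z" using ev by (rule eventually_mono) (use bounds in blast)
      show "\<forall>\<^sub>F z in at ?z. ?f z \<le> \<Lambda> z" using ev by (rule eventually_mono) (use bounds in blast)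
    qed
    then have "isCont ?f ?z" using f0 by (simp add: isCont_def)
    moreover have "snd (tchart AN d) v = ?z" using True m by (simp add: snd_tchart)
    ultimately show ?thesis by simp
  qed
  then show "\<exists>c\<in>tatlas AN. v \<in> fst c \<and> isCont (F2 \<circ> chart_inv c) (snd c v)"
    using tchart_in[OF d(1)] vC by blast
qed

lemma F2_finsler: "finsler_function AN F2"
  unfolding finsler_function_def
proof (intro conjI ballI allI impI)
  show "F2 v \<ge> 0" if "v \<in> TM AN" for v by (rule F2_nonneg[OF that])
  show "continuous_map (mtopology (tatlas AN)) euclideanreal F2" by (rule F2_continuous)
  show "F2 (tscale r v) = r * F2 v" if "v \<in> TM AN" "r > 0" for v r by (rule F2_homogeneous[OF that])
  show "smooth_map_on (tatlas AN) (slit_TM AN) vs_atlas F2" by (rule F2_smooth)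
  fix d v assume d: "d \<in> AN" and v: "v \<in> slit_TM AN" and vd: "fst v \<in> fst d"
  have vT: "v \<in> TM AN" using v by (simp add: slit_TM_def)
  then have n: "fst v \<in> points AN" by (simp add: TM_iff)
  obtain m c where c: "c \<in> AM" "m \<in> fst c" and m: "\<pi> m = fst v"
    using chart_over[OF n d vd] by metis
  interpret splitting_coords "snd c ` fst c" "Qc c d" "Pc c d" "Gc c" "Hc c d"
    by (rule splitting_coords[OF c(1) d])
  have mQ: "snd c m \<in> Qc c d" by (rule Qc_chart[OF c]) (simp add: m vd)
  have Pm: "Pc c d (snd c m) = snd d (fst v)" using Pc_chart[OF c] m by simp
  have "positive_definite (fibre_hessian (energy F2 \<circ> chart_inv (tchart AN d)) (Pc c d (snd c m), snd v d))"
  proof (rule fibre_hessian_pushforward[OF mQ])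
    show "snd v d \<noteq> 0" using slit_TM_iff[OF AN vT d vd] v by simp
    show "open (snd d ` fst d)" by (rule open_chart[OF cN d])
    show "Pc c d (snd c m) \<in> snd d ` fst d" unfolding Pm using vd by simp
    show "smooth_on (snd d ` fst d \<times> (- {0})) (energy F2 \<circ> chart_inv (tchart AN d))"
      by (rule slit_energy_smooth_chart[OF AN F2_smooth d])
    show "(energy F2 \<circ> chart_inv (tchart AN d)) (Pc c d (snd c m), w) = Gc c (snd c m, Hc c d (snd c m, w))" for w
      using F2_chart[OF c(1) d mQ, of w] by (simp add: Gc_def energy_def)
  qed
  then show "positive_definite (fibre_hessian (energy F2 \<circ> chart_inv (tchart AN d)) (snd (tchart AN d) v))"
    by (simp add: Pm snd_tchart)
qed

text \<open>The image of the unit ball is bounded by \<open>F2_le\<close>; every vector of the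
  target ball is attained because its horizontal lift has the same norm.\<close>

lemma F2_submersion: "finsler_submersion AM F1 AN F2 \<pi>"
  unfolding finsler_submersion_def
proof (intro conjI ballI)
  show "\<pi> ` points AM = points AN" by (rule \<pi>_surj)
  fix m assume m: "m \<in> points AM"
  let ?T = "tangent_map AM AN \<pi>"
  note lin = linear_tangent_map_\<pi>[OF m]
  have lift: "h (m, v) \<in> tangent_space AM m \<and> ?T (h (m, v)) = v \<and> F2 v = F1 (h (m, v))"
    if "v \<in> tangent_space AN (\<pi> m)" for v
    using h_in h_over F2_eq pullbackI[OF m that] by blast
  show "minkowski_submersion (tangent_space AM m) F1 (tangent_space AN (\<pi> m)) F2 ?T"
    unfolding minkowski_submersion_def
  proof (intro conjI ballI allI)
    show "?T (tadd v w) = tadd (?T v) (?T w)" if "v \<in> tangent_space AM m" "w \<in> tangent_space AM m" for v w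
      by (rule lin(4)[OF that])
    show "?T (tscale r v) = tscale r (?T v)" if "v \<in> tangent_space AM m" for v r
      by (rule lin(3)[OF that that])
    show "?T ` tangent_space AM m = tangent_space AN (\<pi> m)"
    proof
      show "?T ` tangent_space AM m \<subseteq> tangent_space AN (\<pi> m)" using lin(1) by blast
      show "tangent_space AN (\<pi> m) \<subseteq> ?T ` tangent_space AM m" using lift by (metis image_eqI subsetI)
    qed
    show "?T ` {v \<in> tangent_space AM m. F1 v \<le> 1} = {w \<in> tangent_space AN (\<pi> m). F2 w \<le> 1}"
    proof
      show "?T ` {v \<in> tangent_space AM m. F1 v \<le> 1} \<subseteq> {w \<in> tangent_space AN (\<pi> m). F2 w \<le> 1}"
        using lin(1) F2_le[OF m] order_trans by blast
      show "{w \<in> tangent_space AN (\<pi> m). F2 w \<le> 1} \<subseteq> ?T ` {v \<in> tangent_space AM m. F1 v \<le> 1}"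
      proof
        fix w assume "w \<in> {w \<in> tangent_space AN (\<pi> m). F2 w \<le> 1}"
        then show "w \<in> ?T ` {v \<in> tangent_space AM m. F1 v \<le> 1}"
          using lift[of w] by (intro image_eqI[of _ _ "h (m, w)"]) auto
      qed
    qed
  qed
qed

end

end

theorem proposition6:
  fixes AM :: "('m, 'a::euclidean_space) chart set"
    and AN :: "('n, 'b::euclidean_space) chart set"
    and AF :: "('f, 'k::real_normed_vector) chart set"
    and \<pi> :: "'m \<Rightarrow> 'n"
    and F\<^sub>1 :: "('m, 'a) tangent \<Rightarrow> real"
    and h :: "'m \<times> ('n, 'b) tangent \<Rightarrow> ('m, 'a) tangent"
    and S\<^sub>1 :: "('m, 'a) tangent \<Rightarrow> (('m, 'a) tangent, 'a \<times> 'a) tangent"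
  assumes fibred: "smooth_fibre_bundle AM AN AF \<pi>"
    and connected_fibre: "connected_space (mtopology AF)"
    and finsler: "finsler_function AM F\<^sub>1"
    and splitting: "induced_splitting AM AN \<pi> F\<^sub>1 h"
    and spray: "canonical_spray AM F\<^sub>1 S\<^sub>1"
  shows "(spray_tangent_to_image AM AN \<pi> h S\<^sub>1 \<longleftrightarrow>
       (\<forall>Y. vector_field AM Y \<and> proj_vertical AM AN \<pi> Y \<longrightarrow>
          (\<forall>x \<in> slit_pullback AM AN \<pi>.
             tderiv (tatlas AM) (complete_lift AM Y (h x)) (energy F\<^sub>1) = 0))) \<and>
    (spray_tangent_to_image AM AN \<pi> h S\<^sub>1 \<longrightarrow>
       (\<forall>m m' v. (m, v) \<in> pullback AM AN \<pi> \<and> (m', v) \<in> pullback AM AN \<pi> \<longrightarrow>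
          F\<^sub>1 (h (m, v)) = F\<^sub>1 (h (m', v))) \<and>
       (\<exists>F\<^sub>2. (\<forall>(m, v) \<in> pullback AM AN \<pi>. F\<^sub>2 v = F\<^sub>1 (h (m, v))) \<and>
          finsler_function AN F\<^sub>2 \<and> finsler_submersion AM F\<^sub>1 AN F\<^sub>2 \<pi>))"
proof -
  interpret finsler_splitting AM AN AF \<pi> F\<^sub>1 h
    by unfold_locales (rule fibred, rule finsler, rule splitting)
  have clift: "tderiv (tatlas AM) (complete_lift AM Y (h x)) (energy F\<^sub>1) = 0"
    if "spray_tangent_to_image AM AN \<pi> h S\<^sub>1" "vector_field AM Y" "proj_vertical AM AN \<pi> Y"
      "x \<in> slit_pullback AM AN \<pi>" for Y x
    by (rule complete_lift_eq_0[OF spray that])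
  have tang: "spray_tangent_to_image AM AN \<pi> h S\<^sub>1"
    if "\<forall>Y. vector_field AM Y \<and> proj_vertical AM AN \<pi> Y \<longrightarrow>
          (\<forall>x \<in> slit_pullback AM AN \<pi>. tderiv (tatlas AM) (complete_lift AM Y (h x)) (energy F\<^sub>1) = 0)"
    unfolding spray_tangent_to_image_def
  proof
    fix x assume x: "x \<in> slit_pullback AM AN \<pi>"
    show "tangent_to (tatlas AM) (h ` pullback AM AN \<pi>) (S\<^sub>1 (h x))"
      by (rule tangent_to_image[OF spray x]) (use that x in blast)
  qed
  have const: "F\<^sub>1 (h (m, v)) = F\<^sub>1 (h (m', v))"
    if "spray_tangent_to_image AM AN \<pi> h S\<^sub>1" "(m, v) \<in> pullback AM AN \<pi>" "(m', v) \<in> pullback AM AN \<pi>" for m m' v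
    by (rule energy_h_constant[OF connected_fibre clift[OF that(1)] that(2,3)])
  have "\<exists>F\<^sub>2. (\<forall>(m, v) \<in> pullback AM AN \<pi>. F\<^sub>2 v = F\<^sub>1 (h (m, v))) \<and>
          finsler_function AN F\<^sub>2 \<and> finsler_submersion AM F\<^sub>1 AN F\<^sub>2 \<pi>"
    if t: "spray_tangent_to_image AM AN \<pi> h S\<^sub>1"
    using F2_eq[OF const[OF t]] F2_finsler[OF const[OF t]] F2_submersion[OF const[OF t]]
    by (intro exI[of _ F2]) auto
  then show ?thesis
    using clift tang const by blast
qed

end
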